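(* Let $d\ge 2$, let $E\subseteq\mathbb{R}^d$ be a nonempty connected open set, let $(c,p)$ be an admissible pair of inputs on $E$, and let $X$ be the Hunt process associated with $(c,p)$, with laws $\{\mathbb{P}_x\}_{x\in\hat E}$ (all as defined in the context). Let $$B=\{x\in E: x_i=x_j=x_k\text{ for some distinct indices } i,j,k\in\{1,\dots,d\}\}.$$ Then $$\mathbb{P}_x\big(X(t)\in B\text{ for some }t>0\big)=0\qquad\text{for every }x\in E.$$
   Context: Let $\mathcal{T}$ be the set of permutations of $\{1,\dots,d\}$ and, for $\tau\in\mathcal{T}$, let $E_\tau=\{x\in E: x_{\tau(1)}>x_{\tau(2)}>\dots>x_{\tau(d)}\}$. For a set $V$ contained in a finite-dimensional vector space, $C^1_{\mathcal{T}}(E;V)$ is the set of functions $f:E\to V$ that are continuous on $E$ and whose restriction to $E_\tau$ is continuously differentiable for every $\tau\in\mathcal{T}$. $\mathbb{S}^d_{++}$ denotes the symmetric positive definite $d\times d$ matrices. Admissible inputs: $c\in C^1_{\mathcal{T}}(E;\mathbb{S}^d_{++})$ and $p\in C^1_{\mathcal{T}}(E;(0,\infty))$ such that $cp$ is Lipschitz continuous on every compact subset of $E$. Up to Lebesgue null sets, define $(\mathrm{div}\,c)_i=\sum_{j=1}^d\partial_j c_{ij}$ and $b=\tfrac12\mathrm{div}\,c+\tfrac12 c\nabla\log p$. Let $d\mu(x)=p(x)\,dx$ on $E$. The bilinear form $\mathcal{E}(u,v)=\tfrac12\int_E\nabla u^\top c\nabla v\,p\,dx$, $u,v\in C_c^\infty(E)$,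 is closable on $L^2(E;\mu)$; its closure $(\mathcal{E},D(\mathcal{E}))$ is a symmetric, strongly local, regular Dirichlet form, with generator $(L,D(L))$, where $Lf=b^\top\nabla f+\tfrac12\mathrm{Tr}(c\nabla^2 f)$ for $f\in C_c^\infty(E)$. Let $\hat E=E\cup\{\Theta\}$ be the one-point compactification of $E$; real functions on $E$ are extended to $\hat E$ by the value $0$ at $\Theta$. The Hunt process associated with $(c,p)$: it is known (Baur, Grothaus and Stilgenbauer) that there is a filtered probability space $(\Omega,\mathcal{F},\{\mathcal{F}(t)\}_{t\ge0},\{\mathbb{P}_x\}_{x\in\hat E})$ supporting a Hunt process $X=\{X(t)\}_{t\ge 0}$ with state space $E$ and cemetery state $\Theta$, started at $x$ under $\mathbb{P}_x$, associated with $(\mathcal{E},D(\mathcal{E}))$ (its transition semigroup $(P_t)$ induces the $L^2(E;\mu)$-semigroup of $\mathcal{E}$), with continuous paths in $\hat E$ on $[0,\infty)$, such that for every $u\in D(L)$ and $x\in\hat E$ the process $u(X(t))-u(x)-\int_0^tLu(X(s))\,ds$ is an $(\mathcal{F}(t))$-martingale under $\mathbb{P}_x$, and such that for every $d<r<\infty$, $t>0$ and $f\in L^r(E;\mu)$ one has $P_tf\in C^0(E)$. $X$ denotes this process. *)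

theory Defs
  imports "HOL-Probability.Probability"
begin

section \<open>Coefficients\<close>

text \<open>
  The index type \<open>'d\<close> plays the role of \<open>{1,\<dots>,d}\<close>, with \<open>d = CARD('d)\<close>.  As \<open>'d\<close> carries no
  order, a permutation \<open>\<tau>\<close> is an enumeration \<open>\<tau> 1, \<dots>, \<tau> d\<close> of all the indices.
\<close>

definition perm_enum :: "(nat \<Rightarrow> 'd::finite) \<Rightarrow> bool" where
  "perm_enum \<tau> \<longleftrightarrow> bij_betw \<tau> {1..CARD('d)} UNIV"

definition chamber :: "(real^'d) set \<Rightarrow> (nat \<Rightarrow> 'd::finite) \<Rightarrow> (real^'d) set" where
  "chamber E \<tau> = {x \<in> E. \<forall>i\<in>{1..<CARD('d)}. x $ \<tau> i > x $ \<tau> (Suc i)}"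

definition C1_on :: "'a::euclidean_space set \<Rightarrow> ('a \<Rightarrow> 'b::euclidean_space) \<Rightarrow> bool" where
  "C1_on U f \<longleftrightarrow>
     (\<exists>f'. (\<forall>x\<in>U. (f has_derivative blinfun_apply (f' x)) (at x)) \<and> continuous_on U f')"

definition C1_T :: "(real^'d::finite) set \<Rightarrow> 'b::euclidean_space set \<Rightarrow> (real^'d \<Rightarrow> 'b) set" where
  "C1_T E V = {f. f ` E \<subseteq> V \<and> continuous_on E f \<and> (\<forall>\<tau>. perm_enum \<tau> \<longrightarrow> C1_on (chamber E \<tau>) f)}"

definition spd_matrices :: "(real^'d::finite^'d) set" where
  "spd_matrices = {A. transpose A = A \<and> (\<forall>v. v \<noteq> 0 \<longrightarrow> v \<bullet> (A *v v) > 0)}"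

definition admissible :: "(real^'d::finite) set \<Rightarrow> (real^'d \<Rightarrow> real^'d^'d) \<Rightarrow> (real^'d \<Rightarrow> real) \<Rightarrow> bool"
  where
  "admissible E c p \<longleftrightarrow>
     c \<in> C1_T E spd_matrices \<and> p \<in> C1_T E {0<..} \<and>
     (\<forall>K. compact K \<and> K \<subseteq> E \<longrightarrow> (\<exists>C. C-lipschitz_on K (\<lambda>x. p x *\<^sub>R c x)))"


section \<open>The Dirichlet form\<close>

text \<open>
  Elements of \<open>L\<^sup>r(\<mu>)\<close> are handled through representatives, functions defined on the whole ambient
  type, of which only the values on \<^term>\<open>space \<mu>\<close> matter.
\<close>

definition ref_measure :: "(real^'d::finite) set \<Rightarrow> (real^'d \<Rightarrow> real) \<Rightarrow> (real^'d) measure" where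
  "ref_measure E p = density (restrict_space lborel E) (\<lambda>x. ennreal (p x))"

definition Lr_fun :: "real \<Rightarrow> 'a measure \<Rightarrow> ('a \<Rightarrow> real) set" where
  "Lr_fun r \<mu> = {f \<in> borel_measurable \<mu>. integrable \<mu> (\<lambda>x. \<bar>f x\<bar> powr r)}"

definition L2_dist_sq :: "'a measure \<Rightarrow> ('a \<Rightarrow> real) \<Rightarrow> ('a \<Rightarrow> real) \<Rightarrow> real" where
  "L2_dist_sq \<mu> f g = (LINT x|\<mu>. (f x - g x)\<^sup>2)"

definition partial_deriv :: "'d::finite \<Rightarrow> (real^'d \<Rightarrow> real) \<Rightarrow> real^'d \<Rightarrow> real" where
  "partial_deriv i f x = frechet_derivative f (at x) (axis i 1)"

definition gradient :: "(real^'d::finite \<Rightarrow> real) \<Rightarrow> real^'d \<Rightarrow> real^'d" where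
  "gradient f x = (\<chi> i. partial_deriv i f x)"

fun C_k :: "nat \<Rightarrow> (real^'d::finite \<Rightarrow> real) \<Rightarrow> bool" where
  "C_k 0 f \<longleftrightarrow> continuous_on UNIV f"
| "C_k (Suc k) f \<longleftrightarrow> f differentiable_on UNIV \<and> (\<forall>i. C_k k (partial_deriv i f))"

text \<open>\<open>C\<^sub>c\<^sup>\<infinity>(E)\<close>, each function being extended by zero to the whole space.\<close>

definition test_fun :: "(real^'d::finite) set \<Rightarrow> (real^'d \<Rightarrow> real) set" where
  "test_fun E = {f. (\<forall>k. C_k k f) \<and> (\<exists>K. compact K \<and> K \<subseteq> E \<and> (\<forall>x. x \<notin> K \<longrightarrow> f x = 0))}"

definition pre_form ::
  "(real^'d::finite) set \<Rightarrow> (real^'d \<Rightarrow> real^'d^'d) \<Rightarrow> (real^'d \<Rightarrow> real) \<Rightarrow>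
   (real^'d \<Rightarrow> real) \<Rightarrow> (real^'d \<Rightarrow> real) \<Rightarrow> real" where
  "pre_form E c p u v = 1/2 * (LINT x:E|lborel. (gradient u x \<bullet> (c x *v gradient v x)) * p x)"

definition approximating ::
  "(real^'d::finite) set \<Rightarrow> (real^'d \<Rightarrow> real^'d^'d) \<Rightarrow> (real^'d \<Rightarrow> real) \<Rightarrow>
   (nat \<Rightarrow> real^'d \<Rightarrow> real) \<Rightarrow> (real^'d \<Rightarrow> real) \<Rightarrow> bool" where
  "approximating E c p U u \<longleftrightarrow>
     (\<forall>n. U n \<in> test_fun E) \<and>
     (\<forall>e>0. \<exists>N. \<forall>m\<ge>N. \<forall>n\<ge>N.
        pre_form E c p (\<lambda>x. U m x - U n x) (\<lambda>x. U m x - U n x) < e) \<and>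
     (\<lambda>n. L2_dist_sq (ref_measure E p) (U n) u) \<longlonglongrightarrow> 0"

definition form_domain ::
  "(real^'d::finite) set \<Rightarrow> (real^'d \<Rightarrow> real^'d^'d) \<Rightarrow> (real^'d \<Rightarrow> real) \<Rightarrow> (real^'d \<Rightarrow> real) set" where
  "form_domain E c p = {u \<in> Lr_fun 2 (ref_measure E p). \<exists>U. approximating E c p U u}"

text \<open>
  The closure of \<^term>\<open>pre_form E c p\<close>; closability is what makes the limit independent of the
  approximating sequences.
\<close>

definition closed_form ::
  "(real^'d::finite) set \<Rightarrow> (real^'d \<Rightarrow> real^'d^'d) \<Rightarrow> (real^'d \<Rightarrow> real) \<Rightarrow>
   (real^'d \<Rightarrow> real) \<Rightarrow> (real^'d \<Rightarrow> real) \<Rightarrow> real" where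
  "closed_form E c p u v =
     (THE e. \<forall>U V. approximating E c p U u \<and> approximating E c p V v \<longrightarrow>
                   (\<lambda>n. pre_form E c p (U n) (V n)) \<longlonglongrightarrow> e)"

text \<open>\<open>form_generator E c p u g\<close> means \<open>u \<in> D(L)\<close> and \<open>L u = g\<close>.\<close>

definition form_generator ::
  "(real^'d::finite) set \<Rightarrow> (real^'d \<Rightarrow> real^'d^'d) \<Rightarrow> (real^'d \<Rightarrow> real) \<Rightarrow>
   (real^'d \<Rightarrow> real) \<Rightarrow> (real^'d \<Rightarrow> real) \<Rightarrow> bool" where
  "form_generator E c p u g \<longleftrightarrow>
     u \<in> form_domain E c p \<and> g \<in> Lr_fun 2 (ref_measure E p) \<and>
     (\<forall>v\<in>form_domain E c p. closed_form E c p u v = - (LINT x|ref_measure E p. g x * v x))"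

definition L2_semigroup :: "'a measure \<Rightarrow> (real \<Rightarrow> ('a \<Rightarrow> real) \<Rightarrow> 'a \<Rightarrow> real) \<Rightarrow> bool" where
  "L2_semigroup \<mu> T \<longleftrightarrow>
     (\<forall>t\<ge>0. \<forall>f\<in>Lr_fun 2 \<mu>. T t f \<in> Lr_fun 2 \<mu> \<and>
        L2_dist_sq \<mu> (T t f) (\<lambda>_. 0) \<le> L2_dist_sq \<mu> f (\<lambda>_. 0)) \<and>
     (\<forall>t\<ge>0. \<forall>f\<in>Lr_fun 2 \<mu>. \<forall>g\<in>Lr_fun 2 \<mu>. \<forall>a b.
        AE x in \<mu>. T t (\<lambda>y. a * f y + b * g y) x = a * T t f x + b * T t g x) \<and>
     (\<forall>f\<in>Lr_fun 2 \<mu>. AE x in \<mu>. T 0 f x = f x) \<and>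
     (\<forall>s\<ge>0. \<forall>t\<ge>0. \<forall>f\<in>Lr_fun 2 \<mu>. AE x in \<mu>. T (s + t) f x = T s (T t f) x) \<and>
     (\<forall>f\<in>Lr_fun 2 \<mu>. ((\<lambda>t. L2_dist_sq \<mu> (T t f) f) \<longlongrightarrow> 0) (at_right 0))"

definition semigroup_generator ::
  "'a measure \<Rightarrow> (real \<Rightarrow> ('a \<Rightarrow> real) \<Rightarrow> 'a \<Rightarrow> real) \<Rightarrow> ('a \<Rightarrow> real) \<Rightarrow> ('a \<Rightarrow> real) \<Rightarrow> bool" where
  "semigroup_generator \<mu> T u g \<longleftrightarrow>
     u \<in> Lr_fun 2 \<mu> \<and> g \<in> Lr_fun 2 \<mu> \<and>
     ((\<lambda>t. L2_dist_sq \<mu> (\<lambda>x. (T t u x - u x) / t) g) \<longlongrightarrow> 0) (at_right 0)"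

definition form_semigroup ::
  "(real^'d::finite) set \<Rightarrow> (real^'d \<Rightarrow> real^'d^'d) \<Rightarrow> (real^'d \<Rightarrow> real) \<Rightarrow>
   (real \<Rightarrow> (real^'d \<Rightarrow> real) \<Rightarrow> real^'d \<Rightarrow> real) \<Rightarrow> bool" where
  "form_semigroup E c p T \<longleftrightarrow>
     L2_semigroup (ref_measure E p) T \<and>
     (\<forall>u g. semigroup_generator (ref_measure E p) T u g \<longleftrightarrow> form_generator E c p u g)"


section \<open>Hunt processes\<close>

definition borel_of_top :: "'a topology \<Rightarrow> 'a measure" where
  "borel_of_top S = sigma (topspace S) {U. openin S U}"

text \<open>
  Functions on the state space extended by zero to the cemetery state, which is \<^term>\<open>None\<close>;
  a state \<open>x\<close> is \<^term>\<open>Some x\<close>.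
\<close>

definition ext0 :: "('a \<Rightarrow> real) \<Rightarrow> 'a option \<Rightarrow> real" where
  "ext0 f = case_option 0 f"

text \<open>The state at a random time, with the convention that the process is dead at time infinity.\<close>

definition at_time :: "(real \<Rightarrow> 'w \<Rightarrow> 'a option) \<Rightarrow> ('w \<Rightarrow> ennreal) \<Rightarrow> 'w \<Rightarrow> 'a option" where
  "at_time X \<sigma> \<omega> = (if \<sigma> \<omega> = \<infinity> then None else X (enn2real (\<sigma> \<omega>)) \<omega>)"

text \<open>
  The state space is \<open>S\<close>, \<open>M\<close> carries the sigma-algebra of all events (its measure is irrelevant)
  and \<open>P x\<close> is the law started at \<open>x\<close>.  The filtration is indexed by the extended half line;
  \<open>F \<infinity>\<close> may be any sigma-algebra of events containing all the \<open>F t\<close>.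
\<close>

locale hunt_process = filtration "space M" F
  for S :: "'a topology" and M :: "'w measure" and F :: "ennreal \<Rightarrow> 'w measure"
    and P :: "'a option \<Rightarrow> 'w measure" and X :: "real \<Rightarrow> 'w \<Rightarrow> 'a option" +
  assumes subalgebra_F: "subalgebra M (F t)"
    and right_continuous_F: "t < \<infinity> \<Longrightarrow> sets (F t) = (\<Inter>s\<in>{t<..}. sets (F s))"
    and prob_space_P: "x \<in> topspace (Alexandroff_compactification S) \<Longrightarrow> prob_space (P x)"
    and sets_P: "x \<in> topspace (Alexandroff_compactification S) \<Longrightarrow> sets (P x) = sets M"
    and adapted: "0 \<le> t \<Longrightarrow>
      X t \<in> F (ennreal t) \<rightarrow>\<^sub>M borel_of_top (Alexandroff_compactification S)"
    and measurable_P: "0 \<le> t \<Longrightarrow> A \<in> sets (borel_of_top (Alexandroff_compactification S)) \<Longrightarrow>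
      (\<lambda>x. measure (P x) {\<omega>\<in>space M. X t \<omega> \<in> A})
        \<in> borel_measurable (borel_of_top (Alexandroff_compactification S))"
    and start: "x \<in> topspace (Alexandroff_compactification S) \<Longrightarrow> AE \<omega> in P x. X 0 \<omega> = x"
    and cemetery: "\<omega> \<in> space M \<Longrightarrow> 0 \<le> s \<Longrightarrow> s \<le> t \<Longrightarrow> X s \<omega> = None \<Longrightarrow> X t \<omega> = None"
    and right_continuous_X: "\<omega> \<in> space M \<Longrightarrow> 0 \<le> t \<Longrightarrow>
      limitin (Alexandroff_compactification S) (\<lambda>s. X s \<omega>) (X t \<omega>) (at_right t)"
    and left_limits_X: "\<omega> \<in> space M \<Longrightarrow> 0 < t \<Longrightarrow>
      \<exists>l. limitin (Alexandroff_compactification S) (\<lambda>s. X s \<omega>) l (at_left t)"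
    and strong_markov: "x \<in> topspace (Alexandroff_compactification S) \<Longrightarrow> stopping_time F \<sigma> \<Longrightarrow>
      0 \<le> s \<Longrightarrow> A \<in> sets (borel_of_top (Alexandroff_compactification S)) \<Longrightarrow>
      AE \<omega> in P x.
        real_cond_exp (P x) (pre_sigma \<sigma>)
          (indicator {\<omega>\<in>space M. at_time X (\<lambda>\<omega>. \<sigma> \<omega> + ennreal s) \<omega> \<in> A}) \<omega>
        = measure (P (at_time X \<sigma> \<omega>)) {\<omega>'\<in>space M. X s \<omega>' \<in> A}"
    and quasi_left_continuous: "x \<in> topspace (Alexandroff_compactification S) \<Longrightarrow>
      (\<And>n. stopping_time F (\<sigma>n n)) \<Longrightarrow> stopping_time F \<sigma> \<Longrightarrow>
      (\<And>\<omega>. \<omega> \<in> space M \<Longrightarrow> incseq (\<lambda>n. \<sigma>n n \<omega>) \<and> (\<lambda>n. \<sigma>n n \<omega>) \<longlonglongrightarrow> \<sigma> \<omega>) \<Longrightarrow>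
      AE \<omega> in P x. \<sigma> \<omega> < \<infinity> \<longrightarrow>
        limitin (Alexandroff_compactification S) (\<lambda>n. at_time X (\<sigma>n n) \<omega>) (at_time X \<sigma> \<omega>)
          sequentially"

definition transition ::
  "('a option \<Rightarrow> 'w measure) \<Rightarrow> (real \<Rightarrow> 'w \<Rightarrow> 'a option) \<Rightarrow> real \<Rightarrow> ('a \<Rightarrow> real) \<Rightarrow> 'a \<Rightarrow> real" where
  "transition P X t f x = (LINT \<omega>|P (Some x). ext0 f (X t \<omega>))"

definition is_martingale ::
  "'w measure \<Rightarrow> (ennreal \<Rightarrow> 'w measure) \<Rightarrow> (real \<Rightarrow> 'w \<Rightarrow> real) \<Rightarrow> bool" where
  "is_martingale Q F Y \<longleftrightarrow>
     (\<forall>t\<ge>0. Y t \<in> borel_measurable (F (ennreal t)) \<and> integrable Q (Y t)) \<and>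
     (\<forall>s t. 0 \<le> s \<and> s \<le> t \<longrightarrow>
        (AE \<omega> in Q. real_cond_exp Q (F (ennreal s)) (Y t) \<omega> = Y s \<omega>))"

text \<open>
  The Hunt process associated with \<open>(c,p)\<close>: path continuity, association with the Dirichlet form,
  the martingale problem for the generator, and the strong Feller property on \<open>L\<^sup>r\<close>, \<open>r > d\<close>.

  The martingale property involves the value \<open>u(x)\<close> of a class \<open>u \<in> L\<^sup>2(E;\<mu>)\<close> and requires the
  process in question to be integrable.  A general \<open>u \<in> D(L)\<close> guarantees neither (take \<open>d \<ge> 4\<close>), so
  the property is required whenever the representative \<open>u\<close> is continuous and the integrability
  holds; without these provisos no process would satisfy the definition.
\<close>

definition associated_hunt_process ::
  "(real^'d::finite) set \<Rightarrow> (real^'d \<Rightarrow> real^'d^'d) \<Rightarrow> (real^'d \<Rightarrow> real) \<Rightarrow>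
   'w measure \<Rightarrow> (ennreal \<Rightarrow> 'w measure) \<Rightarrow> ((real^'d) option \<Rightarrow> 'w measure) \<Rightarrow>
   (real \<Rightarrow> 'w \<Rightarrow> (real^'d) option) \<Rightarrow> bool" where
  "associated_hunt_process E c p M F P X \<longleftrightarrow>
     hunt_process (top_of_set E) M F P X \<and>
     (\<forall>\<omega>\<in>space M. continuous_map (top_of_set {0..})
        (Alexandroff_compactification (top_of_set E)) (\<lambda>t. X t \<omega>)) \<and>
     (\<exists>T. form_semigroup E c p T \<and>
        (\<forall>t\<ge>0. \<forall>f\<in>Lr_fun 2 (ref_measure E p).
           AE x in ref_measure E p. transition P X t f x = T t f x)) \<and>
     (\<forall>u g x. form_generator E c p u g \<and> continuous_on E u \<and>
        x \<in> topspace (Alexandroff_compactification (top_of_set E)) \<and>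
        (\<forall>t\<ge>0. integrable (P x) (\<lambda>\<omega>. ext0 u (X t \<omega>)) \<and>
          (\<integral>\<^sup>+\<omega>. (\<integral>\<^sup>+s\<in>{0..t}. ennreal \<bar>ext0 g (X s \<omega>)\<bar> \<partial>lborel) \<partial>P x) < \<infinity>)
        \<longrightarrow> is_martingale (P x) F
              (\<lambda>t \<omega>. ext0 u (X t \<omega>) - ext0 u x - (LINT s:{0..t}|lborel. ext0 g (X s \<omega>)))) \<and>
     (\<forall>r t f. real CARD('d) < r \<and> 0 < t \<and> f \<in> Lr_fun r (ref_measure E p) \<longrightarrow>
        (\<forall>x\<in>E. integrable (P (Some x)) (\<lambda>\<omega>. ext0 f (X t \<omega>))) \<and>
        continuous_on E (transition P X t f))"


section \<open>Triple collisions\<close>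

definition triple_points :: "(real^'d::finite) set \<Rightarrow> (real^'d) set" where
  "triple_points E =
     {x \<in> E. \<exists>i j k. i \<noteq> j \<and> j \<noteq> k \<and> i \<noteq> k \<and> x $ i = x $ j \<and> x $ j = x $ k}"

end

theory Submission
  imports Defs
begin

text \<open>
  The set of triple points has codimension two, so it carries test functions that are at least \<open>1\<close> near
  it and have arbitrarily small norm \<open>\<E>(u,u) + \<parallel>u\<parallel>\<^sup>2\<close> (a truncated logarithmic potential).  For such
  a \<open>u\<close> and a time step \<open>h\<close>, the discounted hitting probability of \<open>{u > 1}\<close> along the grid \<open>h \<nat>\<close> is
  harmonic off \<open>{u > 1}\<close>; as \<open>P\<^sub>h\<close> is a symmetric contraction, its \<open>L\<^sup>2\<close> norm is bounded by the norm of \<open>u\<close>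
  uniformly in \<open>h\<close>, and path continuity turns this into a bound for the hitting probability in continuous
  time.  Hence almost every starting point fails to reach the triple points, and the strong Feller
  property, which makes the law of \<open>X \<delta>\<close> absolutely continuous, removes the exceptional starting points.
\<close>

subsection \<open>Smooth functions\<close>

text \<open>Two obstacles shape the proof. The \<open>L\<^sup>2\<close> semigroup is known only
  through its generator, so symmetry and the energy bound for P_h are extracted from the generator
  on test functions, and symmetry is then carried to bounded functions by monotone class arguments
  for the kernel. That test functions lie in the generator domain is where the local Lipschitz
  continuity of c p enters: c and p may have kinks where two coordinates agree, and a jump of the
  flux p c grad u across such a hyperplane would put a surface measure into its divergence.
  Codimension two is critical for the logarithm: the squared gradient of log(1/r) is r^(-2), whose
  integral grows only like the number n of dyadic scales kept by the truncation, while normalising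
  the height to 1 gains a factor n^2. The energy is thus O(1/n). The time grid replaces equilibrium
  potentials and quasi-continuous versions by a recursion with P_h. The discount e^(-h) per step
  produces the factor 1 - e^(-h) on both sides of the comparison, so the step size cancels.\<close>

lemma partial_deriv_eq:
  "(f has_derivative f') (at x) \<Longrightarrow> partial_deriv i f x = f' (axis i 1)"
  unfolding partial_deriv_def by (metis frechet_derivative_at)

lemma C_k_SucI:
  assumes "\<And>x. (f has_derivative f' x) (at x)" and "\<And>i. C_k k (\<lambda>x. f' x (axis i 1))"
  shows "C_k (Suc k) f"
proof -
  have "partial_deriv i f = (\<lambda>x. f' x (axis i 1))" for i
    using partial_deriv_eq[OF assms(1)] by (rule ext)
  then show ?thesis
    using assms by (auto simp: differentiable_on_def intro!: differentiableI)
qed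

lemma C_k_Suc_has_derivative:
  "C_k (Suc k) f \<Longrightarrow> (f has_derivative frechet_derivative f (at x)) (at x)"
  by (auto simp: differentiable_on_def frechet_derivative_works)

lemma C_k_Suc_imp: "C_k (Suc k) f \<Longrightarrow> C_k k f"
proof (induction k arbitrary: f)
  case 0
  then show ?case by (auto intro: differentiable_imp_continuous_on)
next
  case (Suc k)
  from Suc.prems have "f differentiable_on UNIV" "\<And>i. C_k (Suc k) (partial_deriv i f)"
    by simp_all
  with Suc.IH show ?case by simp
qed

lemma C_k_continuous: "C_k k f \<Longrightarrow> continuous_on UNIV f"
  by (cases k) (auto intro: differentiable_imp_continuous_on)

lemma C_k_const: "C_k k (\<lambda>_. c)"
  by (induction k arbitrary: c) (auto intro!: C_k_SucI[where f'="\<lambda>_ _. 0"] simp del: C_k.simps(2))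

lemma C_k_add: "C_k k f \<Longrightarrow> C_k k g \<Longrightarrow> C_k k (\<lambda>x. f x + g x)"
proof (induction k arbitrary: f g)
  case 0
  then show ?case by (auto intro: continuous_on_add)
next
  case (Suc k)
  show ?case
    by (rule C_k_SucI[OF has_derivative_add[OF C_k_Suc_has_derivative[OF Suc.prems(1)]
          C_k_Suc_has_derivative[OF Suc.prems(2)]]])
       (use Suc in \<open>auto simp: partial_deriv_def[abs_def]\<close>)
qed

lemma C_k_mult: "C_k k f \<Longrightarrow> C_k k g \<Longrightarrow> C_k k (\<lambda>x. f x * g x)"
proof (induction k arbitrary: f g)
  case 0
  then show ?case by (auto intro: continuous_on_mult)
next
  case (Suc k)
  show ?case
    by (rule C_k_SucI[OF has_derivative_mult[OF C_k_Suc_has_derivative[OF Suc.prems(1)]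
          C_k_Suc_has_derivative[OF Suc.prems(2)]]], rule C_k_add)
       (use Suc C_k_Suc_imp[OF Suc.prems(1)] C_k_Suc_imp[OF Suc.prems(2)] in
         \<open>auto simp: partial_deriv_def[abs_def]\<close>)
qed

lemma C_k_prod: "(\<And>i. i \<in> I \<Longrightarrow> C_k k (f i)) \<Longrightarrow> C_k k (\<lambda>x. \<Prod>i\<in>I. f i x)"
  by (induction I rule: infinite_finite_induct) (auto intro: C_k_const C_k_mult)

lemma C_k_nth: "C_k k (\<lambda>x. x $ i)"
proof (cases k)
  case 0
  then show ?thesis by (auto intro: continuous_intros)
next
  case (Suc m)
  have "((\<lambda>x. x $ i) has_derivative (\<lambda>h. h $ i)) (at x)" for x
    by (rule bounded_linear_imp_has_derivative) (rule bounded_linear_vec_nth)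
  from C_k_SucI[OF this C_k_const] show ?thesis
    using Suc by simp
qed

text \<open>A whole chain \<open>D\<close> of successive derivatives is carried along so that the
  induction closes: the chain rule turns \<open>D n\<close> into \<open>D (Suc n)\<close> times a
  partial derivative. The set \<open>S\<close> admits functions such as \<open>ln\<close> that are
  differentiable only on part of the line.\<close>

lemma C_k_comp_family:
  fixes D :: "nat \<Rightarrow> real \<Rightarrow> real"
  assumes D: "\<And>n x. x \<in> S \<Longrightarrow> (D n has_field_derivative D (Suc n) x) (at x)"
    and "C_k k f" and S: "\<And>x. f x \<in> S"
  shows "C_k k (\<lambda>x. D n (f x))"
  using assms(2) S
proof (induction k arbitrary: n)
  case 0
  have "continuous_on S (D n)"
    using D by (meson DERIV_continuous continuous_at_imp_continuous_on)
  with 0 show ?case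
    by (auto intro!: continuous_on_compose2[of S "D n"])
next
  case (Suc k)
  have "((\<lambda>x. D n (f x)) has_derivative (\<lambda>h. D (Suc n) (f x) * frechet_derivative f (at x) h)) (at x)"
    for x
    by (rule has_derivative_compose[OF C_k_Suc_has_derivative[OF Suc.prems(1)],
          where g'="(*) (D (Suc n) (f x))"])
       (use D[OF Suc.prems(2)] in \<open>simp add: has_field_derivative_def\<close>)
  moreover have "C_k k (\<lambda>x. D (Suc n) (f x) * partial_deriv i f x)" for i
    using Suc.prems by (intro C_k_mult[OF Suc.IH[OF C_k_Suc_imp]]) auto
  ultimately show ?case
    by (intro C_k_SucI) (auto simp: partial_deriv_def[abs_def])
qed

definition smooth :: "(real^'d::finite \<Rightarrow> real) \<Rightarrow> bool" where
  "smooth f \<longleftrightarrow> (\<forall>k. C_k k f)"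

lemma smooth_const [intro]: "smooth (\<lambda>_. c)"
  and smooth_nth [intro]: "smooth (\<lambda>x. x $ i)"
  and smooth_add [intro]: "smooth f \<Longrightarrow> smooth g \<Longrightarrow> smooth (\<lambda>x. f x + g x)"
  and smooth_mult [intro]: "smooth f \<Longrightarrow> smooth g \<Longrightarrow> smooth (\<lambda>x. f x * g x)"
  by (auto simp: smooth_def C_k_const C_k_nth C_k_add C_k_mult)

lemma smooth_prod [intro]: "(\<And>i. i \<in> I \<Longrightarrow> smooth (f i)) \<Longrightarrow> smooth (\<lambda>x. \<Prod>i\<in>I. f i x)"
  by (auto simp: smooth_def C_k_prod)

lemma smooth_minus [intro]: "smooth f \<Longrightarrow> smooth g \<Longrightarrow> smooth (\<lambda>x. f x - g x)"
  using smooth_add[OF _ smooth_mult[OF smooth_const[of "-1"]], of f g] by simp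

lemma smooth_power [intro]: "smooth f \<Longrightarrow> smooth (\<lambda>x. f x ^ n)"
  by (induction n) auto

lemma smooth_exp [intro]: "smooth f \<Longrightarrow> smooth (\<lambda>x. exp (f x))"
  unfolding smooth_def
  by (intro allI C_k_comp_family[of UNIV "\<lambda>_. exp"]) (auto intro!: DERIV_exp)

lemma smooth_ln [intro]:
  assumes "smooth f" "\<And>x. f x > 0"
  shows "smooth (\<lambda>x. ln (f x))"
proof -
  \<comment> \<open>The derivative of order m + 1 of \<open>ln\<close> is (-1)^m m!
    x^(-m-1).\<close>
  define D :: "nat \<Rightarrow> real \<Rightarrow> real" where
    "D n = (case n of 0 \<Rightarrow> ln | Suc m \<Rightarrow> (\<lambda>x. (-1) ^ m * fact m * inverse x ^ Suc m))" for n
  have "(D n has_field_derivative D (Suc n) x) (at x)" if "x \<in> {0<..}" for n x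
  proof (cases n)
    case 0
    then show ?thesis
      using that by (auto simp: D_def intro!: derivative_eq_intros simp: inverse_eq_divide)
  next
    case (Suc m)
    have "((\<lambda>x. inverse x ^ Suc m) has_field_derivative
        real (Suc m) * (- (inverse x ^ Suc (Suc 0)) * inverse x ^ (Suc m - Suc 0))) (at x)"
      using that by (intro DERIV_power DERIV_inverse) auto
    from DERIV_cmult[OF this, of "(-1) ^ m * fact m"] show ?thesis
      unfolding D_def Suc by (simp add: mult_ac)
  qed
  from C_k_comp_family[of "{0<..}" D, OF this, of _ f 0] assms show ?thesis
    by (auto simp: smooth_def D_def)
qed

lemma smooth_has_derivative:
  "smooth f \<Longrightarrow> (f has_derivative frechet_derivative f (at x)) (at x)"
  unfolding smooth_def using C_k_Suc_has_derivative[of 0] by blast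

lemma smooth_partial_deriv [intro]: "smooth f \<Longrightarrow> smooth (partial_deriv i f)"
  unfolding smooth_def by (metis C_k.simps(2))

lemma smooth_continuous: "smooth f \<Longrightarrow> continuous_on A f"
  unfolding smooth_def using C_k_continuous continuous_on_subset by blast


lemma smooth_partial_deriv_diff:
  "smooth f \<Longrightarrow> smooth g \<Longrightarrow>
   partial_deriv i (\<lambda>x. f x - g x) x = partial_deriv i f x - partial_deriv i g x"
  using partial_deriv_eq[OF has_derivative_diff[OF smooth_has_derivative smooth_has_derivative]]
  by (simp add: partial_deriv_def)

lemma smooth_partial_deriv_mult:
  "smooth f \<Longrightarrow> smooth g \<Longrightarrow>
   partial_deriv i (\<lambda>x. f x * g x) x = f x * partial_deriv i g x + partial_deriv i f x * g x"
  using partial_deriv_eq[OF has_derivative_mult[OF smooth_has_derivative smooth_has_derivative]]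
  by (simp add: partial_deriv_def)

lemma smooth_partial_deriv_cmult:
  "smooth f \<Longrightarrow> partial_deriv i (\<lambda>x. a * f x) x = a * partial_deriv i f x"
  using partial_deriv_eq[OF has_derivative_mult_right[OF smooth_has_derivative]]
  by (simp add: partial_deriv_def)

subsection \<open>Bump functions\<close>

text \<open>\<open>flat 0\<close> is the usual smooth function e^(-1/t) that vanishes for t \<le> 0.
  The powers of 1/t produced by differentiation are built in, so that derivatives of members are
  combinations of members.\<close>

definition flat :: "nat \<Rightarrow> real \<Rightarrow> real" where
  "flat n t = (if t > 0 then exp (- (1 / t)) / t ^ n else 0)"

lemma flat_pos_iff: "flat n t > 0 \<longleftrightarrow> t > 0" and flat_nonneg: "flat n t \<ge> 0"
  by (auto simp: flat_def)

text \<open>In the variable y = 1/t the limit from the right is that of y^n e^(-y) at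
  infinity.\<close>

lemma tendsto_flat_0: "(flat n \<longlongrightarrow> 0) (at 0)"
proof (rule filterlim_split_at)
  show "(flat n \<longlongrightarrow> 0) (at_left 0)"
    by (rule tendsto_eventually) (auto simp: flat_def eventually_at_filter)
  have "((\<lambda>y::real. y ^ n / exp y) \<longlongrightarrow> 0) at_top"
    by (rule tendsto_power_div_exp_0)
  then have "((\<lambda>t::real. inverse t ^ n / exp (inverse t)) \<longlongrightarrow> 0) (at_right 0)"
    by (rule filterlim_compose) (rule filterlim_inverse_at_top_right)
  then show "(flat n \<longlongrightarrow> 0) (at_right 0)"
  proof (rule Lim_transform_eventually)
    show "\<forall>\<^sub>F t in at_right 0. inverse t ^ n / exp (inverse t) = flat n t"
      by (auto simp: eventually_at_filter flat_def exp_minus field_simps)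
  qed
qed

lemma flat_has_derivative:
  "(flat n has_field_derivative (flat (n + 2) t - real n * flat (n + 1) t)) (at t)"
proof (cases t "0::real" rule: linorder_cases)
  case less
  have "((\<lambda>_. 0) has_field_derivative (flat (n + 2) t - real n * flat (n + 1) t)) (at t)"
    using less by (auto simp: flat_def)
  then show ?thesis
    by (rule has_field_derivative_transform_within_open[of _ _ _ "{..<0}"])
       (use less in \<open>auto simp: flat_def\<close>)
next
  case equal
  \<comment> \<open>At 0 the difference quotient of \<open>flat n\<close> is
    \<open>flat (n + 1)\<close> itself.\<close>
  have "((\<lambda>h. (flat n (0 + h) - flat n 0) / h) \<longlongrightarrow> 0) (at 0)"
    using tendsto_flat_0[of "n + 1"]
    by (rule Lim_transform_eventually) (auto simp: eventually_at_filter flat_def field_simps)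
  with equal show ?thesis
    by (simp add: DERIV_def flat_def)
next
  case greater
  have "((\<lambda>t. exp (- (1 / t)) / t ^ n) has_field_derivative
      (flat (n + 2) t - real n * flat (n + 1) t)) (at t)"
    using greater
    by (auto intro!: derivative_eq_intros simp: flat_def divide_simps)
       (cases n; simp add: algebra_simps power2_eq_square)
  then show ?thesis
    by (rule has_field_derivative_transform_within_open[of _ _ _ "{0<..}"])
       (use greater in \<open>auto simp: flat_def\<close>)
qed

text \<open>\<open>C_k_comp_family\<close> does not apply, because the derivative of a member is a
  combination of two members rather than the next one in a chain.\<close>

lemma C_k_flat: "C_k k f \<Longrightarrow> C_k k (\<lambda>x. flat n (f x))"
proof (induction k arbitrary: n)
  case 0
  have "continuous_on UNIV (flat n)"
    using flat_has_derivative by (meson DERIV_continuous continuous_at_imp_continuous_on)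
  with 0 show ?case
    by (auto intro!: continuous_on_compose2[of UNIV "flat n"])
next
  case (Suc k)
  have *: "((\<lambda>x. flat n (f x)) has_derivative
      (\<lambda>h. (flat (n + 2) (f x) + (- real n) * flat (n + 1) (f x)) * frechet_derivative f (at x) h)) (at x)"
    for x
    by (rule has_derivative_compose[OF C_k_Suc_has_derivative[OF Suc.prems],
          where g'="(*) (flat (n + 2) (f x) + (- real n) * flat (n + 1) (f x))"])
       (use flat_has_derivative[of n "f x"] in \<open>simp add: has_field_derivative_def\<close>)
  moreover have "C_k k (\<lambda>x. (flat (n + 2) (f x) + (- real n) * flat (n + 1) (f x)) * partial_deriv i f x)" for i
    using Suc.prems by (intro C_k_mult C_k_add C_k_const Suc.IH[OF C_k_Suc_imp]) auto
  ultimately show ?case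
    by (intro C_k_SucI) (auto simp: partial_deriv_def[abs_def])
qed

lemma smooth_flat [intro]: "smooth f \<Longrightarrow> smooth (\<lambda>x. flat n (f x))"
  by (auto simp: smooth_def C_k_flat)

text \<open>Being positive exactly on the open box is all that is asked of it; there is no plateau,
  and later arguments pass through the sets where it exceeds 1/(n+1).\<close>

definition bump :: "real^'d::finite \<Rightarrow> real^'d \<Rightarrow> real^'d \<Rightarrow> real" where
  "bump a b x = (\<Prod>i\<in>UNIV. flat 0 (x $ i - a $ i) * flat 0 (b $ i - x $ i))"

lemma smooth_bump [intro]: "smooth (bump a b)"
  unfolding bump_def[abs_def] by (intro smooth_prod smooth_mult smooth_flat smooth_minus) auto

lemma bump_nonneg: "bump a b x \<ge> 0"
  by (auto simp: bump_def flat_nonneg intro!: prod_nonneg)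

lemma bump_pos_iff: "bump a b x > 0 \<longleftrightarrow> x \<in> box a b"
proof -
  have "bump a b x > 0 \<longleftrightarrow> bump a b x \<noteq> 0"
    using bump_nonneg[of a b x] by linarith
  also have "\<dots> \<longleftrightarrow> (\<forall>i. flat 0 (x $ i - a $ i) > 0 \<and> flat 0 (b $ i - x $ i) > 0)"
    using flat_nonneg by (auto simp: bump_def less_le)
  also have "\<dots> \<longleftrightarrow> x \<in> box a b"
    by (auto simp: flat_pos_iff mem_box_cart)
  finally show ?thesis .
qed

lemma bump_eq_0: "x \<notin> box a b \<Longrightarrow> bump a b x = 0"
  using bump_pos_iff[of a b x] bump_nonneg[of a b x] by linarith

subsection \<open>Test functions\<close>

lemma test_fun_smooth: "u \<in> test_fun E \<Longrightarrow> smooth u"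
  by (auto simp: test_fun_def smooth_def)

lemma test_funI: "smooth u \<Longrightarrow> compact K \<Longrightarrow> K \<subseteq> E \<Longrightarrow> (\<And>x. x \<notin> K \<Longrightarrow> u x = 0) \<Longrightarrow> u \<in> test_fun E"
  by (auto simp: test_fun_def smooth_def)

lemma test_funE:
  assumes "u \<in> test_fun E"
  obtains K where "smooth u" "compact K" "K \<subseteq> E" "\<And>x. x \<notin> K \<Longrightarrow> u x = 0"
  using assms unfolding test_fun_def smooth_def by blast

lemma test_fun_diff: 
  assumes "u \<in> test_fun E" "v \<in> test_fun E"
  shows "(\<lambda>x. u x - v x) \<in> test_fun E"
proof -
  from assms(1) obtain K where K: "smooth u" "compact K" "K \<subseteq> E" "\<And>x. x \<notin> K \<Longrightarrow> u x = 0"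
    using test_funE by blast
  from assms(2) obtain L where L: "smooth v" "compact L" "L \<subseteq> E" "\<And>x. x \<notin> L \<Longrightarrow> v x = 0"
    using test_funE by blast
  show ?thesis
    by (rule test_funI[of _ "K \<union> L"]) (use K L in auto)
qed

lemma test_fun_mult:
  assumes "smooth f" "u \<in> test_fun E"
  shows "(\<lambda>x. f x * u x) \<in> test_fun E"
proof -
  from assms(2) obtain K where "smooth u" "compact K" "K \<subseteq> E" "\<And>x. x \<notin> K \<Longrightarrow> u x = 0"
    using test_funE by blast
  with assms(1) show ?thesis
    by (intro test_funI[of _ K]) auto
qed

lemma test_fun_cmult: "u \<in> test_fun E \<Longrightarrow> (\<lambda>x. a * u x) \<in> test_fun E"
  by (rule test_fun_mult) auto

lemma bump_eq_0_cbox: "x \<notin> cbox a b \<Longrightarrow> bump a b x = 0"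
  using bump_eq_0 box_subset_cbox by blast

lemma bump_test_fun: "cbox a b \<subseteq> E \<Longrightarrow> bump a b \<in> test_fun E"
  by (rule test_funI[of _ "cbox a b"]) (auto simp: bump_eq_0_cbox)

text \<open>As r grows, these test functions increase to the indicator of the open box; this is the
  bridge from smooth functions to indicators.\<close>

lemma one_minus_exp_bump_test_fun: "cbox a b \<subseteq> E \<Longrightarrow> (\<lambda>x. 1 - exp (- r * bump a b x)) \<in> test_fun E"
  by (rule test_funI[of _ "cbox a b"], intro smooth_minus smooth_exp smooth_mult)
     (auto simp: bump_eq_0_cbox)

lemma box_indicator_limit:
  "(\<lambda>n. 1 - exp (- real n * bump a b x)) \<longlonglongrightarrow> indicator (box a b) x"
proof (cases "x \<in> box a b")
  case True
  then have "bump a b x > 0" by (simp add: bump_pos_iff)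
  then have "(\<lambda>n. 1 - exp (- (bump a b x)) ^ n) \<longlonglongrightarrow> 1 - 0"
    by (intro tendsto_intros LIMSEQ_realpow_zero) auto
  with True show ?thesis
    by (simp flip: exp_of_nat_mult)
qed (simp add: bump_eq_0)

lemma partial_deriv_outside:
  assumes "closed K" "\<And>x. x \<notin> K \<Longrightarrow> u x = 0" "x \<notin> K"
  shows "partial_deriv i u x = 0"
proof -
  have "(u has_derivative (\<lambda>_. 0)) (at x)"
    by (rule has_derivative_transform_within_open[of "\<lambda>_. 0" _ _ UNIV "-K"]) (use assms in auto)
  then show ?thesis by (simp add: partial_deriv_eq)
qed

subsection \<open>Square integrable functions\<close>

definition L2 :: "'a measure \<Rightarrow> ('a \<Rightarrow> real) \<Rightarrow> bool" where
  "L2 \<mu> f \<longleftrightarrow> f \<in> borel_measurable \<mu> \<and> integrable \<mu> (\<lambda>x. (f x)\<^sup>2)"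

definition ip :: "'a measure \<Rightarrow> ('a \<Rightarrow> real) \<Rightarrow> ('a \<Rightarrow> real) \<Rightarrow> real" where
  "ip \<mu> f g = (LINT x|\<mu>. f x * g x)"

abbreviation nsq :: "'a measure \<Rightarrow> ('a \<Rightarrow> real) \<Rightarrow> real" where
  "nsq \<mu> f \<equiv> ip \<mu> f f"

lemma Lr_fun_2_iff: "f \<in> Lr_fun 2 \<mu> \<longleftrightarrow> L2 \<mu> f"
proof -
  have "\<bar>y\<bar> powr 2 = y\<^sup>2" for y :: real
    by (cases "y = 0") (auto simp: powr_numeral)
  then show ?thesis
    by (simp add: Lr_fun_def L2_def)
qed

lemma L2_measurable [measurable_dest]: "L2 \<mu> f \<Longrightarrow> f \<in> borel_measurable \<mu>"
  by (simp add: L2_def)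

lemma L2_integrable_mult:
  assumes "L2 \<mu> f" "L2 \<mu> g"
  shows "integrable \<mu> (\<lambda>x. f x * g x)"
proof (rule Bochner_Integration.integrable_bound)
  show "integrable \<mu> (\<lambda>x. (f x)\<^sup>2 + (g x)\<^sup>2)"
    using assms by (auto simp: L2_def)
  show "(\<lambda>x. f x * g x) \<in> borel_measurable \<mu>"
    using assms by (auto simp: L2_def)
  have "\<bar>a * b\<bar> \<le> a\<^sup>2 + b\<^sup>2" for a b :: real
    using sum_squares_bound[of "\<bar>a\<bar>" "\<bar>b\<bar>"] mult_nonneg_nonneg[of "\<bar>a\<bar>" "\<bar>b\<bar>"]
    unfolding abs_mult power2_abs by linarith
  then show "AE x in \<mu>. norm (f x * g x) \<le> norm ((f x)\<^sup>2 + (g x)\<^sup>2)"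
    by auto
qed

lemma L2_add:
  assumes "L2 \<mu> f" "L2 \<mu> g"
  shows "L2 \<mu> (\<lambda>x. f x + g x)"
  using assms L2_integrable_mult[OF assms]
  by (auto simp: L2_def power2_sum mult.assoc intro!: Bochner_Integration.integrable_add)

lemma L2_cmult: "L2 \<mu> f \<Longrightarrow> L2 \<mu> (\<lambda>x. a * f x)"
  by (auto simp: L2_def power_mult_distrib)

lemma L2_diff:
  assumes "L2 \<mu> f" "L2 \<mu> g"
  shows "L2 \<mu> (\<lambda>x. f x - g x)"
  using L2_add[OF assms(1) L2_cmult[OF assms(2), of "-1"]] by simp

lemma L2_bound:
  assumes "L2 \<mu> f" "g \<in> borel_measurable \<mu>" "AE x in \<mu>. \<bar>g x\<bar> \<le> \<bar>f x\<bar>"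
  shows "L2 \<mu> g"
  unfolding L2_def
proof (rule conjI[OF assms(2)], rule Bochner_Integration.integrable_bound[of _ "\<lambda>x. (f x)\<^sup>2"])
  show "AE x in \<mu>. norm ((g x)\<^sup>2) \<le> norm ((f x)\<^sup>2)"
    using assms(3) by eventually_elim (simp add: abs_le_square_iff)
qed (use assms in \<open>auto simp: L2_def\<close>)

lemma L2_cong_AE:
  assumes "L2 \<mu> f" "g \<in> borel_measurable \<mu>" "AE x in \<mu>. f x = g x"
  shows "L2 \<mu> g"
  by (rule L2_bound[OF assms(1,2)]) (use assms(3) in eventually_elim, auto)

lemma L2_dist_sq_eq: "L2_dist_sq \<mu> f g = nsq \<mu> (\<lambda>x. f x - g x)"
  by (simp add: L2_dist_sq_def ip_def power2_eq_square)

lemma ip_commute: "ip \<mu> f g = ip \<mu> g f"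
  by (simp add: ip_def mult.commute)

lemma ip_add_left: "L2 \<mu> f \<Longrightarrow> L2 \<mu> g \<Longrightarrow> L2 \<mu> h \<Longrightarrow> ip \<mu> (\<lambda>x. f x + g x) h = ip \<mu> f h + ip \<mu> g h"
  by (simp add: ip_def L2_integrable_mult distrib_right)

lemma ip_add_right: "L2 \<mu> f \<Longrightarrow> L2 \<mu> g \<Longrightarrow> L2 \<mu> h \<Longrightarrow> ip \<mu> h (\<lambda>x. f x + g x) = ip \<mu> h f + ip \<mu> h g"
  by (simp add: ip_commute[of _ h] ip_add_left)

lemma ip_diff_left: "L2 \<mu> f \<Longrightarrow> L2 \<mu> g \<Longrightarrow> L2 \<mu> h \<Longrightarrow> ip \<mu> (\<lambda>x. f x - g x) h = ip \<mu> f h - ip \<mu> g h"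
  by (simp add: ip_def L2_integrable_mult left_diff_distrib)

lemma ip_diff_right: "L2 \<mu> f \<Longrightarrow> L2 \<mu> g \<Longrightarrow> L2 \<mu> h \<Longrightarrow> ip \<mu> h (\<lambda>x. f x - g x) = ip \<mu> h f - ip \<mu> h g"
  by (simp add: ip_commute[of _ h] ip_diff_left)

lemma ip_cmult_left: "ip \<mu> (\<lambda>x. a * f x) g = a * ip \<mu> f g"
  by (simp add: ip_def mult.assoc)

lemma ip_cmult_right: "ip \<mu> g (\<lambda>x. a * f x) = a * ip \<mu> g f"
  by (simp add: ip_commute[of _ g] ip_cmult_left)

lemma ip_cong_AE:
  assumes "AE x in \<mu>. f x = f' x" "AE x in \<mu>. g x = g' x"
    and "f \<in> borel_measurable \<mu>" "g \<in> borel_measurable \<mu>" "f' \<in> borel_measurable \<mu>" "g' \<in> borel_measurable \<mu>"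
  shows "ip \<mu> f g = ip \<mu> f' g'"
  unfolding ip_def
  by (intro integral_cong_AE) (use assms in auto)

lemma nsq_nonneg: "nsq \<mu> f \<ge> 0"
  by (simp add: ip_def)

text \<open>Stated for three numbers so that it serves both the inner product and the Dirichlet
  form. For c = 0 an affine function of t that stays nonnegative is constant; otherwise the
  minimiser t = -b/c gives the bound.\<close>

lemma Cauchy_Schwarz_of_nonneg_form:
  fixes a b c :: real
  assumes "a \<ge> 0" and "c \<ge> 0" and "\<And>t. a + 2 * t * b + t\<^sup>2 * c \<ge> 0"
  shows "\<bar>b\<bar> \<le> sqrt a * sqrt c"
proof (cases "c = 0")
  case True
  have "b = 0"
  proof (rule ccontr)
    assume "b \<noteq> 0"
    then have "2 * (- (a + 1) / (2 * b)) * b = - (a + 1)" by simp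
    with assms(3)[of "- (a + 1) / (2 * b)"] True show False by simp
  qed
  with assms show ?thesis by simp
next
  case False
  then have "c > 0" using assms by simp
  have "b\<^sup>2 \<le> a * c"
    using assms(3)[of "- b / c"] \<open>c > 0\<close> by (simp add: field_simps power2_eq_square)
  then show ?thesis
    by (metis real_sqrt_le_mono real_sqrt_abs real_sqrt_mult)
qed

lemma ip_Cauchy_Schwarz:
  assumes "L2 \<mu> f" "L2 \<mu> g"
  shows "\<bar>ip \<mu> f g\<bar> \<le> sqrt (nsq \<mu> f) * sqrt (nsq \<mu> g)"
proof (rule Cauchy_Schwarz_of_nonneg_form)
  fix t
  have "nsq \<mu> (\<lambda>x. f x + t * g x) = nsq \<mu> f + 2 * t * ip \<mu> f g + t\<^sup>2 * nsq \<mu> g"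
    using assms by (simp add: ip_add_left ip_add_right ip_cmult_left ip_cmult_right L2_add L2_cmult
        ip_commute[of \<mu> g f] power2_eq_square algebra_simps)
  then show "0 \<le> nsq \<mu> f + 2 * t * ip \<mu> f g + t\<^sup>2 * nsq \<mu> g"
    using nsq_nonneg[of \<mu> "\<lambda>x. f x + t * g x"] by simp
qed (auto simp: nsq_nonneg)

lemma ip_tendsto:
  assumes "\<And>n. L2 \<mu> (F n)" "L2 \<mu> f" "L2 \<mu> g" "((\<lambda>n. nsq \<mu> (\<lambda>x. F n x - f x)) \<longlongrightarrow> 0) A"
  shows "((\<lambda>n. ip \<mu> (F n) g) \<longlongrightarrow> ip \<mu> f g) A"
proof -
  have "((\<lambda>n. sqrt (nsq \<mu> (\<lambda>x. F n x - f x)) * sqrt (nsq \<mu> g)) \<longlongrightarrow> sqrt 0 * sqrt (nsq \<mu> g)) A"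
    using assms(4) by (intro tendsto_intros)
  then have lim: "((\<lambda>n. sqrt (nsq \<mu> (\<lambda>x. F n x - f x)) * sqrt (nsq \<mu> g)) \<longlongrightarrow> 0) A"
    by simp
  have "((\<lambda>n. ip \<mu> (\<lambda>x. F n x - f x) g) \<longlongrightarrow> 0) A"
  proof (rule Lim_null_comparison[OF always_eventually lim], intro allI)
    show "norm (ip \<mu> (\<lambda>x. F n x - f x) g) \<le> sqrt (nsq \<mu> (\<lambda>x. F n x - f x)) * sqrt (nsq \<mu> g)" for n
      unfolding real_norm_def by (intro ip_Cauchy_Schwarz L2_diff assms(1-3))
  qed
  then have "((\<lambda>n. ip \<mu> (F n) g - ip \<mu> f g) \<longlongrightarrow> 0) A"
    using assms by (simp add: ip_diff_left)
  then show ?thesis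
    by (rule LIM_zero_cancel)
qed

lemma nsq_zero_AE:
  assumes "L2 \<mu> f" "nsq \<mu> f = 0"
  shows "AE x in \<mu>. f x = 0"
proof -
  have "AE x in \<mu>. f x * f x = 0"
    using assms L2_integrable_mult[OF assms(1) assms(1)]
    by (subst (asm) ip_def, subst integral_nonneg_eq_0_iff_AE[symmetric]) auto
  then show ?thesis by simp
qed

lemma filterlim_divide_Suc_at_right:
  "(t::real) > 0 \<Longrightarrow> filterlim (\<lambda>n. t / real (Suc n)) (at_right 0) sequentially"
  unfolding filterlim_at using LIMSEQ_Suc[OF lim_const_over_n[of t]]
  by (auto intro!: always_eventually simp del: of_nat_Suc)

subsection \<open>Semigroups of contractions with a symmetric generator\<close>

text \<open>Symmetry is asked of the generator alone, since that is what a symmetric form yields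
  directly. For the operators \<open>T t\<close> it has to be integrated up, and is obtained on the
  generator domain.\<close>

locale sym_semigroup =
  fixes \<mu> :: "'a measure" and T :: "real \<Rightarrow> ('a \<Rightarrow> real) \<Rightarrow> 'a \<Rightarrow> real"
  assumes semigroup: "L2_semigroup \<mu> T"
    and generator_sym: "semigroup_generator \<mu> T u g \<Longrightarrow> semigroup_generator \<mu> T v h \<Longrightarrow> ip \<mu> g v = ip \<mu> h u"
begin

lemma L2_T: "t \<ge> 0 \<Longrightarrow> L2 \<mu> f \<Longrightarrow> L2 \<mu> (T t f)"
  using semigroup by (auto simp: L2_semigroup_def Lr_fun_2_iff)

lemma contraction: "t \<ge> 0 \<Longrightarrow> L2 \<mu> f \<Longrightarrow> nsq \<mu> (T t f) \<le> nsq \<mu> f"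
  using semigroup by (auto simp: L2_semigroup_def Lr_fun_2_iff L2_dist_sq_eq)

lemma T_lin: "t \<ge> 0 \<Longrightarrow> L2 \<mu> f \<Longrightarrow> L2 \<mu> g \<Longrightarrow> AE x in \<mu>. T t (\<lambda>y. a * f y + b * g y) x = a * T t f x + b * T t g x"
  using semigroup by (auto simp: L2_semigroup_def Lr_fun_2_iff)

lemma T_diff: "t \<ge> 0 \<Longrightarrow> L2 \<mu> f \<Longrightarrow> L2 \<mu> g \<Longrightarrow> AE x in \<mu>. T t (\<lambda>y. f y - g y) x = T t f x - T t g x"
  using T_lin[of t f g 1 "-1"] by simp

lemma T_cmult: "t \<ge> 0 \<Longrightarrow> L2 \<mu> f \<Longrightarrow> AE x in \<mu>. T t (\<lambda>y. a * f y) x = a * T t f x"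
  using T_lin[of t f f a 0] by simp

lemma T_zero: "L2 \<mu> f \<Longrightarrow> AE x in \<mu>. T 0 f x = f x"
  using semigroup by (auto simp: L2_semigroup_def Lr_fun_2_iff)

lemma T_add: "s \<ge> 0 \<Longrightarrow> t \<ge> 0 \<Longrightarrow> L2 \<mu> f \<Longrightarrow> AE x in \<mu>. T (s + t) f x = T s (T t f) x"
  using semigroup by (auto simp: L2_semigroup_def Lr_fun_2_iff)


lemma T_ip_le: "t \<ge> 0 \<Longrightarrow> L2 \<mu> f \<Longrightarrow> ip \<mu> f (T t f) \<le> nsq \<mu> f"
  using ip_Cauchy_Schwarz[of \<mu> f "T t f"] contraction[of t f] L2_T[of t f] nsq_nonneg[of \<mu> f]
    mult_left_mono[of "sqrt (nsq \<mu> (T t f))" "sqrt (nsq \<mu> f)" "sqrt (nsq \<mu> f)"]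
  by (auto simp: real_sqrt_le_mono)

lemma generator_iff:
  "semigroup_generator \<mu> T u g \<longleftrightarrow> L2 \<mu> u \<and> L2 \<mu> g \<and>
    ((\<lambda>h. nsq \<mu> (\<lambda>x. (T h u x - u x) / h - g x)) \<longlongrightarrow> 0) (at_right 0)"
  by (simp add: semigroup_generator_def Lr_fun_2_iff L2_dist_sq_eq)

lemma L2_quotient: "h \<ge> 0 \<Longrightarrow> L2 \<mu> u \<Longrightarrow> L2 \<mu> (\<lambda>x. (T h u x - u x) / h)"
  using L2_cmult[OF L2_diff[OF L2_T[of h u]], of u "1 / h"] by simp

text \<open>\<open>T t\<close> commutes with the difference quotients, so as a contraction it can
  only decrease their distance to the limit.\<close>

lemma generator_T:
  assumes "semigroup_generator \<mu> T u g" "t \<ge> 0"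
  shows "semigroup_generator \<mu> T (T t u) (T t g)"
proof -
  have u: "L2 \<mu> u" "L2 \<mu> g" and
    lim: "((\<lambda>h. nsq \<mu> (\<lambda>x. (T h u x - u x) / h - g x)) \<longlongrightarrow> 0) (at_right 0)"
    using assms by (auto simp: generator_iff)
  have "nsq \<mu> (\<lambda>x. (T h (T t u) x - T t u x) / h - T t g x) \<le> nsq \<mu> (\<lambda>x. (T h u x - u x) / h - g x)"
    if "h > 0" for h
  proof -
    have "AE x in \<mu>. T t (\<lambda>x. (1 / h) * (T h u x - u x) - g x) x =
      T t (\<lambda>x. (1 / h) * (T h u x - u x)) x - T t g x"
      using that assms u by (intro T_diff L2_diff L2_cmult L2_T) auto
    moreover have "AE x in \<mu>. T t (\<lambda>x. (1 / h) * (T h u x - u x)) x = (1 / h) * T t (\<lambda>x. T h u x - u x) x"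
      using that assms u by (intro T_cmult L2_diff L2_T) auto
    moreover have "AE x in \<mu>. T t (\<lambda>x. T h u x - u x) x = T t (T h u) x - T t u x"
      using that assms u by (intro T_diff L2_diff L2_T) auto
    moreover have "AE x in \<mu>. T (t + h) u x = T t (T h u) x"
      using that assms u by (intro T_add) auto
    moreover have "AE x in \<mu>. T (t + h) u x = T h (T t u) x"
      unfolding add.commute[of t h] using that assms u by (intro T_add) auto
    ultimately have "AE x in \<mu>. T t (\<lambda>x. (1 / h) * (T h u x - u x) - g x) x =
       (T h (T t u) x - T t u x) / h - T t g x"
    proof eventually_elim
      case (elim x)
      show ?case
        unfolding elim(1-3) elim(4)[symmetric] elim(5) by simp
    qed
    then have "nsq \<mu> (\<lambda>x. (T h (T t u) x - T t u x) / h - T t g x) =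
        nsq \<mu> (T t (\<lambda>x. (1 / h) * (T h u x - u x) - g x))"
      using that assms u
      by (intro ip_cong_AE L2_measurable L2_diff L2_T L2_quotient L2_cmult) (auto elim: eventually_mono)
    also have "\<dots> \<le> nsq \<mu> (\<lambda>x. (1 / h) * (T h u x - u x) - g x)"
      using that assms u by (intro contraction L2_diff L2_cmult L2_T) auto
    finally show ?thesis by simp
  qed
  then have "((\<lambda>h. nsq \<mu> (\<lambda>x. (T h (T t u) x - T t u x) / h - T t g x)) \<longlongrightarrow> 0) (at_right 0)"
    by (intro real_tendsto_sandwich[OF _ _ tendsto_const lim])
       (auto simp: eventually_at_filter nsq_nonneg)
  then show ?thesis
    using u assms by (auto simp: generator_iff intro: L2_T)
qed

text \<open>\<open>r \<mapsto> \<langle>T\<^sub>r u, T\<^bsub>t-r\<^esub> v\<rangle>\<close> changes by \<open>o(h)\<close>, uniformly in \<open>r\<close>, over an interval of length \<open>h\<close>.\<close>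

lemma symmetric_on_domain:
  assumes u: "semigroup_generator \<mu> T u g" and v: "semigroup_generator \<mu> T v k" and "t \<ge> 0"
  shows "ip \<mu> (T t u) v = ip \<mu> u (T t v)"
proof (cases "t = 0")
  case True
  have "L2 \<mu> u" "L2 \<mu> v" using u v by (auto simp: generator_iff)
  then have "ip \<mu> (T 0 u) v = ip \<mu> u v" "ip \<mu> u (T 0 v) = ip \<mu> u v"
    by (intro ip_cong_AE T_zero L2_measurable L2_T; auto)+
  with True show ?thesis by simp
next
  case False
  with \<open>t \<ge> 0\<close> have t: "t > 0" by simp
  have L: "L2 \<mu> u" "L2 \<mu> v" "L2 \<mu> g" "L2 \<mu> k"
    and limu: "((\<lambda>h. nsq \<mu> (\<lambda>x. (T h u x - u x) / h - g x)) \<longlongrightarrow> 0) (at_right 0)"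
    and limv: "((\<lambda>h. nsq \<mu> (\<lambda>x. (T h v x - v x) / h - k x)) \<longlongrightarrow> 0) (at_right 0)"
    using u v by (auto simp: generator_iff)
  define \<phi> where "\<phi> r = ip \<mu> (T r u) (T (t - r) v)" for r
  define \<epsilon> where "\<epsilon> h = sqrt (nsq \<mu> (\<lambda>x. (T h u x - u x) / h - g x)) * sqrt (nsq \<mu> v) +
      sqrt (nsq \<mu> u) * sqrt (nsq \<mu> (\<lambda>x. (T h v x - v x) / h - k x))" for h
  have \<epsilon>: "(\<epsilon> \<longlongrightarrow> 0) (at_right 0)"
    unfolding \<epsilon>_def
    using tendsto_add[OF tendsto_mult[OF tendsto_real_sqrt[OF limu] tendsto_const]
        tendsto_mult[OF tendsto_const tendsto_real_sqrt[OF limv]]]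
    by simp
  have bd: "\<bar>ip \<mu> (T r a) (T s b)\<bar> \<le> sqrt (nsq \<mu> a) * sqrt (nsq \<mu> b)"
    if "r \<ge> 0" "s \<ge> 0" "L2 \<mu> a" "L2 \<mu> b" for r s a b
    by (rule order_trans[OF ip_Cauchy_Schwarz])
       (use that in \<open>auto intro!: mult_mono contraction L2_T simp: nsq_nonneg\<close>)
  have step: "\<bar>\<phi> (r + h) - \<phi> r\<bar> \<le> h * \<epsilon> h" if "r \<ge> 0" "h > 0" "r + h \<le> t" for r h
  proof -
    define s where "s = t - r - h"
    define U where "U x = (T h u x - u x) / h - g x" for x
    define V where "V x = (T h v x - v x) / h - k x" for x
    have s: "s \<ge> 0" "t - r = s + h" "t - (r + h) = s" using that by (auto simp: s_def)
    have LUV: "L2 \<mu> U" "L2 \<mu> V"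
      unfolding U_def V_def using that L by (auto intro!: L2_diff[OF L2_quotient])
    \<comment> \<open>First-order expansion with exact remainder: \<open>W\<close> is the error of
      the difference quotient of \<open>w\<close> at step h.\<close>
    have exp: "AE x in \<mu>. T (q + h) w x = T q w x + h * (T q y x + T q W x)"
      if "q \<ge> 0" "L2 \<mu> w" "L2 \<mu> y" "L2 \<mu> W" "\<And>x. W x = (T h w x - w x) / h - y x" for q w y W
    proof -
      have "AE x in \<mu>. T (q + h) w x = T q (T h w) x"
        using that \<open>h > 0\<close> by (intro T_add) auto
      moreover have "T h w = (\<lambda>x. 1 * w x + h * (1 * y x + 1 * W x))"
        using that \<open>h > 0\<close> by (auto simp: field_simps)
      moreover have "AE x in \<mu>. T q (\<lambda>x. 1 * w x + h * (1 * y x + 1 * W x)) x =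
          1 * T q w x + h * T q (\<lambda>x. 1 * y x + 1 * W x) x"
        using that(1-4) by (intro T_lin L2_add L2_cmult) auto
      moreover have "AE x in \<mu>. T q (\<lambda>x. 1 * y x + 1 * W x) x = 1 * T q y x + 1 * T q W x"
        using that(1-4) by (intro T_lin) auto
      ultimately show ?thesis by (auto elim: eventually_elim2)
    qed
    have 1: "\<phi> (r + h) = ip \<mu> (\<lambda>x. T r u x + h * (T r g x + T r U x)) (T s v)"
      unfolding \<phi>_def s using that s L LUV exp[of r u g U]
      by (intro ip_cong_AE L2_measurable L2_T L2_add L2_cmult) (auto simp: U_def)
    have 2: "\<phi> r = ip \<mu> (T r u) (\<lambda>x. T s v x + h * (T s k x + T s V x))"
      unfolding \<phi>_def s using that s L LUV exp[of s v k V]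
      by (intro ip_cong_AE L2_measurable L2_T L2_add L2_cmult) (auto simp: V_def)
    have LT: "L2 \<mu> (T r u)" "L2 \<mu> (T r g)" "L2 \<mu> (T r U)" "L2 \<mu> (T s v)" "L2 \<mu> (T s k)" "L2 \<mu> (T s V)"
      using that s L LUV by (auto intro!: L2_T)
    \<comment> \<open>The two first-order terms cancel, as \<open>T r u\<close> and
      \<open>T s v\<close> stay in the domain; only the remainders \<open>U\<close> and
      \<open>V\<close> survive.\<close>
    have sym: "ip \<mu> (T r g) (T s v) = ip \<mu> (T s k) (T r u)"
      using that s by (intro generator_sym generator_T u v)
    have "\<phi> (r + h) = ip \<mu> (T r u) (T s v) + h * (ip \<mu> (T r g) (T s v) + ip \<mu> (T r U) (T s v))"
      unfolding 1 using LT by (simp add: ip_add_left ip_cmult_left L2_add L2_cmult)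
    moreover have "\<phi> r = ip \<mu> (T r u) (T s v) + h * (ip \<mu> (T s k) (T r u) + ip \<mu> (T r u) (T s V))"
      unfolding 2 using LT
      by (simp add: ip_add_right ip_cmult_right L2_add L2_cmult ip_commute[of _ "T s k"])
    ultimately have "\<phi> (r + h) - \<phi> r = h * (ip \<mu> (T r U) (T s v) - ip \<mu> (T r u) (T s V))"
      using sym by (simp add: algebra_simps)
    moreover have "\<bar>ip \<mu> (T r U) (T s v) - ip \<mu> (T r u) (T s V)\<bar> \<le> \<epsilon> h"
      using bd[of r s U v] bd[of r s u V] that s L LUV unfolding \<epsilon>_def U_def V_def
      by linarith
    ultimately show ?thesis
      using that by (simp add: abs_mult)
  qed
  \<comment> \<open>The number of steps is inversely proportional to their length h, so errors of
    size h \<epsilon>(h) add up to t \<epsilon>(h), which vanishes as n grows.\<close>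
  have tel: "\<bar>\<phi> t - \<phi> 0\<bar> \<le> t * \<epsilon> (t / real (Suc n))" for n
  proof -
    define h where "h = t / real (Suc n)"
    have h: "h > 0" "real (Suc n) * h = t" using t by (auto simp: h_def)
    have "\<bar>\<phi> (real m * h) - \<phi> 0\<bar> \<le> real m * (h * \<epsilon> h)" if "m \<le> Suc n" for m
      using that
    proof (induction m)
      case (Suc m)
      have "real m * h + h = real (Suc m) * h" by (simp add: algebra_simps)
      also have "\<dots> \<le> real (Suc n) * h" using Suc.prems h by (intro mult_right_mono) auto
      finally have "real m * h + h \<le> t" using h by simp
      then have "\<bar>\<phi> (real m * h + h) - \<phi> (real m * h)\<bar> \<le> h * \<epsilon> h"
        using h by (intro step) auto
      with Suc.IH Suc.prems show ?case by (simp add: algebra_simps)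
    qed simp
    from this[of "Suc n"] have "\<bar>\<phi> t - \<phi> 0\<bar> \<le> real (Suc n) * (h * \<epsilon> h)"
      by (simp only: h(2))
    also have "\<dots> = t * \<epsilon> h"
      by (simp only: mult.assoc[symmetric] h(2))
    finally show ?thesis by (simp only: h_def)
  qed
  have "filterlim (\<lambda>n. t / real (Suc n)) (at_right 0) sequentially"
    using t by (rule filterlim_divide_Suc_at_right)
  from filterlim_compose[OF \<epsilon> this] have "(\<lambda>n. t * \<epsilon> (t / real (Suc n))) \<longlonglongrightarrow> t * 0"
    by (intro tendsto_intros)
  then have "\<bar>\<phi> t - \<phi> 0\<bar> \<le> t * 0"
    using tel by (intro LIMSEQ_le_const) auto
  then have "\<phi> t = \<phi> 0" by simp
  moreover have "\<phi> t = ip \<mu> (T t u) v"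
    unfolding \<phi>_def using t L by (intro ip_cong_AE L2_measurable L2_T) (auto intro!: T_zero)
  moreover have "\<phi> 0 = ip \<mu> u (T t v)"
    unfolding \<phi>_def using t L by (intro ip_cong_AE L2_measurable L2_T) (auto intro!: T_zero)
  ultimately show ?thesis by simp
qed

text \<open>By symmetry a(r) = <T_r u, u> is the squared norm of T_(r/2) u, which makes it convex;
  hence it lies above its tangent at 0, whose slope is <g, u>.\<close>

lemma dissipation_bound:
  assumes u: "semigroup_generator \<mu> T u g" and "h \<ge> 0"
  shows "nsq \<mu> u - ip \<mu> (T h u) u \<le> - h * ip \<mu> g u"
proof (cases "h = 0")
  case True
  have "L2 \<mu> u" using u by (auto simp: generator_iff)
  then have "ip \<mu> (T 0 u) u = ip \<mu> u u"
    by (intro ip_cong_AE T_zero L2_measurable L2_T; auto)+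
  with True show ?thesis by simp
next
  case False
  with \<open>h \<ge> 0\<close> have h: "h > 0" by simp
  have L: "L2 \<mu> u" "L2 \<mu> g"
    and lim: "((\<lambda>h. nsq \<mu> (\<lambda>x. (T h u x - u x) / h - g x)) \<longlongrightarrow> 0) (at_right 0)"
    using u by (auto simp: generator_iff)
  define a where "a r = ip \<mu> (T r u) u" for r
  have a0: "a 0 = nsq \<mu> u"
    unfolding a_def using L by (intro ip_cong_AE T_zero L2_measurable L2_T; auto)
  have a_half: "ip \<mu> (T r u) (T s u) = a (r + s)" if "r \<ge> 0" "s \<ge> 0" for r s
  proof -
    have "ip \<mu> (T r u) (T s u) = ip \<mu> (T s (T r u)) u"
      using that by (intro symmetric_on_domain[OF generator_T[OF u] u, symmetric])
    also have "\<dots> = a (s + r)"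
      unfolding a_def using that L T_add[of s r u]
      by (intro ip_cong_AE L2_measurable L2_T) (auto elim: eventually_mono)
    finally show ?thesis by (simp add: add.commute)
  qed
  \<comment> \<open>The squared norm of T_(r/2) u - T_(r/2+d) u expands into a second difference of
    a.\<close>
  have convex: "a (r + d) - a (r + 2 * d) \<le> a r - a (r + d)" if "r \<ge> 0" "d \<ge> 0" for r d
  proof -
    have LT: "L2 \<mu> (T (r / 2) u)" "L2 \<mu> (T (r / 2 + d) u)" using that L by (auto intro: L2_T)
    have "0 \<le> nsq \<mu> (\<lambda>x. T (r / 2) u x - T (r / 2 + d) u x)" by (rule nsq_nonneg)
    also have "\<dots> = ip \<mu> (T (r / 2) u) (T (r / 2) u) - 2 * ip \<mu> (T (r / 2) u) (T (r / 2 + d) u)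
        + ip \<mu> (T (r / 2 + d) u) (T (r / 2 + d) u)"
      using LT by (simp add: ip_diff_left ip_diff_right L2_diff ip_commute)
    also have "\<dots> = a r - 2 * a (r + d) + a (r + 2 * d)"
      using that by (simp add: a_half algebra_simps)
    finally show ?thesis by simp
  qed
  \<comment> \<open>Convexity makes the first decrement the largest, so n + 1 copies of it bound the
    total drop.\<close>
  have tel: "a 0 - a h \<le> - h * ip \<mu> (\<lambda>x. (T (h / real (Suc n)) u x - u x) / (h / real (Suc n))) u" for n
  proof -
    define d where "d = h / real (Suc n)"
    have d: "d > 0" "real (Suc n) * d = h" using h by (auto simp: d_def)
    have one: "a (real m * d) - a (real m * d + d) \<le> a 0 - a d" for m
    proof (induction m)
      case (Suc m)
      have "a (real m * d + d) - a (real m * d + 2 * d) \<le> a (real m * d) - a (real m * d + d)"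
        using d by (intro convex) auto
      with Suc show ?case by (simp add: algebra_simps)
    qed simp
    have "a 0 - a (real m * d) \<le> real m * (a 0 - a d)" for m
    proof (induction m)
      case (Suc m)
      with one[of m] show ?case by (simp add: algebra_simps)
    qed simp
    from this[of "Suc n"] have "a 0 - a h \<le> real (Suc n) * (a 0 - a d)" using d by simp
    also have "\<dots> = - (real (Suc n) * d) * ((a d - a 0) / d)" using d(1) by (simp add: field_simps del: of_nat_Suc)
    also have "(a d - a 0) / d = ip \<mu> (\<lambda>x. (T d u x - u x) / d) u"
      using ip_cmult_left[of \<mu> "1 / d" "\<lambda>x. T d u x - u x" u] d L a0
      by (simp add: ip_diff_left L2_T a_def)
    finally show ?thesis unfolding d(2) unfolding d_def .
  qed
  have seq: "filterlim (\<lambda>n. h / real (Suc n)) (at_right 0) sequentially"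
    using h by (rule filterlim_divide_Suc_at_right)
  have "(\<lambda>n. ip \<mu> (\<lambda>x. (T (h / real (Suc n)) u x - u x) / (h / real (Suc n))) u) \<longlonglongrightarrow> ip \<mu> g u"
    using h L filterlim_compose[OF lim seq] by (intro ip_tendsto L2_quotient) auto
  then have "(\<lambda>n. - h * ip \<mu> (\<lambda>x. (T (h / real (Suc n)) u x - u x) / (h / real (Suc n))) u)
      \<longlonglongrightarrow> - h * ip \<mu> g u"
    by (intro tendsto_intros)
  then have "a 0 - a h \<le> - h * ip \<mu> g u"
    using tel by (intro LIMSEQ_le_const) auto
  then show ?thesis by (simp add: a0) (simp add: a_def)
qed

end

subsection \<open>Integration by parts\<close>

lemma integrable_compact_support:
  fixes f :: "'a::euclidean_space \<Rightarrow> real"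
  assumes "f \<in> borel_measurable borel" "compact K" "\<And>x. x \<notin> K \<Longrightarrow> f x = 0" "\<And>x. \<bar>f x\<bar> \<le> B"
  shows "integrable lborel f"
proof (rule Bochner_Integration.integrable_bound)
  have "integrable lborel (\<lambda>x. indicator K x :: real)"
    using emeasure_compact_finite[OF assms(2)] assms(2)
    by (intro integrable_real_indicator) (auto simp: borel_closed compact_imp_closed)
  then show "integrable lborel (\<lambda>x. B * indicator K x)"
    by simp
  show "AE x in lborel. norm (f x) \<le> norm (B * indicator K x)"
  proof (rule AE_I2)
    show "norm (f x) \<le> norm (B * indicator K x)" for x
      using assms(3)[of x] assms(4)[of x] by (cases "x \<in> K") auto
  qed
qed (use assms(1) in simp)

lemma bounded_compact_support:
  fixes f :: "'a::euclidean_space \<Rightarrow> real"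
  assumes "continuous_on UNIV f" "compact K" "\<And>x. x \<notin> K \<Longrightarrow> f x = 0"
  obtains B where "\<And>x. \<bar>f x\<bar> \<le> B"
proof -
  have "compact (f ` K)"
    using assms by (intro compact_continuous_image continuous_on_subset[OF assms(1)]) auto
  then obtain B where B: "\<forall>y\<in>f ` K. norm y \<le> B"
    using compact_imp_bounded bounded_iff by blast
  have "\<bar>f x\<bar> \<le> max B 0" for x
    using B assms(3)[of x] by (cases "x \<in> K") (auto simp: le_max_iff_disj)
  then show thesis by (rule that)
qed

lemma test_fun_bounded:
  assumes "u \<in> test_fun E" obtains B where "\<And>x. \<bar>u x\<bar> \<le> B"
proof -
  from assms obtain K where K: "smooth u" "compact K" "K \<subseteq> E" "\<And>x. x \<notin> K \<Longrightarrow> u x = 0"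
    using test_funE by blast
  show thesis
    by (rule bounded_compact_support[of u K]) (use K that in \<open>auto intro: smooth_continuous\<close>)
qed

lemma test_fun_partial_deriv:
  assumes "u \<in> test_fun E" shows "partial_deriv i u \<in> test_fun E"
proof -
  from assms obtain K where "smooth u" "compact K" "K \<subseteq> E" "\<And>x. x \<notin> K \<Longrightarrow> u x = 0"
    using test_funE by blast
  then show ?thesis
    by (intro test_funI[of _ K]) (auto intro: partial_deriv_outside[of K] compact_imp_closed)
qed

lemma has_derivative_along:
  assumes "(f has_derivative f') (at (x + t *\<^sub>R e))"
  shows "((\<lambda>t. f (x + t *\<^sub>R e)) has_field_derivative f' e) (at (t::real))"
proof -
  have "((\<lambda>t. f (x + t *\<^sub>R e)) has_derivative (\<lambda>h. f' (h *\<^sub>R e))) (at t)"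
    by (rule has_derivative_compose[of "\<lambda>t. x + t *\<^sub>R e" "\<lambda>h. h *\<^sub>R e" t UNIV f f', OF _ assms])
       (auto intro!: derivative_eq_intros)
  moreover have "(\<lambda>h. f' (h *\<^sub>R e)) = (*) (f' e)"
    using linear_scale[OF has_derivative_linear[OF assms]] by (auto simp: mult.commute)
  ultimately show ?thesis
    by (simp add: has_field_derivative_def)
qed

lemma test_fun_Lipschitz_along:
  assumes "u \<in> test_fun E"
  obtains B where "B \<ge> 0" "\<And>x t. \<bar>u (x + t *\<^sub>R axis i 1) - u x\<bar> \<le> B * \<bar>t\<bar>"
proof -
  obtain B where B: "\<And>x. \<bar>partial_deriv i u x\<bar> \<le> B"
    using test_fun_bounded[OF test_fun_partial_deriv[OF assms]] by blast
  have "\<bar>u (x + t *\<^sub>R axis i 1) - u x\<bar> \<le> B * \<bar>t\<bar>" for x t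
  proof -
    have "norm (u (x + t *\<^sub>R axis i 1) - u (x + 0 *\<^sub>R axis i 1)) \<le> B * norm (t - 0)"
    proof (rule field_differentiable_bound[of UNIV])
      show "((\<lambda>t. u (x + t *\<^sub>R axis i 1)) has_field_derivative partial_deriv i u (x + s *\<^sub>R axis i 1)) (at s within UNIV)" for s
        unfolding partial_deriv_def
        by (rule has_derivative_along[OF smooth_has_derivative[OF test_fun_smooth[OF assms]]])
    qed (use B in auto)
    then show ?thesis by simp
  qed
  moreover have "B \<ge> 0" using B[of 0] by linarith
  ultimately show thesis by (rule that[rotated])
qed

lemma lborel_integral_translate:
  fixes f :: "'a::euclidean_space \<Rightarrow> real"
  assumes [measurable]: "f \<in> borel_measurable borel"
  shows "(LINT x|lborel. f (x + w)) = (LINT x|lborel. f x)"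
proof -
  have "(LINT x|lborel. f x) = (LINT x|distr lborel borel ((+) w). f x)"
    by (simp add: lborel_distr_plus)
  also have "\<dots> = (LINT x|lborel. f (w + x))"
    by (rule integral_distr) auto
  finally show ?thesis by (simp add: add.commute)
qed

text \<open>Difference quotients move from \<open>F\<close> to \<open>v\<close> by translation
  invariance, and dominated convergence applies on both sides. Convergence of the quotients of
  \<open>F\<close> is asked only almost everywhere; the Lipschitz bound dominates them and thereby
  excludes a singular part of the derivative.\<close>

lemma integration_by_parts:
  fixes F D v :: "real^'d::finite \<Rightarrow> real"
  assumes F[measurable]: "F \<in> borel_measurable borel" and D[measurable]: "D \<in> borel_measurable borel"
    and K: "compact K" "\<And>x. x \<notin> K \<Longrightarrow> F x = 0" and B: "\<And>x. \<bar>F x\<bar> \<le> B"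
    and "h \<longlonglongrightarrow> 0" "\<And>n. h n \<noteq> 0"
    and Lip: "\<And>n x. \<bar>F (x + h n *\<^sub>R axis j 1) - F x\<bar> \<le> C * \<bar>h n\<bar>"
    and lim: "AE x in lborel. (\<lambda>n. (F (x + h n *\<^sub>R axis j 1) - F x) / h n) \<longlonglongrightarrow> D x"
    and v: "v \<in> test_fun V"
  shows "(LINT x|lborel. D x * v x) = - (LINT x|lborel. F x * partial_deriv j v x)"
proof -
  define e :: "real^'d" where "e = axis j 1"
  have vc: "continuous_on UNIV v" "continuous_on UNIV (partial_deriv j v)"
    using v test_fun_smooth test_fun_partial_deriv smooth_continuous by blast+
  then have [measurable]: "v \<in> borel_measurable borel" "partial_deriv j v \<in> borel_measurable borel"
    by (auto intro: borel_measurable_continuous_onI)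
  obtain Kv where Kv: "compact Kv" "\<And>x. x \<notin> Kv \<Longrightarrow> v x = 0"
    using v test_funE by metis
  obtain Bv where Bv: "\<And>x. \<bar>v x\<bar> \<le> Bv" using test_fun_bounded[OF v] by blast
  obtain Lv where Lv: "Lv \<ge> 0" "\<And>x t. \<bar>v (x + t *\<^sub>R e) - v x\<bar> \<le> Lv * \<bar>t\<bar>"
    using test_fun_Lipschitz_along[OF v, of j] unfolding e_def by blast
  \<comment> \<open>Substituting x - h e for x turns a forward quotient of \<open>F\<close> into a
    backward one of \<open>v\<close>.\<close>
  have swap: "(LINT x|lborel. (F (x + h n *\<^sub>R e) - F x) / h n * v x) =
      (LINT x|lborel. F x * ((v (x + (- h n) *\<^sub>R e) - v x) / h n))" for n
  proof -
    have i1: "integrable lborel (\<lambda>x. F x * v (x + (- h n) *\<^sub>R e))"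
      by (rule integrable_compact_support[OF _ K(1), of _ "B * Bv"])
         (auto simp: K abs_mult intro!: mult_mono B Bv order_trans[OF abs_ge_zero B])
    have i2: "integrable lborel (\<lambda>x. F x * v x)"
      by (rule integrable_compact_support[OF _ K(1), of _ "B * Bv"])
         (auto simp: K abs_mult intro!: mult_mono B Bv order_trans[OF abs_ge_zero B])
    have i3: "integrable lborel (\<lambda>x. F (x + h n *\<^sub>R e) * v x)"
      by (rule integrable_compact_support[OF _ Kv(1), of _ "B * Bv"])
         (auto simp: Kv abs_mult intro!: mult_mono B Bv order_trans[OF abs_ge_zero B])
    have "(LINT x|lborel. F (x + h n *\<^sub>R e) * v x) = (LINT x|lborel. F x * v (x + (- h n) *\<^sub>R e))"
      using lborel_integral_translate[of "\<lambda>x. F x * v (x + (- h n) *\<^sub>R e)" "h n *\<^sub>R e"] by simp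
    moreover have "(LINT x|lborel. (F (x + h n *\<^sub>R e) - F x) / h n * v x) =
        ((LINT x|lborel. F (x + h n *\<^sub>R e) * v x) - (LINT x|lborel. F x * v x)) / h n"
      unfolding Bochner_Integration.integral_diff[OF i3 i2, symmetric] integral_divide_zero[symmetric]
      by (simp add: left_diff_distrib)
    moreover have "(LINT x|lborel. F x * ((v (x + (- h n) *\<^sub>R e) - v x) / h n)) =
        ((LINT x|lborel. F x * v (x + (- h n) *\<^sub>R e)) - (LINT x|lborel. F x * v x)) / h n"
      unfolding Bochner_Integration.integral_diff[OF i1 i2, symmetric] integral_divide_zero[symmetric]
      by (simp add: right_diff_distrib)
    ultimately show ?thesis by (simp only:)
  qed
  have L1: "(\<lambda>n. LINT x|lborel. (F (x + h n *\<^sub>R e) - F x) / h n * v x) \<longlonglongrightarrow> (LINT x|lborel. D x * v x)"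
  proof (rule integral_dominated_convergence[where w = "\<lambda>x. C * \<bar>v x\<bar>"])
    show "integrable lborel (\<lambda>x. C * \<bar>v x\<bar>)"
      by (intro integrable_mult_right integrable_compact_support[OF _ Kv(1), of _ Bv]) (auto simp: Kv Bv)
    have "\<bar>(F (x + h n *\<^sub>R e) - F x) / h n\<bar> \<le> C" for n x
      using Lip[of x n] assms(7)[of n] by (simp add: e_def divide_simps)
    then show "AE x in lborel. norm ((F (x + h n *\<^sub>R e) - F x) / h n * v x) \<le> C * \<bar>v x\<bar>" for n
      by (intro AE_I2) (auto simp only: real_norm_def abs_mult intro!: mult_right_mono)
    show "AE x in lborel. (\<lambda>n. (F (x + h n *\<^sub>R e) - F x) / h n * v x) \<longlonglongrightarrow> D x * v x"
      using lim unfolding e_def by eventually_elim (intro tendsto_intros)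
  qed measurable
  have L2: "(\<lambda>n. LINT x|lborel. F x * ((v (x + (- h n) *\<^sub>R e) - v x) / h n))
      \<longlonglongrightarrow> (LINT x|lborel. F x * (- partial_deriv j v x))"
  proof (rule integral_dominated_convergence[where w = "\<lambda>x. \<bar>F x\<bar> * Lv"])
    show "integrable lborel (\<lambda>x. \<bar>F x\<bar> * Lv)"
      by (intro integrable_mult_left integrable_compact_support[OF _ K(1), of _ B]) (auto simp: K B)
    have "\<bar>(v (x + (- h n) *\<^sub>R e) - v x) / h n\<bar> \<le> Lv" for n x
      using Lv(2)[of x "- h n"] assms(7)[of n] by (simp add: divide_simps)
    then show "AE x in lborel. norm (F x * ((v (x + (- h n) *\<^sub>R e) - v x) / h n)) \<le> \<bar>F x\<bar> * Lv" for n
      by (intro AE_I2) (auto simp only: real_norm_def abs_mult intro!: mult_left_mono)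
    have "(\<lambda>n. (v (x + (- h n) *\<^sub>R e) - v x) / (- h n)) \<longlonglongrightarrow> partial_deriv j v x" for x
    proof -
      have "((\<lambda>t. v (x + t *\<^sub>R e)) has_field_derivative partial_deriv j v x) (at 0)"
        using has_derivative_along[of v "frechet_derivative v (at x)" x 0 e]
          smooth_has_derivative[OF test_fun_smooth[OF v], of x]
        by (simp add: partial_deriv_def e_def)
      then have *: "((\<lambda>t. (v (x + t *\<^sub>R e) - v x) / t) \<longlongrightarrow> partial_deriv j v x) (at 0)"
        by (simp add: DERIV_def)
      have "filterlim (\<lambda>n. - h n) (at 0) sequentially"
        unfolding filterlim_at using assms(6,7) tendsto_minus[OF assms(6)] by auto
      from filterlim_compose[OF * this] show ?thesis .
    qed
    from tendsto_minus[OF this]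
    have "(\<lambda>n. (v (x + (- h n) *\<^sub>R e) - v x) / h n) \<longlonglongrightarrow> - partial_deriv j v x" for x
      by (simp only: divide_minus_right minus_minus)
    then show "AE x in lborel. (\<lambda>n. F x * ((v (x + (- h n) *\<^sub>R e) - v x) / h n))
        \<longlonglongrightarrow> F x * (- partial_deriv j v x)"
      by (intro AE_I2 tendsto_intros)
  qed measurable
  from LIMSEQ_unique[OF L1 L2[folded swap]] show ?thesis by simp
qed

text \<open>The coefficients are assumed differentiable only inside the chambers, which fill
  \<open>E\<close> up to these finitely many hyperplanes.\<close>

lemma AE_lborel_distinct:
  "AE x in (lborel :: (real^'d::finite) measure). \<forall>i j. i \<noteq> j \<longrightarrow> x $ i \<noteq> x $ j"
proof -
  have "AE x in (lborel :: (real^'d) measure). x $ i \<noteq> x $ j" if "i \<noteq> j" for i j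
  proof -
    define a :: "real^'d" where "a = axis i 1 - axis j 1"
    have "a $ i = 1" using that by (simp add: a_def axis_def)
    then have "a \<noteq> 0" by auto
    then have "negligible {x. a \<bullet> x = 0}" by (intro negligible_hyperplane) auto
    moreover have "{x. a \<bullet> x = 0} = {x::real^'d. x $ i = x $ j}"
      by (auto simp: a_def inner_diff_left inner_axis')
    moreover have "closed {x. a \<bullet> x = 0}" by (rule closed_hyperplane)
    ultimately have "{x::real^'d. x $ i = x $ j} \<in> null_sets lborel"
      by (metis borel_closed negligible_iff_null_sets null_sets_completion_iff sets_lborel)
    then show ?thesis by (rule AE_I'[where N="{x. x $ i = x $ j}"]) auto
  qed
  then show ?thesis by (simp add: AE_all_countable)
qed

subsection \<open>The form on test functions\<close>

text \<open>The indices are read off in decreasing order of their coordinates. Enumerations start at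
  1 and lists at 0, whence the shift by one.\<close>

lemma sorting_enumeration:
  fixes x :: "real^'d::finite"
  assumes "\<And>i j. i \<noteq> j \<Longrightarrow> x $ i \<noteq> x $ j" "x \<in> E"
  obtains \<tau> where "perm_enum \<tau>" "x \<in> chamber E \<tau>"
proof -
  have inj: "inj (\<lambda>i. x $ i)" using assms(1) by (auto intro!: injI)
  define V where "V = range (\<lambda>i. x $ i)"
  define l where "l = rev (sorted_list_of_set V)"
  have l: "set l = V" "distinct l" "length l = CARD('d)" "sorted_wrt (>) l"
    using card_image[OF inj] strict_sorted_list_of_set[of V]
    by (auto simp: l_def V_def sorted_wrt_rev)
  define \<tau> where "\<tau> n = inv (\<lambda>i. x $ i) (l ! (n - 1))" for n
  have x\<tau>: "x $ \<tau> n = l ! (n - 1)" if "n \<in> {1..CARD('d)}" for n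
  proof -
    have "l ! (n - 1) \<in> V" using that l by (metis One_nat_def Suc_pred atLeastAtMost_iff less_Suc_eq_le less_eq_Suc_le nth_mem)
    then show ?thesis unfolding \<tau>_def V_def by (rule f_inv_into_f)
  qed
  have "inj_on \<tau> {1..CARD('d)}"
  proof (rule inj_onI)
    fix m n assume *: "m \<in> {1..CARD('d)}" "n \<in> {1..CARD('d)}" "\<tau> m = \<tau> n"
    then have "l ! (m - 1) = l ! (n - 1)" using x\<tau> by metis
    moreover have "m - 1 < length l" "n - 1 < length l" using * l by auto
    ultimately have "m - 1 = n - 1" using l(2) nth_eq_iff_index_eq by blast
    then show "m = n" using * by auto
  qed
  then have "perm_enum \<tau>"
    unfolding perm_enum_def bij_betw_def by (simp add: card_image card_subset_eq)
  moreover have "x $ \<tau> i > x $ \<tau> (Suc i)" if "i \<in> {1..<CARD('d)}" for i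
  proof -
    have "l ! (i - 1) > l ! i"
      using that l(3,4) by (intro sorted_wrt_nth_less[of "(>)"]) auto
    then show ?thesis using that by (simp add: x\<tau>)
  qed
  ultimately show thesis
    using assms(2) by (intro that[of \<tau>]) (auto simp: chamber_def)
qed

locale dirichlet_data =
  fixes E :: "(real^'d::finite) set" and c :: "real^'d \<Rightarrow> real^'d^'d" and p :: "real^'d \<Rightarrow> real"
  assumes open_E: "open E" and adm: "admissible E c p"
begin

abbreviation \<mu> :: "(real^'d) measure" where "\<mu> \<equiv> ref_measure E p"

lemma p_cont: "continuous_on E p" and p_pos: "x \<in> E \<Longrightarrow> p x > 0"
  and c_cont: "continuous_on E c" and c_sym: "x \<in> E \<Longrightarrow> transpose (c x) = c x"
  and c_pos: "x \<in> E \<Longrightarrow> v \<noteq> 0 \<Longrightarrow> v \<bullet> (c x *v v) > 0"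
  using adm by (auto simp: admissible_def C1_T_def spd_matrices_def image_subset_iff)

lemma c_nonneg: "x \<in> E \<Longrightarrow> v \<bullet> (c x *v v) \<ge> 0"
  using c_pos[of x v] by (cases "v = 0") auto


lemma E_borel [measurable]: "E \<in> sets borel" using open_E by simp

lemma space_\<mu> [simp]: "space \<mu> = E"
  by (simp add: ref_measure_def space_restrict_space)

lemma sets_\<mu> [measurable_cong]: "sets \<mu> = sets (restrict_space borel E)"
  by (simp add: ref_measure_def sets_restrict_space)

lemma p_meas [measurable]: "p \<in> borel_measurable (restrict_space borel E)"
  using p_cont by (rule borel_measurable_continuous_on_restrict)

lemma p_meas' [measurable]: "p \<in> borel_measurable (restrict_space lborel E)"
  using p_meas by (simp add: measurable_def space_restrict_space sets_restrict_space)

lemma borel_imp_meas_\<mu>: "f \<in> borel_measurable borel \<Longrightarrow> f \<in> borel_measurable \<mu>"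
  unfolding measurable_cong_sets[OF sets_\<mu> refl] by (rule measurable_restrict_space1)

lemma cont_imp_meas_\<mu>: "continuous_on E (f :: real^'d \<Rightarrow> real) \<Longrightarrow> f \<in> borel_measurable \<mu>"
  unfolding measurable_cong_sets[OF sets_\<mu> refl] by (rule borel_measurable_continuous_on_restrict)

lemma meas_restrict_lborel: "borel_measurable (restrict_space lborel E) = borel_measurable \<mu>"
  by (rule measurable_cong_sets) (simp_all add: sets_\<mu> sets_restrict_space)

lemma integral_\<mu>:
  fixes f :: "real^'d \<Rightarrow> real"
  assumes [measurable]: "f \<in> borel_measurable \<mu>"
  shows "(LINT x|\<mu>. f x) = (LINT x:E|lborel. p x * f x)"
proof -
  have "f \<in> borel_measurable (restrict_space lborel E)" using assms by (simp add: meas_restrict_lborel)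
  then have "(LINT x|\<mu>. f x) = (LINT x|restrict_space lborel E. p x * f x)"
    unfolding ref_measure_def using p_pos
    by (subst integral_density) (auto intro!: AE_I2 simp: space_restrict_space less_imp_le)
  then show ?thesis
    by (simp add: integral_restrict_space set_lebesgue_integral_def)
qed

lemma AE_\<mu>_iff:
  "(AE x in \<mu>. P x) \<longleftrightarrow> (AE x in lborel. x \<in> E \<longrightarrow> P x)"
proof -
  have "(AE x in \<mu>. P x) \<longleftrightarrow> (AE x in restrict_space lborel E. 0 < ennreal (p x) \<longrightarrow> P x)"
    unfolding ref_measure_def by (rule AE_density) simp
  also have "\<dots> \<longleftrightarrow> (AE x in lborel. x \<in> E \<longrightarrow> 0 < ennreal (p x) \<longrightarrow> P x)"
    by (subst AE_restrict_space_iff) auto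
  also have "\<dots> \<longleftrightarrow> (AE x in lborel. x \<in> E \<longrightarrow> P x)"
    using p_pos by (intro arg_cong[where f="\<lambda>P. AE x in lborel. P x"]) (auto simp: fun_eq_iff)
  finally show ?thesis .
qed

lemma compact_bound:
  assumes "compact K" "K \<subseteq> E" "continuous_on E (f :: real^'d \<Rightarrow> real)"
  obtains B where "B \<ge> 0" "\<And>x. x \<in> K \<Longrightarrow> \<bar>f x\<bar> \<le> B"
proof -
  have "compact (f ` K)"
    using assms by (intro compact_continuous_image continuous_on_subset[OF assms(3)]) auto
  then obtain B where B: "\<forall>y\<in>f ` K. norm y \<le> B"
    using compact_imp_bounded bounded_iff by blast
  have "\<bar>f x\<bar> \<le> max B 0" if "x \<in> K" for x
    using B that by (auto simp: le_max_iff_disj)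
  then show thesis by (intro that[of "max B 0"]) auto
qed

lemma emeasure_\<mu>_compact:
  assumes "compact K" "K \<subseteq> E"
  shows "emeasure \<mu> K < \<infinity>" "K \<in> sets \<mu>"
proof -
  have Ks: "K \<in> sets (restrict_space lborel E)"
    using assms by (auto simp: sets_restrict_space_iff borel_closed compact_imp_closed)
  show "K \<in> sets \<mu>" using Ks by (simp add: sets_\<mu> sets_restrict_space)
  obtain B where B: "B \<ge> 0" "\<And>x. x \<in> K \<Longrightarrow> \<bar>p x\<bar> \<le> B" using compact_bound[OF assms p_cont] by blast
  have "emeasure \<mu> K = (\<integral>\<^sup>+x. ennreal (p x) * indicator K x \<partial>restrict_space lborel E)"
    unfolding ref_measure_def by (rule emeasure_density[OF _ Ks]) simp
  also have "\<dots> \<le> (\<integral>\<^sup>+x. ennreal B * indicator K x \<partial>restrict_space lborel E)"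
    using B by (intro nn_integral_mono) (auto simp: indicator_def intro!: ennreal_leI dest: abs_le_D1)
  also have "\<dots> = ennreal B * emeasure lborel K"
    using assms Ks by (simp add: nn_integral_cmult_indicator emeasure_restrict_space)
  also have "\<dots> < \<infinity>"
    using emeasure_compact_finite[OF assms(1)] by (simp add: ennreal_mult_less_top)
  finally show "emeasure \<mu> K < \<infinity>" .
qed

lemma compact_support_\<mu>:
  assumes "f \<in> borel_measurable \<mu>" "compact K" "K \<subseteq> E" "\<And>x. x \<in> E \<Longrightarrow> x \<notin> K \<Longrightarrow> f x = 0" "\<And>x. x \<in> K \<Longrightarrow> \<bar>f x\<bar> \<le> B"
  shows "integrable \<mu> f" and "L2 \<mu> f"
proof -
  have *: "integrable \<mu> g" if "g \<in> borel_measurable \<mu>" "\<And>x. x \<in> E \<Longrightarrow> x \<notin> K \<Longrightarrow> g x = 0" "\<And>x. x \<in> K \<Longrightarrow> \<bar>g x\<bar> \<le> B'"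
    for g :: "real^'d \<Rightarrow> real" and B'
  proof (rule Bochner_Integration.integrable_bound[OF _ that(1)])
    show "integrable \<mu> (\<lambda>x. B' * indicator K x)"
      using emeasure_\<mu>_compact[OF assms(2,3)] by (intro integrable_mult_right integrable_real_indicator)
    show "AE x in \<mu>. norm (g x) \<le> norm (B' * indicator K x)"
      using that(2,3) by (intro AE_I2) (force simp: indicator_def)
  qed
  show "integrable \<mu> f" by (rule *[OF assms(1,4,5)])
  have "\<bar>(f x)\<^sup>2\<bar> \<le> B\<^sup>2" if "x \<in> K" for x
    using power_mono[OF assms(5)[OF that], of 2] by simp
  then have "integrable \<mu> (\<lambda>x. (f x)\<^sup>2)"
    using assms(1,4) by (intro *[of _ "B\<^sup>2"]) auto
  with assms(1) show "L2 \<mu> f" by (simp add: L2_def)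
qed

lemma test_fun_L2:
  assumes "u \<in> test_fun E"
  shows "L2 \<mu> u" "integrable \<mu> u"
proof -
  from assms obtain K where K: "smooth u" "compact K" "K \<subseteq> E" "\<And>x. x \<notin> K \<Longrightarrow> u x = 0"
    using test_funE by blast
  obtain B where B: "\<And>x. \<bar>u x\<bar> \<le> B" using test_fun_bounded[OF assms] by blast
  show "L2 \<mu> u" "integrable \<mu> u"
    by (rule compact_support_\<mu>[OF _ K(2,3), of _ B]; use K B in \<open>auto intro!: cont_imp_meas_\<mu> smooth_continuous\<close>)+
qed

text \<open>Component j of p c^T grad u, where c is symmetric on \<open>E\<close>. The factor
  \<open>p\<close> stays attached to \<open>c\<close> because it is the product that is Lipschitz on
  compact sets.\<close>

definition flux :: "(real^'d \<Rightarrow> real) \<Rightarrow> 'd \<Rightarrow> real^'d \<Rightarrow> real" where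
  "flux u j x = (\<Sum>i\<in>UNIV. p x * c x $ i $ j * partial_deriv i u x)"

abbreviation form :: "(real^'d \<Rightarrow> real) \<Rightarrow> (real^'d \<Rightarrow> real) \<Rightarrow> real" where
  "form \<equiv> pre_form E c p"

lemma flux_outside:
  assumes "compact K" "\<And>x. x \<notin> K \<Longrightarrow> u x = 0" "x \<notin> K"
  shows "flux u j x = 0"
  using assms by (auto simp: flux_def partial_deriv_outside[of K] compact_imp_closed)

lemma c_entry_cont: "continuous_on E (\<lambda>x. c x $ i $ j)"
  using c_cont by (intro continuous_intros)

lemma flux_cont: "u \<in> test_fun E \<Longrightarrow> continuous_on E (flux u j)"
  unfolding flux_def[abs_def]
  by (intro continuous_intros p_cont c_entry_cont smooth_continuous smooth_partial_deriv test_fun_smooth)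

text \<open>Off \<open>E\<close> the coefficients are arbitrary, but there the gradient factor
  vanishes. So the flux is a bounded Borel function on the whole space and can be integrated against
  \<open>lborel\<close>.\<close>

lemma flux_compact_support:
  assumes "u \<in> test_fun E"
  obtains K B where "compact K" "K \<subseteq> E" "\<And>x. x \<notin> K \<Longrightarrow> u x = 0" "\<And>j x. x \<notin> K \<Longrightarrow> flux u j x = 0"
    "\<And>j x. \<bar>flux u j x\<bar> \<le> B" "\<And>j. flux u j \<in> borel_measurable borel"
proof -
  from assms obtain K where K: "smooth u" "compact K" "K \<subseteq> E" "\<And>x. x \<notin> K \<Longrightarrow> u x = 0"
    using test_funE by blast
  have out: "flux u j x = 0" if "x \<notin> K" for j x
    using K that by (intro flux_outside) auto
  have "\<exists>B\<ge>0. \<forall>x\<in>K. \<bar>flux u j x\<bar> \<le> B" for j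
    using compact_bound[OF K(2,3) flux_cont[OF assms, of j]] by metis
  then obtain B where B: "\<And>j. B j \<ge> 0" "\<And>j x. x \<in> K \<Longrightarrow> \<bar>flux u j x\<bar> \<le> B j" by metis
  have "\<bar>flux u j x\<bar> \<le> sum B UNIV" for j x
  proof -
    have "\<bar>flux u j x\<bar> \<le> B j" using B out[of x j] by (cases "x \<in> K") auto
    also have "\<dots> \<le> sum B UNIV" using B by (intro member_le_sum) auto
    finally show ?thesis .
  qed
  moreover have "flux u j \<in> borel_measurable borel" for j
  proof -
    have "(\<lambda>x. indicator K x *\<^sub>R flux u j x) \<in> borel_measurable borel"
      using K continuous_on_subset[OF flux_cont[OF assms] K(3)]
      by (intro borel_measurable_continuous_on_indicator) (auto simp: borel_closed compact_imp_closed)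
    also have "(\<lambda>x. indicator K x *\<^sub>R flux u j x) = flux u j"
      using out by (auto simp: indicator_def fun_eq_iff)
    finally show ?thesis .
  qed
  ultimately show thesis using K out by (intro that[of K "sum B UNIV"]) auto
qed

lemma integrand_eq:
  "(gradient u x \<bullet> (c x *v gradient v x)) * p x = (\<Sum>j\<in>UNIV. flux u j x * partial_deriv j v x)"
proof -
  have "(gradient u x \<bullet> (c x *v gradient v x)) * p x =
      (\<Sum>i\<in>UNIV. \<Sum>j\<in>UNIV. p x * c x $ i $ j * partial_deriv i u x * partial_deriv j v x)"
    by (simp add: inner_vec_def matrix_vector_mult_def gradient_def sum_distrib_left sum_distrib_right mult_ac)
  also have "\<dots> = (\<Sum>j\<in>UNIV. flux u j x * partial_deriv j v x)"
    by (subst sum.swap) (simp add: flux_def sum_distrib_right)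
  finally show ?thesis .
qed

lemma flux_integrable:
  assumes "u \<in> test_fun E" "v \<in> test_fun E"
  shows "integrable lborel (\<lambda>x. flux u j x * v x)"
proof -
  from assms(1) obtain K B where K: "compact K" "\<And>j x. x \<notin> K \<Longrightarrow> flux u j x = 0"
    "\<And>j x. \<bar>flux u j x\<bar> \<le> B" "\<And>j. flux u j \<in> borel_measurable borel"
    using flux_compact_support by metis
  obtain Bv where Bv: "\<And>x. \<bar>v x\<bar> \<le> Bv" using test_fun_bounded[OF assms(2)] by blast
  have "v \<in> borel_measurable borel"
    using assms(2) by (intro borel_measurable_continuous_onI smooth_continuous test_fun_smooth)
  then show ?thesis
    by (intro integrable_compact_support[OF _ K(1), of _ "B * Bv"])
       (auto simp: K abs_mult intro!: mult_mono Bv borel_measurable_times order_trans[OF abs_ge_zero K(3)[of _ 0]]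
        intro: order_trans[OF abs_ge_zero K(3)])
qed

lemma form_eq:
  assumes "u \<in> test_fun E" "v \<in> test_fun E"
  shows "form u v = 1/2 * (\<Sum>j\<in>UNIV. (LINT x|lborel. flux u j x * partial_deriv j v x))"
proof -
  from assms(1) obtain K where K: "compact K" "K \<subseteq> E" "\<And>j x. x \<notin> K \<Longrightarrow> flux u j x = 0"
    using flux_compact_support by metis
  then have out: "\<And>j x. x \<notin> E \<Longrightarrow> flux u j x = 0" by blast
  have "(LINT x:E|lborel. (gradient u x \<bullet> (c x *v gradient v x)) * p x) =
    (LINT x|lborel. (\<Sum>j\<in>UNIV. flux u j x * partial_deriv j v x))"
    unfolding set_lebesgue_integral_def integrand_eq
    by (intro Bochner_Integration.integral_cong) (auto simp: indicator_def out)
  also have "\<dots> = (\<Sum>j\<in>UNIV. (LINT x|lborel. flux u j x * partial_deriv j v x))"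
    by (intro Bochner_Integration.integral_sum flux_integrable test_fun_partial_deriv assms)
  finally show ?thesis by (simp add: pre_form_def)
qed

lemma form_sym: "form u v = form v u"
proof -
  have "x \<in> E \<Longrightarrow> gradient u x \<bullet> (c x *v gradient v x) = gradient v x \<bullet> (c x *v gradient u x)" for x
    by (metis c_sym dot_lmul_matrix transpose_matrix_vector inner_commute)
  then show ?thesis
    by (auto simp: pre_form_def intro!: set_lebesgue_integral_cong)
qed

lemma form_nonneg: "form u u \<ge> 0"
proof -
  have "(LINT x:E|lborel. (gradient u x \<bullet> (c x *v gradient u x)) * p x) \<ge> 0"
    unfolding set_lebesgue_integral_def
    by (rule Bochner_Integration.integral_nonneg) (auto simp: indicator_def intro!: mult_nonneg_nonneg c_nonneg less_imp_le[OF p_pos])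
  then show ?thesis by (simp add: pre_form_def)
qed

lemma form_diff_right:
  assumes "u \<in> test_fun E" "v \<in> test_fun E" "w \<in> test_fun E"
  shows "form u (\<lambda>x. v x - w x) = form u v - form u w"
  using assms flux_integrable[OF assms(1) test_fun_partial_deriv[OF assms(2)]]
    flux_integrable[OF assms(1) test_fun_partial_deriv[OF assms(3)]]
  by (simp add: form_eq test_fun_diff smooth_partial_deriv_diff test_fun_smooth right_diff_distrib
      sum_subtractf)

lemma form_diff_left:
  assumes "u \<in> test_fun E" "v \<in> test_fun E" "w \<in> test_fun E"
  shows "form (\<lambda>x. v x - w x) u = form v u - form w u"
  using form_diff_right[OF assms] by (simp add: form_sym[of _ u])

lemma form_cmult_right:
  assumes "u \<in> test_fun E" "v \<in> test_fun E"
  shows "form u (\<lambda>x. a * v x) = a * form u v"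
  using assms
  by (simp add: form_eq test_fun_cmult smooth_partial_deriv_cmult test_fun_smooth mult.left_commute[of _ a]
      sum_distrib_left)

lemma form_cmult_left:
  assumes "u \<in> test_fun E" "v \<in> test_fun E"
  shows "form (\<lambda>x. a * v x) u = a * form v u"
  using form_cmult_right[OF assms] by (simp add: form_sym[of _ u])

lemma form_Cauchy_Schwarz:
  assumes "u \<in> test_fun E" "v \<in> test_fun E"
  shows "\<bar>form u v\<bar> \<le> sqrt (form u u) * sqrt (form v v)"
proof (rule Cauchy_Schwarz_of_nonneg_form)
  fix t
  have "form (\<lambda>x. u x - (-t) * v x) (\<lambda>x. u x - (-t) * v x) = form u u + 2 * t * form u v + t\<^sup>2 * form v v"
    using assms
    by (simp only: form_diff_left form_diff_right test_fun_diff test_fun_cmult form_cmult_right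
        form_cmult_left form_sym[of v u])
      (simp add: algebra_simps power2_eq_square)
  then show "0 \<le> form u u + 2 * t * form u v + t\<^sup>2 * form v v"
    using form_nonneg[of "\<lambda>x. u x - (-t) * v x"] by simp
qed (simp_all add: form_nonneg)

subsection \<open>Test functions belong to the domain of the generator\<close>

lemma entry_abs_le:
  fixes A :: "real^'d^'d" shows "\<bar>A $ i $ j\<bar> \<le> norm A"
proof -
  have "norm (A $ i $ j) \<le> norm (A $ i)" by (simp add: component_le_norm_cart)
  also have "\<dots> \<le> norm A" by (rule Finite_Cartesian_Product.norm_nth_le)
  finally show ?thesis by simp
qed

text \<open>If one endpoint lies in the support of \<open>u\<close>, a step of length at most
  \<delta> keeps both in a compact neighbourhood inside \<open>E\<close> where c p is Lipschitz and
  the product rule for Lipschitz functions applies. Otherwise the flux vanishes at both.\<close>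

lemma flux_Lipschitz_along:
  assumes "u \<in> test_fun E"
  obtains \<delta> C where "\<delta> > 0" "\<And>x h. \<bar>h\<bar> \<le> \<delta> \<Longrightarrow> \<bar>flux u j (x + h *\<^sub>R axis j 1) - flux u j x\<bar> \<le> C * \<bar>h\<bar>"
proof -
  from assms obtain K where K: "smooth u" "compact K" "K \<subseteq> E" "\<And>x. x \<notin> K \<Longrightarrow> u x = 0"
    using test_funE by blast
  have out: "flux u j x = 0" if "x \<notin> K" for x
    using K that by (intro flux_outside) auto
  obtain \<delta> where \<delta>: "\<delta> > 0" "(\<Union>x\<in>K. cball x \<delta>) \<subseteq> E"
    using compact_subset_open_imp_cball_epsilon_subset[OF K(2) open_E K(3)] by blast
  define K' where "K' = (\<Union>x\<in>K. cball x \<delta>)"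
  have K': "compact K'" "K' \<subseteq> E"
    using \<delta> K(2) by (auto simp: K'_def intro: compact_minkowski_sum_cball)
  obtain L where L: "L-lipschitz_on K' (\<lambda>x. p x *\<^sub>R c x)"
    using adm K' by (auto simp: admissible_def)
  have "\<exists>A\<ge>0. \<forall>x\<in>K'. \<bar>p x * c x $ i $ j\<bar> \<le> A" for i
    using compact_bound[OF K' continuous_on_mult[OF p_cont c_entry_cont[of i j]]] by metis
  then obtain A where A: "\<And>i. A i \<ge> 0" "\<And>i x. x \<in> K' \<Longrightarrow> \<bar>p x * c x $ i $ j\<bar> \<le> A i" by metis
  have "\<exists>B. \<forall>x. \<bar>partial_deriv i u x\<bar> \<le> B" for i
    using test_fun_bounded[OF test_fun_partial_deriv[OF assms, of i]] by metis
  then obtain B where B: "\<And>i x. \<bar>partial_deriv i u x\<bar> \<le> B i" by metis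
  have "\<exists>B. \<forall>x t. \<bar>partial_deriv i u (x + t *\<^sub>R axis j 1) - partial_deriv i u x\<bar> \<le> B * \<bar>t\<bar>" for i
    using test_fun_Lipschitz_along[OF test_fun_partial_deriv[OF assms, of i], of j] by metis
  then obtain B' where B': "\<And>i x t. \<bar>partial_deriv i u (x + t *\<^sub>R axis j 1) - partial_deriv i u x\<bar> \<le> B' i * \<bar>t\<bar>"
    by metis
  define C where "C = (\<Sum>i\<in>UNIV. L * B i + A i * B' i)"
  have Bp: "B i \<ge> 0" for i using B[of i 0] by linarith
  have B'p: "B' i \<ge> 0" for i using B'[of i 0 1] by linarith
  have Lp: "L \<ge> 0" using L by (rule lipschitz_on_nonneg)
  have Cp: "C \<ge> 0" unfolding C_def using Bp B'p Lp A by (intro sum_nonneg add_nonneg_nonneg mult_nonneg_nonneg) auto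
  have "\<bar>flux u j (x + h *\<^sub>R axis j 1) - flux u j x\<bar> \<le> C * \<bar>h\<bar>" if h: "\<bar>h\<bar> \<le> \<delta>" for x h
  proof (cases "x \<in> K \<or> x + h *\<^sub>R axis j 1 \<in> K")
    case False
    then show ?thesis using Cp by (simp add: out)
  next
    case True
    define y where "y = x + h *\<^sub>R axis j 1"
    have d: "dist x y = \<bar>h\<bar>" by (simp add: y_def dist_norm)
    have "\<exists>z\<in>K. dist z x \<le> \<delta> \<and> dist z y \<le> \<delta>"
      using True h d \<delta>(1) unfolding y_def[symmetric]
      by (elim disjE; intro bexI conjI; simp add: dist_commute)
    then have xy: "x \<in> K'" "y \<in> K'"
      unfolding K'_def by auto
    have "\<bar>p y * c y $ i $ j * partial_deriv i u y - p x * c x $ i $ j * partial_deriv i u x\<bar> \<le> (L * B i + A i * B' i) * \<bar>h\<bar>" for i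
    proof -
      have "\<bar>p y * c y $ i $ j - p x * c x $ i $ j\<bar> \<le> norm (p y *\<^sub>R c y - p x *\<^sub>R c x)"
        using entry_abs_le[of "p y *\<^sub>R c y - p x *\<^sub>R c x" i j] by simp
      also have "\<dots> \<le> L * \<bar>h\<bar>"
        using lipschitz_onD[OF L xy(2,1)] d by (simp add: dist_norm norm_minus_commute)
      finally have 1: "\<bar>p y * c y $ i $ j - p x * c x $ i $ j\<bar> * \<bar>partial_deriv i u y\<bar> \<le> L * \<bar>h\<bar> * B i"
        using B[of i y] Lp by (intro mult_mono) auto
      have 2: "\<bar>p x * c x $ i $ j\<bar> * \<bar>partial_deriv i u y - partial_deriv i u x\<bar> \<le> A i * (B' i * \<bar>h\<bar>)"
        using A(1)[of i] A(2)[OF xy(1), of i] B'[of i x h] unfolding y_def by (intro mult_mono) auto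
      have "p y * c y $ i $ j * partial_deriv i u y - p x * c x $ i $ j * partial_deriv i u x =
        (p y * c y $ i $ j - p x * c x $ i $ j) * partial_deriv i u y +
        p x * c x $ i $ j * (partial_deriv i u y - partial_deriv i u x)"
        by (simp add: algebra_simps)
      then have "\<bar>p y * c y $ i $ j * partial_deriv i u y - p x * c x $ i $ j * partial_deriv i u x\<bar> \<le>
        \<bar>p y * c y $ i $ j - p x * c x $ i $ j\<bar> * \<bar>partial_deriv i u y\<bar> +
        \<bar>p x * c x $ i $ j\<bar> * \<bar>partial_deriv i u y - partial_deriv i u x\<bar>"
        using abs_triangle_ineq[of "(p y * c y $ i $ j - p x * c x $ i $ j) * partial_deriv i u y"
          "p x * c x $ i $ j * (partial_deriv i u y - partial_deriv i u x)"]
        by (simp only: abs_mult)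
      with 1 2 show ?thesis by (simp add: algebra_simps)
    qed
    then have "\<bar>flux u j y - flux u j x\<bar> \<le> (\<Sum>i\<in>UNIV. (L * B i + A i * B' i) * \<bar>h\<bar>)"
      unfolding flux_def sum_subtractf[symmetric] by (intro order_trans[OF sum_abs] sum_mono)
    then show ?thesis by (simp add: C_def sum_distrib_right y_def)
  qed
  with \<delta>(1) show thesis by (rule that)
qed

lemma flux_differentiable:
  assumes "u \<in> test_fun E" "x \<in> E" "\<And>i j. i \<noteq> j \<Longrightarrow> x $ i \<noteq> x $ j"
  obtains F' where "(flux u j has_derivative F') (at x)"
proof -
  obtain \<tau> where \<tau>: "perm_enum \<tau>" "x \<in> chamber E \<tau>"
    using sorting_enumeration[OF assms(3,2)] by blast
  have "C1_on (chamber E \<tau>) c" "C1_on (chamber E \<tau>) p"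
    using adm \<tau>(1) by (auto simp: admissible_def C1_T_def)
  then obtain c' p' where c': "(c has_derivative c') (at x)" and p': "(p has_derivative p') (at x)"
    using \<tau>(2) unfolding C1_on_def by meson
  have "\<exists>F'. ((\<lambda>x. p x * c x $ i $ j * partial_deriv i u x) has_derivative F') (at x)" for i
  proof -
    have "((\<lambda>x. c x $ i $ j) has_derivative (\<lambda>h. c' h $ i $ j)) (at x)"
      by (intro bounded_linear.has_derivative[OF bounded_linear_vec_nth] c')
    from has_derivative_mult[OF has_derivative_mult[OF p' this]
        smooth_has_derivative[OF smooth_partial_deriv[OF test_fun_smooth[OF assms(1)], of i]]]
    show ?thesis by blast
  qed
  then have "\<exists>F'. \<forall>i. ((\<lambda>x. p x * c x $ i $ j * partial_deriv i u x) has_derivative F' i) (at x)"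
    by (intro choice allI)
  then obtain F' where "\<And>i. ((\<lambda>x. p x * c x $ i $ j * partial_deriv i u x) has_derivative F' i) (at x)"
    by blast
  then have "((\<lambda>x. \<Sum>i\<in>UNIV. p x * c x $ i $ j * partial_deriv i u x) has_derivative (\<lambda>h. \<Sum>i\<in>UNIV. F' i h)) (at x)"
    by (intro has_derivative_sum)
  then have "(flux u j has_derivative (\<lambda>h. \<Sum>i\<in>UNIV. F' i h)) (at x)"
    by (simp add: flux_def[abs_def])
  then show thesis by (rule that)
qed

text \<open>\<open>D\<close> is the almost everywhere derivative of the flux along axis j.
  Integrating by parts is legitimate although the flux may have kinks on the chamber walls, since it
  is Lipschitz across them.\<close>

lemma flux_divergence:
  assumes "u \<in> test_fun E"
  obtains D K B where "D \<in> borel_measurable borel" "compact K" "K \<subseteq> E" "\<And>x. x \<notin> K \<Longrightarrow> D x = 0"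
    "\<And>x. \<bar>D x\<bar> \<le> B"
    "\<And>v. v \<in> test_fun E \<Longrightarrow> (LINT x|lborel. flux u j x * partial_deriv j v x) = - (LINT x|lborel. D x * v x)"
proof -
  define e :: "real^'d" where "e = axis j 1"
  define F where "F = flux u j"
  obtain K B where K: "compact K" "K \<subseteq> E" "\<And>x. x \<notin> K \<Longrightarrow> F x = 0"
    "\<And>x. \<bar>F x\<bar> \<le> B" and Fm[measurable]: "F \<in> borel_measurable borel"
    unfolding F_def using flux_compact_support[OF assms] by metis
  obtain \<delta> C where \<delta>: "\<delta> > 0" and C: "\<And>x h. \<bar>h\<bar> \<le> \<delta> \<Longrightarrow> \<bar>F (x + h *\<^sub>R e) - F x\<bar> \<le> C * \<bar>h\<bar>"
    unfolding F_def e_def using flux_Lipschitz_along[OF assms, of j] by blast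
  define h where "h n = \<delta> / real (Suc n)" for n
  have h: "h \<longlonglongrightarrow> 0" "\<And>n. h n > 0"
    using LIMSEQ_Suc[OF lim_const_over_n[of \<delta>]] \<delta> by (auto simp: h_def[abs_def] simp del: of_nat_Suc)
  then have h0: "\<And>n. h n \<noteq> 0" by (metis less_irrefl)
  have hle: "\<bar>h n\<bar> \<le> \<delta>" for n
    using \<delta> by (simp add: h_def divide_simps)
  have hat: "filterlim h (at 0) sequentially"
    unfolding filterlim_at using h h0 by auto
  define q where "q n x = (F (x + h n *\<^sub>R e) - F x) / h n" for n x
  have [measurable]: "q n \<in> borel_measurable borel" for n unfolding q_def[abs_def] by measurable
  have qC: "\<bar>q n x\<bar> \<le> C" for n x
    using C[OF hle, of x n] h0[of n] by (simp add: q_def divide_simps)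
  have qK: "(\<lambda>n. q n x) \<longlonglongrightarrow> 0" if "x \<notin> K" for x
  proof -
    have "(\<lambda>n. x + h n *\<^sub>R e) \<longlonglongrightarrow> x + 0 *\<^sub>R e" using h by (intro tendsto_intros)
    then have "(\<lambda>n. x + h n *\<^sub>R e) \<longlonglongrightarrow> x" by simp
    moreover have "open (- K)" "x \<in> - K" using K(1) that by (auto simp: compact_imp_closed)
    ultimately have "\<forall>\<^sub>F n in sequentially. x + h n *\<^sub>R e \<in> - K"
      by (rule topological_tendstoD)
    then show ?thesis
      by (intro tendsto_eventually) (auto elim!: eventually_mono simp: q_def K that)
  qed
  define G where "G = E \<inter> {x::real^'d. \<forall>i j. i \<noteq> j \<longrightarrow> x $ i \<noteq> x $ j}"
  have [measurable]: "G \<in> sets borel"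
  proof -
    have "{x::real^'d. \<forall>i j. i \<noteq> j \<longrightarrow> x $ i \<noteq> x $ j} = (\<Inter>i. \<Inter>j. {x. i \<noteq> j \<longrightarrow> x $ i \<noteq> x $ j})"
      by auto
    also have "open \<dots>" by (intro open_INT ballI finite open_Collect_imp closed_Collect_const open_Collect_neq continuous_intros)
    finally show ?thesis by (auto simp: G_def open_E)
  qed
  have conv: "convergent (\<lambda>n. q n x)" if x: "x \<in> G" for x
  proof -
    obtain F' where "(F has_derivative F') (at x)"
      by (rule flux_differentiable[OF assms, of x j]) (use x in \<open>auto simp: G_def F_def\<close>)
    then have "((\<lambda>t. F (x + t *\<^sub>R e)) has_field_derivative F' e) (at 0)"
      by (intro has_derivative_along) simp
    then have "((\<lambda>t. (F (x + t *\<^sub>R e) - F x) / t) \<longlongrightarrow> F' e) (at 0)"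
      by (simp add: DERIV_def)
    from filterlim_compose[OF this hat] show ?thesis
      by (auto simp: convergent_def q_def)
  qed
  \<comment> \<open>Taking the limit along one fixed sequence of steps makes \<open>D\<close>
    measurable at once. Outside \<open>G\<close> the sequence may diverge and \<open>lim\<close> be
    meaningless, so \<open>D\<close> is set to 0 there.\<close>
  define D where "D x = indicator G x * lim (\<lambda>n. q n x)" for x
  have Dm: "D \<in> borel_measurable borel" unfolding D_def[abs_def] by measurable
  have qD: "(\<lambda>n. q n x) \<longlonglongrightarrow> D x" if "x \<in> G \<or> x \<notin> E" for x
  proof (cases "x \<in> G")
    case True
    with conv[of x] show ?thesis by (simp add: D_def convergent_LIMSEQ_iff)
  next
    case False
    with that K(2) have "x \<notin> K" by blast
    with qK False show ?thesis by (simp add: D_def)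
  qed
  have DK: "D x = 0" if "x \<notin> K" for x
    using qK[OF that] limI by (auto simp: D_def)
  have DC: "\<bar>D x\<bar> \<le> C" for x
  proof (cases "x \<in> G")
    case True
    then have "(\<lambda>n. \<bar>q n x\<bar>) \<longlonglongrightarrow> \<bar>D x\<bar>" by (intro tendsto_intros qD) simp
    then show ?thesis by (rule LIMSEQ_le_const2) (auto simp: qC)
  next
    case False
    then show ?thesis using qC[of 0 x] by (simp add: D_def)
  qed
  have ae: "AE x in lborel. (\<lambda>n. q n x) \<longlonglongrightarrow> D x"
    using AE_lborel_distinct by eventually_elim (auto intro!: qD simp: G_def)
  have "(LINT x|lborel. F x * partial_deriv j v x) = - (LINT x|lborel. D x * v x)" if "v \<in> test_fun E" for v
    using integration_by_parts[OF Fm Dm K(1,3,4) h(1) h0, of j C v E] C[OF hle] ae that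
    unfolding q_def e_def by simp
  with Dm K(1,2) DK DC show thesis by (intro that) (auto simp: F_def)
qed

text \<open>\<open>form_generator\<close> read on test functions only, before closability is
  available to extend the identity to the whole form domain.\<close>

definition has_generator :: "(real^'d \<Rightarrow> real) \<Rightarrow> (real^'d \<Rightarrow> real) \<Rightarrow> bool" where
  "has_generator u g \<longleftrightarrow> L2 \<mu> g \<and> (\<forall>v\<in>test_fun E. form u v = - ip \<mu> g v)"

lemma test_fun_has_generator:
  assumes "u \<in> test_fun E"
  obtains g where "has_generator u g"
proof -
  define Q where "Q j D K B \<longleftrightarrow> D \<in> borel_measurable borel \<and> compact K \<and> K \<subseteq> E \<and>
    (\<forall>x. x \<notin> K \<longrightarrow> D x = 0) \<and> (\<forall>x. \<bar>D x\<bar> \<le> B) \<and>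
    (\<forall>v\<in>test_fun E. (LINT x|lborel. flux u j x * partial_deriv j v x) = - (LINT x|lborel. D x * v x))"
    for j D K B
  have "\<exists>D K B. Q j D K B" for j
    unfolding Q_def by (rule flux_divergence[OF assms, of j]) blast
  then obtain D K B where Q: "\<And>j. Q j (D j) (K j) (B j)"
    by metis
  have D: "\<And>j. D j \<in> borel_measurable borel" "\<And>j. compact (K j)" "\<And>j. K j \<subseteq> E"
    "\<And>j x. x \<notin> K j \<Longrightarrow> D j x = 0" "\<And>j x. \<bar>D j x\<bar> \<le> B j"
    "\<And>j v. v \<in> test_fun E \<Longrightarrow> (LINT x|lborel. flux u j x * partial_deriv j v x) = - (LINT x|lborel. D j x * v x)"
    using Q unfolding Q_def by blast+
  \<comment> \<open>This is L u in divergence form, div (p c grad u) / (2 p). The quotient by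
    \<open>p\<close> accounts for the reference measure, and 1/p is bounded on the compact
    support.\<close>
  define g where "g x = 1 / 2 * (\<Sum>j\<in>UNIV. D j x) / p x" for x
  define K' where "K' = (\<Union>j. K j)"
  have K': "compact K'" "K' \<subseteq> E" using D(2,3) by (auto simp: K'_def)
  have Dmu [measurable]: "D j \<in> borel_measurable \<mu>" for j using D(1) by (rule borel_imp_meas_\<mu>)
  have [measurable]: "p \<in> borel_measurable \<mu>" by (intro cont_imp_meas_\<mu> p_cont)
  have gm [measurable]: "g \<in> borel_measurable \<mu>" unfolding g_def[abs_def] by measurable
  have "continuous_on E (\<lambda>x. 1 / p x)"
    using p_pos by (intro continuous_intros p_cont) (metis less_irrefl)
  then obtain A where A: "A \<ge> 0" "\<And>x. x \<in> K' \<Longrightarrow> \<bar>1 / p x\<bar> \<le> A" using compact_bound[OF K'] by blast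
  have Bp: "B j \<ge> 0" for j using D(5)[of j 0] by linarith
  have "L2 \<mu> g"
  proof (rule compact_support_\<mu>[OF gm K'])
    fix x assume "x \<in> K'"
    have "\<bar>\<Sum>j\<in>UNIV. D j x\<bar> \<le> (\<Sum>j\<in>UNIV. B j)" by (intro order_trans[OF sum_abs] sum_mono D(5))
    then have "\<bar>\<Sum>j\<in>UNIV. D j x\<bar> * \<bar>1 / p x\<bar> \<le> (\<Sum>j\<in>UNIV. B j) * A"
      using A \<open>x \<in> K'\<close> Bp by (intro mult_mono sum_nonneg) auto
    moreover have "\<bar>g x\<bar> = 1 / 2 * (\<bar>\<Sum>j\<in>UNIV. D j x\<bar> * \<bar>1 / p x\<bar>)"
      by (simp add: g_def abs_mult)
    moreover have "0 \<le> \<bar>\<Sum>j\<in>UNIV. D j x\<bar> * \<bar>1 / p x\<bar>" by simp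
    ultimately show "\<bar>g x\<bar> \<le> (\<Sum>j\<in>UNIV. B j) * A" by linarith
  qed (auto simp: g_def K'_def D(4))
  moreover have "form u v = - ip \<mu> g v" if v: "v \<in> test_fun E" for v
  proof -
    have vm [measurable]: "v \<in> borel_measurable borel" "v \<in> borel_measurable \<mu>"
      using test_fun_smooth[OF v] by (auto intro!: borel_measurable_continuous_onI cont_imp_meas_\<mu> smooth_continuous)
    have int: "integrable lborel (\<lambda>x. D j x * v x)" for j
    proof -
      obtain Bv where Bv: "\<And>x. \<bar>v x\<bar> \<le> Bv" using test_fun_bounded[OF v] by blast
      show ?thesis
        by (rule integrable_compact_support[OF _ D(2)[of j], of _ "B j * Bv"])
           (auto simp: D(4) abs_mult intro!: mult_mono D(1,5) Bv Bp borel_measurable_times vm)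
    qed
    have "ip \<mu> g v = (LINT x:E|lborel. p x * (g x * v x))"
      unfolding ip_def by (rule integral_\<mu>) measurable
    also have "\<dots> = (LINT x|lborel. 1 / 2 * (\<Sum>j\<in>UNIV. D j x * v x))"
      unfolding set_lebesgue_integral_def
    proof (rule Bochner_Integration.integral_cong[OF refl])
      fix x show "indicator E x *\<^sub>R (p x * (g x * v x)) = 1 / 2 * (\<Sum>j\<in>UNIV. D j x * v x)"
      proof (cases "x \<in> E")
        case True
        then show ?thesis using p_pos[of x] by (simp add: g_def sum_distrib_right)
      next
        case False
        then have "D j x = 0" for j using D(3,4) by blast
        with False show ?thesis by simp
      qed
    qed
    also have "\<dots> = 1 / 2 * (\<Sum>j\<in>UNIV. (LINT x|lborel. D j x * v x))"
      using int by simp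
    finally show ?thesis
      using assms v by (simp add: form_eq D(6) sum_negf)
  qed
  ultimately show thesis by (intro that) (auto simp: has_generator_def)
qed

text \<open>For fixed n the mixed term form (W_n, W_m) = -<g_n, W_m> tends to 0 as m grows, because
  W_n lies in the generator domain. Since form (W_n, W_n) is at most form (W_m - W_n) + 2 form (W_n,
  W_m), the Cauchy property controls it.\<close>

lemma closable:
  assumes W: "\<And>n. W n \<in> test_fun E"
    and Cauchy: "\<And>e. e > 0 \<Longrightarrow> \<exists>N. \<forall>m\<ge>N. \<forall>n\<ge>N. form (\<lambda>x. W m x - W n x) (\<lambda>x. W m x - W n x) < e"
    and lim: "(\<lambda>n. nsq \<mu> (W n)) \<longlonglongrightarrow> 0"
  shows "(\<lambda>n. form (W n) (W n)) \<longlonglongrightarrow> 0"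
proof (rule LIMSEQ_I)
  fix e :: real assume e: "e > 0"
  obtain N where N: "\<And>m n. m \<ge> N \<Longrightarrow> n \<ge> N \<Longrightarrow> form (\<lambda>x. W m x - W n x) (\<lambda>x. W m x - W n x) < e / 2"
    using Cauchy[of "e / 2"] e by auto
  have "form (W n) (W n) \<le> e / 2" if n: "n \<ge> N" for n
  proof -
    obtain g where g: "has_generator (W n) g" using test_fun_has_generator[OF W] by blast
    have "(\<lambda>m. nsq \<mu> (\<lambda>x. W m x - 0)) \<longlonglongrightarrow> 0" using lim by simp
    then have "(\<lambda>m. ip \<mu> (W m) g) \<longlonglongrightarrow> ip \<mu> (\<lambda>_. 0) g"
      using g W by (intro ip_tendsto) (auto simp: has_generator_def test_fun_L2 L2_def[of _ "\<lambda>_. 0"])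
    then have "(\<lambda>m. e / 2 + 2 * form (W n) (W m)) \<longlonglongrightarrow> e / 2 + 2 * (- ip \<mu> (\<lambda>_. 0) g)"
      using g W by (auto simp: has_generator_def ip_commute[of \<mu> g] intro!: tendsto_intros)
    then have "(\<lambda>m. e / 2 + 2 * form (W n) (W m)) \<longlonglongrightarrow> e / 2" by (simp add: ip_def)
    moreover have "form (W n) (W n) \<le> e / 2 + 2 * form (W n) (W m)" if "m \<ge> N" for m
    proof -
      have "form (\<lambda>x. W m x - W n x) (\<lambda>x. W m x - W n x) = form (W m) (W m) - 2 * form (W n) (W m) + form (W n) (W n)"
        using W by (simp add: form_diff_left form_diff_right test_fun_diff form_sym[of "W m" "W n"])
      with N[OF that n] form_nonneg[of "W m"] show ?thesis by linarith
    qed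
    ultimately show ?thesis by (intro LIMSEQ_le_const) auto
  qed
  then show "\<exists>N. \<forall>n\<ge>N. norm (form (W n) (W n) - 0) < e"
    using e form_nonneg by (intro exI[of _ N]) (force simp: abs_of_nonneg)
qed

text \<open>\<open>closed_form\<close> is a definite description, so one common limit is needed for
  all approximating pairs. U_n - u approximates 0, closability makes form (U_n - u, V_n) vanish, and
  what remains is -<g, V_n>, which converges. The constant sequence \<open>u\<close> shows that the
  description is not vacuous.\<close>

lemma form_generator_test_fun:
  assumes u: "u \<in> test_fun E" and g: "has_generator u g"
  shows "form_generator E c p u g"
proof -
  have Lg: "L2 \<mu> g" using g by (simp add: has_generator_def)
  have "form (\<lambda>x. 0) (\<lambda>x. 0) = 0"
    using form_diff_right[OF test_fun_diff[OF u u] u u] by simp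
  then have app_u: "approximating E c p (\<lambda>_. u) u"
    using u by (auto simp: approximating_def L2_dist_sq_def form_diff_left test_fun_diff)
  have "closed_form E c p u v = - (LINT x|\<mu>. g x * v x)" if v: "v \<in> form_domain E c p" for v
  proof -
    have Lv: "L2 \<mu> v" using v by (auto simp: form_domain_def Lr_fun_2_iff)
    obtain V0 where V0: "approximating E c p V0 v" using v by (auto simp: form_domain_def)
    have lim: "(\<lambda>n. form (U n) (V n)) \<longlonglongrightarrow> - ip \<mu> g v"
      if U: "approximating E c p U u" and V: "approximating E c p V v" for U V
    proof -
      have Ut: "\<And>n. U n \<in> test_fun E" and Vt: "\<And>n. V n \<in> test_fun E"
        using U V by (auto simp: approximating_def)
      define W where "W n x = U n x - u x" for n x
      have Wt: "W n \<in> test_fun E" for n unfolding W_def[abs_def] by (intro test_fun_diff Ut u)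
      have "(\<lambda>n. form (W n) (W n)) \<longlonglongrightarrow> 0"
      proof (rule closable[OF Wt])
        show "\<exists>N. \<forall>m\<ge>N. \<forall>n\<ge>N. form (\<lambda>x. W m x - W n x) (\<lambda>x. W m x - W n x) < e" if "e > 0" for e
          using U that by (auto simp: approximating_def W_def)
        show "(\<lambda>n. nsq \<mu> (W n)) \<longlonglongrightarrow> 0"
          using U by (auto simp: approximating_def L2_dist_sq_eq W_def[abs_def])
      qed
      moreover obtain B where B: "\<And>n. form (V n) (V n) \<le> B"
      proof -
        obtain N where N: "\<And>n. n \<ge> N \<Longrightarrow> form (\<lambda>x. V N x - V n x) (\<lambda>x. V N x - V n x) < 1"
          using V unfolding approximating_def by (metis le_refl zero_less_one)
        have "form (V n) (V n) \<le> 2 * form (V N) (V N) + 2" if "n \<ge> N" for n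
        proof -
          have eq: "form (\<lambda>x. V N x - V n x) (\<lambda>x. V N x - V n x) = form (V N) (V N) - 2 * form (V N) (V n) + form (V n) (V n)"
            using Vt by (simp add: form_diff_left form_diff_right test_fun_diff form_sym[of "V n" "V N"])
          \<comment> \<open>Together with form (V_N - V_n) < 1 this bounds form (V_n) by 2 form
            (V_N) + 2; the finitely many earlier terms are covered by their sum.\<close>
          have "0 \<le> form (\<lambda>x. V n x - 2 * V N x) (\<lambda>x. V n x - 2 * V N x)" by (rule form_nonneg)
          also have "\<dots> = form (V n) (V n) - 4 * form (V N) (V n) + 4 * form (V N) (V N)"
            using Vt by (simp add: form_diff_left form_diff_right test_fun_diff test_fun_cmult form_cmult_right
                form_cmult_left form_sym[of "V n" "V N"])
          finally show ?thesis using N[OF that] eq by linarith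
        qed
        then have "form (V n) (V n) \<le> 2 * form (V N) (V N) + 2 + (\<Sum>k<N. form (V k) (V k))" for n
          using member_le_sum[of n "{..<N}" "\<lambda>k. form (V k) (V k)"] form_nonneg sum_nonneg[of "{..<N}" "\<lambda>k. form (V k) (V k)"]
          by (cases "n \<ge> N") (force, smt (verit) form_nonneg finite_lessThan lessThan_iff not_le)
        then show thesis by (rule that)
      qed
      ultimately have l0: "(\<lambda>n. sqrt (form (W n) (W n)) * sqrt B) \<longlonglongrightarrow> 0"
        using tendsto_mult[OF tendsto_real_sqrt tendsto_const, of _ 0] by fastforce
      have "(\<lambda>n. form (W n) (V n)) \<longlonglongrightarrow> 0"
      proof (rule Lim_null_comparison[OF always_eventually l0], intro allI)
        fix n
        have "sqrt (form (W n) (W n)) * sqrt (form (V n) (V n)) \<le> sqrt (form (W n) (W n)) * sqrt B"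
          using B[of n] by (intro mult_left_mono) (auto simp: form_nonneg)
        then show "norm (form (W n) (V n)) \<le> sqrt (form (W n) (W n)) * sqrt B"
          using form_Cauchy_Schwarz[OF Wt Vt, of n n] by simp
      qed
      moreover have "(\<lambda>n. - ip \<mu> (V n) g) \<longlonglongrightarrow> - ip \<mu> v g"
        using V Vt Lv Lg
        by (intro tendsto_minus ip_tendsto) (auto simp: approximating_def L2_dist_sq_eq test_fun_L2)
      ultimately have "(\<lambda>n. form (W n) (V n) + - ip \<mu> (V n) g) \<longlonglongrightarrow> 0 + - ip \<mu> v g"
        by (intro tendsto_add)
      moreover have "form (W n) (V n) + - ip \<mu> (V n) g = form (U n) (V n)" for n
        using g Ut Vt u by (auto simp: W_def[abs_def] form_diff_left has_generator_def ip_commute[of \<mu> g])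
      ultimately show ?thesis by (simp add: ip_commute)
    qed
    have "closed_form E c p u v = - ip \<mu> g v"
      unfolding closed_form_def
    proof (rule the_equality)
      show "\<forall>U V. approximating E c p U u \<and> approximating E c p V v \<longrightarrow> (\<lambda>n. form (U n) (V n)) \<longlonglongrightarrow> - ip \<mu> g v"
        using lim by blast
      fix e assume "\<forall>U V. approximating E c p U u \<and> approximating E c p V v \<longrightarrow> (\<lambda>n. form (U n) (V n)) \<longlonglongrightarrow> e"
      then show "e = - ip \<mu> g v"
        using lim[OF app_u V0] app_u V0 LIMSEQ_unique by blast
    qed
    then show ?thesis by (simp add: ip_def)
  qed
  then show ?thesis
    using app_u test_fun_L2[OF u] Lg by (auto simp: form_generator_def form_domain_def Lr_fun_2_iff)
qed

text \<open>Exchanging the arguments yields the same predicate under the definite description, so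
  the equality holds even where no limit exists.\<close>

lemma closed_form_sym: "closed_form E c p u v = closed_form E c p v u"
proof -
  have eq: "(\<lambda>n. form (U n) (V n)) = (\<lambda>n. form (V n) (U n))" for U V :: "nat \<Rightarrow> real^'d \<Rightarrow> real"
    by (rule ext) (rule form_sym)
  show ?thesis
    unfolding closed_form_def
    by (intro arg_cong[where f=The] ext iffI allI impI; subst eq; blast)
qed

lemma form_generator_sym:
  assumes "form_generator E c p u g" "form_generator E c p v h"
  shows "ip \<mu> g v = ip \<mu> h u"
  using assms closed_form_sym[of u v] by (auto simp: form_generator_def ip_def)

end

subsection \<open>Sets of codimension two have capacity zero\<close>

text \<open>The translates of \<open>S\<close> by \<open>4 * 2\<^sup>-\<^sup>m (p e\<^sub>i + q e\<^sub>k)\<close> with \<open>p, q < 2\<^sup>m\<close> are disjoint and stay in a fixed box.\<close>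

lemma emeasure_tube_le:
  fixes a b :: "real^'d::finite" and i j k :: 'd
  assumes "i \<noteq> j" "j \<noteq> k" "i \<noteq> k"
  shows "4 ^ m * measure lborel {x\<in>cbox a b. \<bar>x $ i - x $ j\<bar> \<le> (1/2) ^ m \<and> \<bar>x $ j - x $ k\<bar> \<le> (1/2) ^ m}
    \<le> measure lborel (cbox a (b + (\<chi> _. 4)))"
proof -
  define S where "S = {x\<in>cbox a b. \<bar>x $ i - x $ j\<bar> \<le> (1/2) ^ m \<and> \<bar>x $ j - x $ k\<bar> \<le> (1/2) ^ m}"
  define Q where "Q = cbox a (b + (\<chi> _. 4))"
  define I where "I = {..<(2::nat) ^ m} \<times> {..<(2::nat) ^ m}"
  \<comment> \<open>Coordinates i and k move while j stays, so the two differences are shifted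
    independently. On \<open>S\<close> each of them ranges over an interval of length twice 2^(-m),
    which the spacing, four times 2^(-m), exceeds; with fewer than 2^m steps all shifts stay below
    4.\<close>
  define s where "s z = (4 * (1/2) ^ m) *\<^sub>R (real (fst z) *\<^sub>R axis i 1 + real (snd z) *\<^sub>R axis k (1::real))" for z :: "nat \<times> nat"
  define T where "T z = {x. x - s z \<in> S}" for z
  have "closed S"
    unfolding S_def by (intro closed_Collect_conj closed_Collect_le continuous_intros) auto
  then have S: "S \<in> sets borel" by simp
  have T: "T z \<in> sets borel" "emeasure lborel (T z) = emeasure lborel S" for z
  proof -
    have "emeasure lborel S = emeasure (distr lborel borel ((+) (- s z))) S"
      by (simp add: lborel_distr_plus)
    also have "\<dots> = emeasure lborel (((+) (- s z)) -` S \<inter> space lborel)"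
      using S by (intro emeasure_distr) auto
    also have "((+) (- s z)) -` S \<inter> space lborel = T z" by (auto simp: T_def)
    finally show "emeasure lborel (T z) = emeasure lborel S" by simp
    have "(\<lambda>x. x - s z) -` S \<inter> space borel \<in> sets borel"
      using S by (intro measurable_sets[of _ borel borel]) auto
    then show "T z \<in> sets borel" by (simp add: T_def vimage_def)
  qed
  have si: "s z $ i = 4 * (1/2) ^ m * real (fst z)" "s z $ k = 4 * (1/2) ^ m * real (snd z)" "s z $ j = 0" for z
    using assms by (auto simp: s_def axis_def)
  have eq_of_close: "p = q" if "\<bar>4 * (1/2) ^ m * real p - 4 * (1/2) ^ m * real q\<bar> \<le> 2 * (1/2) ^ m" for p q
  proof -
    have "4 * (1/2) ^ m * \<bar>real p - real q\<bar> \<le> 2 * (1/2::real) ^ m"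
      using that by (simp flip: right_diff_distrib add: abs_mult)
    then have "\<bar>real p - real q\<bar> < 1" by (simp add: field_simps)
    then show ?thesis by linarith
  qed
  have "disjoint_family_on T I"
    unfolding disjoint_family_on_def
  proof (intro ballI impI, rule ccontr)
    fix z z' assume "z \<noteq> z'" "T z \<inter> T z' \<noteq> {}"
    then obtain x where x: "x - s z \<in> S" "x - s z' \<in> S" by (auto simp: T_def)
    have "fst z = fst z'"
      using x by (intro eq_of_close) (auto simp: S_def si)
    moreover have "snd z = snd z'"
      using x by (intro eq_of_close) (auto simp: S_def si)
    ultimately show False using \<open>z \<noteq> z'\<close> by (simp add: prod_eq_iff)
  qed
  then have "(\<Sum>z\<in>I. emeasure lborel (T z)) = emeasure lborel (\<Union>z\<in>I. T z)"
    using T(1) by (intro sum_emeasure) (auto simp: I_def)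
  also have "\<dots> \<le> emeasure lborel Q"
  proof (rule emeasure_mono)
    show "(\<Union>z\<in>I. T z) \<subseteq> Q"
    proof
      fix x assume "x \<in> (\<Union>z\<in>I. T z)"
      then obtain z where z: "z \<in> I" "x - s z \<in> S" by (auto simp: T_def)
      have "0 \<le> s z $ l \<and> s z $ l \<le> 4" for l
      proof -
        have "real (fst z) < 2 ^ m" "real (snd z) < 2 ^ m" using z(1) by (auto simp: I_def)
        then have "4 * (1/2) ^ m * real (fst z) \<le> 4" "4 * (1/2) ^ m * real (snd z) \<le> 4"
          by (auto simp: field_simps)
        moreover have "s z $ l = (if l = i then 4 * (1/2) ^ m * real (fst z) else if l = k then 4 * (1/2) ^ m * real (snd z) else 0)"
          using assms by (auto simp: s_def axis_def)
        ultimately show ?thesis by auto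
      qed
      then show "x \<in> Q"
        using z(2) by (auto simp: Q_def S_def mem_box_cart) (smt (verit))+
    qed
  qed (simp add: Q_def)
  finally have "of_nat (card I) * emeasure lborel S \<le> emeasure lborel Q"
    using T by simp
  moreover have fin: "emeasure lborel S < \<infinity>" "emeasure lborel Q < \<infinity>"
  proof -
    show "emeasure lborel Q < \<infinity>" unfolding Q_def by (intro emeasure_compact_finite) simp
    have "emeasure lborel S \<le> emeasure lborel (cbox a b)" by (intro emeasure_mono) (auto simp: S_def)
    also have "\<dots> < \<infinity>" by (intro emeasure_compact_finite) simp
    finally show "emeasure lborel S < \<infinity>" .
  qed
  moreover have "real (card I) = 4 ^ m"
    by (simp add: I_def card_cartesian_product flip: power_mult_distrib)
  ultimately have "ennreal (4 ^ m * measure lborel S) \<le> ennreal (measure lborel Q)"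
    by (simp add: emeasure_eq_ennreal_measure ennreal_mult less_top ennreal_of_nat_eq_real_of_nat)
  then show ?thesis by (simp add: S_def Q_def)
qed

text \<open>Let m be the last scale with y \<le> 4^(-m). Then y > 4^(-m-1), so the single term of
  index m already dominates 1/y. The shift by 4^(-n) caps the left side at 4^n, and the leading 1
  covers y > 1.\<close>

lemma dyadic_bound:
  fixes y :: real
  assumes "y \<ge> 0"
  shows "1 / (y + (1/4) ^ n) \<le> 1 + (\<Sum>m\<le>n. 4 ^ Suc m * of_bool (y \<le> (1/4) ^ m))"
proof (cases "y > (1/4) ^ n")
  case True
  have "y > (1/4) ^ n \<Longrightarrow> 1 / y \<le> 1 + (\<Sum>m<n. 4 ^ Suc m * of_bool (y \<le> (1/4) ^ m))"
  proof (induction n)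
    case (Suc n)
    show ?case
    proof (cases "y > (1/4) ^ n")
      case False
      have "y > 0" using Suc.prems by (smt (verit) zero_less_power zero_less_divide_iff)
      then have "1 / y \<le> 4 ^ Suc n" using Suc.prems by (simp add: field_simps power_divide)
      with False show ?thesis
        by (simp add: sum_nonneg add_increasing)
    qed (use Suc.IH in simp)
  qed simp
  then have "1 / y \<le> 1 + (\<Sum>m<n. 4 ^ Suc m * of_bool (y \<le> (1/4) ^ m))" using True by blast
  moreover have "1 / (y + (1/4) ^ n) \<le> 1 / y"
  proof (intro divide_left_mono)
    have "0 < (1/4::real) ^ n" by simp
    then have "y > 0" using True by linarith
    then show "0 < (y + (1/4) ^ n) * y" by (intro mult_pos_pos add_pos_pos) auto
  qed auto
  ultimately show ?thesis using True by (simp add: lessThan_Suc_atMost[symmetric])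
next
  case False
  have "1 / (y + (1/4) ^ n) \<le> 1 / (1/4) ^ n"
    using assms by (intro divide_left_mono) (auto intro!: mult_pos_pos add_nonneg_pos)
  also have "\<dots> \<le> 4 ^ Suc n * of_bool (y \<le> (1/4) ^ n)"
    using False by (simp add: power_divide)
  also have "\<dots> \<le> (\<Sum>m\<le>n. 4 ^ Suc m * of_bool (y \<le> (1/4) ^ m))"
    by (intro member_le_sum[of n "{..n}" "\<lambda>m. 4 ^ Suc m * of_bool (y \<le> (1/4) ^ m)"]) auto
  finally show ?thesis by simp
qed

text \<open>For distinct indices its zero set is the codimension two subspace x_i = x_j = x_k, and
  it is comparable to the squared distance from that subspace.\<close>

definition gap :: "'d \<Rightarrow> 'd \<Rightarrow> 'd \<Rightarrow> real^'d::finite \<Rightarrow> real" where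
  "gap i j k x = (x $ i - x $ j)\<^sup>2 + (x $ j - x $ k)\<^sup>2"

lemma gap_nonneg: "gap i j k x \<ge> 0" by (simp add: gap_def)

lemma smooth_gap [intro]: "smooth (gap i j k)"
  unfolding gap_def[abs_def] by (intro smooth_add smooth_power smooth_minus smooth_nth)

text \<open>Codimension two makes the integral of 1/gap diverge only logarithmically: the part of
  the box where gap \<le> 4^(-m) has volume of order 4^(-m), so each of the n + 1 scales contributes
  a bounded amount.\<close>

lemma gap_integral_bound:
  fixes a b :: "real^'d::finite"
  assumes "i \<noteq> j" "j \<noteq> k" "i \<noteq> k"
  obtains V where "V \<ge> 0" "\<And>n. (LINT x:cbox a b|lborel. 1 / (gap i j k x + (1/4) ^ n)) \<le> V * real (n + 1)"
    "\<And>n. set_integrable lborel (cbox a b) (\<lambda>x. 1 / (gap i j k x + (1/4) ^ n))"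
proof -
  define S where "S m = {x\<in>cbox a b. gap i j k x \<le> (1/4) ^ m}" for m
  define V where "V = measure lborel (cbox a (b + (\<chi> _. 4)))"
  have "closed (S m)" for m
    unfolding S_def by (intro closed_Collect_conj closed_Collect_le smooth_continuous smooth_gap continuous_intros) auto
  then have Sm: "S m \<in> sets lborel" for m by simp
  have fin: "emeasure lborel A < \<infinity>" if "A \<subseteq> cbox a b" for A :: "(real^'d) set"
  proof -
    have "emeasure lborel A \<le> emeasure lborel (cbox a b)" using that by (intro emeasure_mono) auto
    also have "\<dots> < \<infinity>" by (intro emeasure_compact_finite) simp
    finally show ?thesis .
  qed
  have finS: "emeasure lborel (S m) < \<infinity>" for m
    by (rule fin) (auto simp: S_def)
  have SV: "4 ^ m * measure lborel (S m) \<le> V" for m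
  proof -
    have sub: "S m \<subseteq> {x\<in>cbox a b. \<bar>x $ i - x $ j\<bar> \<le> (1/2) ^ m \<and> \<bar>x $ j - x $ k\<bar> \<le> (1/2) ^ m}"
    proof -
      have "\<bar>t\<bar> \<le> (1/2) ^ m" if "t\<^sup>2 \<le> (1/4::real) ^ m" for t
      proof -
        have "(1/4::real) ^ m = ((1/2) ^ m)\<^sup>2" by (simp add: power2_eq_square flip: power_mult_distrib)
        then have "\<bar>t\<bar>\<^sup>2 \<le> ((1/2) ^ m)\<^sup>2" using that by simp
        then show ?thesis by (rule power2_le_imp_le) simp
      qed
      moreover have "t\<^sup>2 \<le> (1/4) ^ m" "r\<^sup>2 \<le> (1/4) ^ m" if "t\<^sup>2 + r\<^sup>2 \<le> (1/4::real) ^ m" for t r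
        using that zero_le_power2[of t] zero_le_power2[of r] by linarith+
      ultimately show ?thesis by (auto simp: S_def gap_def)
    qed
    have "closed {x\<in>cbox a b. \<bar>x $ i - x $ j\<bar> \<le> (1/2) ^ m \<and> \<bar>x $ j - x $ k\<bar> \<le> (1/2) ^ m}"
      by (intro closed_Collect_conj closed_Collect_le continuous_intros) auto
    then have "measure lborel (S m) \<le> measure lborel {x\<in>cbox a b. \<bar>x $ i - x $ j\<bar> \<le> (1/2) ^ m \<and> \<bar>x $ j - x $ k\<bar> \<le> (1/2) ^ m}"
      using sub Sm fin[of "{x\<in>cbox a b. \<bar>x $ i - x $ j\<bar> \<le> (1/2) ^ m \<and> \<bar>x $ j - x $ k\<bar> \<le> (1/2) ^ m}"]
      by (intro measure_mono_fmeasurable) (auto simp: fmeasurable_def)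
    then have "4 ^ m * measure lborel (S m) \<le> 4 ^ m * measure lborel {x\<in>cbox a b. \<bar>x $ i - x $ j\<bar> \<le> (1/2) ^ m \<and> \<bar>x $ j - x $ k\<bar> \<le> (1/2) ^ m}"
      by (intro mult_left_mono) auto
    also have "\<dots> \<le> V" unfolding V_def by (rule emeasure_tube_le[OF assms])
    finally show ?thesis .
  qed
  have QV: "measure lborel (cbox a b) \<le> V"
    unfolding V_def
    using emeasure_compact_finite[of "cbox a (b + (\<chi> _. 4))"]
    by (intro measure_mono_fmeasurable) (auto simp: fmeasurable_def mem_box_cart intro!: add_increasing2)
  have Vp: "V \<ge> 0" by (simp add: V_def)
  define f where "f n x = (indicator (cbox a b) x :: real) + (\<Sum>m\<le>n. 4 ^ Suc m * indicator (S m) x)" for n and x :: "real^'d"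
  have intf: "integrable lborel (f n)" for n
    unfolding f_def using Sm finS fin[of "cbox a b"]
    by (intro Bochner_Integration.integrable_add Bochner_Integration.integrable_sum integrable_mult_right integrable_real_indicator)
       auto
  have le: "indicator (cbox a b) x *\<^sub>R (1 / (gap i j k x + (1/4) ^ n)) \<le> f n x" for n x
  proof (cases "x \<in> cbox a b")
    case True
    then have "indicator (S m) x = (of_bool (gap i j k x \<le> (1/4) ^ m) :: real)" for m
      by (simp add: S_def indicator_def)
    with True dyadic_bound[OF gap_nonneg[of i j k x], of n] show ?thesis by (simp add: f_def)
  qed (auto simp: f_def intro!: sum_nonneg)
  have int: "set_integrable lborel (cbox a b) (\<lambda>x. 1 / (gap i j k x + (1/4) ^ n))" for n
    unfolding set_integrable_def
  proof (rule Bochner_Integration.integrable_bound[OF intf[of n]])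
    have "gap i j k x + (1/4) ^ n \<noteq> 0" for x
      using gap_nonneg[of i j k x] zero_less_power[of "1/4::real" n] by linarith
    then have "continuous_on UNIV (\<lambda>x. 1 / (gap i j k x + (1/4) ^ n))"
      by (intro continuous_intros smooth_continuous smooth_gap) auto
    then have "(\<lambda>x. 1 / (gap i j k x + (1/4) ^ n)) \<in> borel_measurable borel"
      by (rule borel_measurable_continuous_onI)
    then show "(\<lambda>x. indicator (cbox a b) x *\<^sub>R (1 / (gap i j k x + (1/4) ^ n))) \<in> borel_measurable lborel"
      by (intro borel_measurable_scaleR borel_measurable_indicator) simp_all
    show "AE x in lborel. norm (indicator (cbox a b) x *\<^sub>R (1 / (gap i j k x + (1/4) ^ n))) \<le> norm (f n x)"
    proof (rule AE_I2)
      fix x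
      have "0 \<le> indicator (cbox a b) x *\<^sub>R (1 / (gap i j k x + (1/4) ^ n))"
        using gap_nonneg[of i j k x] by (auto simp: indicator_def)
      with le[of x n] show "norm (indicator (cbox a b) x *\<^sub>R (1 / (gap i j k x + (1/4) ^ n))) \<le> norm (f n x)"
        unfolding real_norm_def by linarith
    qed
  qed
  \<comment> \<open>Each scale costs 4 V, from the weight 4^(m+1) against a volume of at most V
    4^(-m); the constant term of \<open>dyadic_bound\<close> costs one more V.\<close>
  have "(LINT x:cbox a b|lborel. 1 / (gap i j k x + (1/4) ^ n)) \<le> 5 * V * real (n + 1)" for n
  proof -
    have "(LINT x:cbox a b|lborel. 1 / (gap i j k x + (1/4) ^ n)) \<le> (LINT x|lborel. f n x)"
      unfolding set_lebesgue_integral_def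
      using int[of n] le by (intro integral_mono intf) (auto simp: set_integrable_def)
    also have "\<dots> = measure lborel (cbox a b) + (\<Sum>m\<le>n. 4 ^ Suc m * measure lborel (S m))"
    proof -
      have i1: "integrable lborel (\<lambda>x. indicator (cbox a b) x :: real)"
        using fin[of "cbox a b"] by (intro integrable_real_indicator) auto
      have i2: "integrable lborel (\<lambda>x. 4 ^ Suc m * indicator (S m) x :: real)" for m
        using Sm finS by (intro integrable_mult_right integrable_real_indicator)
      have "(LINT x|lborel. f n x) = (LINT x|lborel. indicator (cbox a b) x) +
          (LINT x|lborel. (\<Sum>m\<le>n. 4 ^ Suc m * indicator (S m) x))"
        unfolding f_def by (intro Bochner_Integration.integral_add Bochner_Integration.integrable_sum i1 i2)
      also have "(LINT x|lborel. (\<Sum>m\<le>n. 4 ^ Suc m * indicator (S m) x :: real)) =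
          (\<Sum>m\<le>n. (LINT x|lborel. 4 ^ Suc m * indicator (S m) x))"
        by (intro Bochner_Integration.integral_sum i2)
      finally show ?thesis
        using Sm by (simp only: integral_mult_right_zero Bochner_Integration.integral_indicator) simp
    qed
    also have "\<dots> \<le> V + (\<Sum>m\<le>n. 4 * V)"
      using QV SV by (intro add_mono sum_mono) (auto simp: mult.assoc)
    also have "\<dots> \<le> 5 * V * real (n + 1)" using Vp by (simp add: algebra_simps)
    finally show ?thesis .
  qed
  then show thesis using Vp int by (intro that[of "5 * V"]) auto
qed

text \<open>The logarithmic potential \<open>ln (1 + 1 / gap)\<close>, truncated by shifting the gap by \<open>4\<^sup>-\<^sup>n\<close> and then normalised.\<close>

definition log_potential :: "'d \<Rightarrow> 'd \<Rightarrow> 'd \<Rightarrow> nat \<Rightarrow> real^'d::finite \<Rightarrow> real" where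
  "log_potential i j k n x =
     1 / (real n * ln 4) * (ln (gap i j k x + ((1/4) ^ n + 1)) - ln (gap i j k x + (1/4) ^ n))"

lemma smooth_log_potential: "smooth (log_potential i j k n)"
  unfolding log_potential_def[abs_def]
  by (intro smooth_mult smooth_const smooth_minus smooth_ln smooth_add smooth_gap)
     (auto intro!: add_nonneg_pos gap_nonneg)

lemma log_potential_nonneg: "log_potential i j k n x \<ge> 0"
proof -
  have "gap i j k x + (1/4) ^ n > 0" by (intro add_nonneg_pos gap_nonneg) auto
  then have "ln (gap i j k x + (1/4) ^ n) \<le> ln (gap i j k x + ((1/4) ^ n + 1))"
    by (subst ln_le_cancel_iff) auto
  then show ?thesis by (simp add: log_potential_def)
qed

text \<open>n ln 4 = -ln (4^(-n)) is the height at which the shift truncates the logarithmic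
  singularity, hence the normalisation.\<close>

lemma log_potential_ge_1: "n > 0 \<Longrightarrow> gap i j k x = 0 \<Longrightarrow> log_potential i j k n x \<ge> 1"
proof -
  assume n: "n > 0" and 0: "gap i j k x = 0"
  have "ln ((1/4::real) ^ n) = - (real n * ln 4)"
    by (simp add: ln_realpow ln_div)
  moreover have "ln ((1/4::real) ^ n + 1) \<ge> 0" by simp
  ultimately have "real n * ln 4 \<le> ln ((1/4::real) ^ n + 1) - ln ((1/4) ^ n)" by linarith
  then have "1 / (real n * ln 4) * (real n * ln 4) \<le> 1 / (real n * ln 4) * (ln ((1/4::real) ^ n + 1) - ln ((1/4) ^ n))"
    by (intro mult_left_mono) auto
  then show ?thesis using n by (simp add: log_potential_def 0)
qed

lemma one_le_ln_4: "1 \<le> ln (4::real)"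
proof -
  have "exp 1 \<le> (4::real)" using exp_le by linarith
  then have "ln (exp 1) \<le> ln (4::real)" by (subst ln_le_cancel_iff) auto
  then show ?thesis by simp
qed

text \<open>With y the shifted gap and z = y^(-1/2), ln (1 + z^2) \<le> 2 ln (1 + z) \<le> 2 z. The
  bound is crude but has the same shape as the one for the gradient, so a single integral controls
  both.\<close>

lemma log_potential_le:
  "log_potential i j k n x \<le> 2 * sqrt (1 / (gap i j k x + (1/4) ^ n)) / real n"
proof -
  define y where "y = gap i j k x + (1/4) ^ n"
  have y: "y > 0" unfolding y_def by (intro add_nonneg_pos gap_nonneg) auto
  define z where "z = sqrt (1 / y)"
  have z: "z > 0" "z\<^sup>2 = 1 / y" using y by (auto simp: z_def)
  have "ln (y + 1) - ln y = ln (1 + z\<^sup>2)"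
  proof -
    have "ln (y + 1) - ln y = ln ((y + 1) / y)" using y by (simp add: ln_div)
    also have "(y + 1) / y = 1 + z\<^sup>2" using y by (simp add: z field_simps)
    finally show ?thesis .
  qed
  also have "\<dots> \<le> ln ((1 + z)\<^sup>2)"
    using z(1) by (subst ln_le_cancel_iff) (auto simp: power2_sum intro!: add_pos_nonneg)
  also have "\<dots> = 2 * ln (1 + z)" using z(1) by (simp add: ln_realpow)
  also have "\<dots> \<le> 2 * z" using ln_add_one_self_le_self[of z] z(1) by simp
  finally have le: "ln (y + 1) - ln y \<le> 2 * z" .
  have "log_potential i j k n x = (ln (y + 1) - ln y) / (real n * ln 4)"
    by (simp add: log_potential_def y_def add.assoc)
  also have "\<dots> \<le> 2 * z / (real n * ln 4)" using le by (intro divide_right_mono) auto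
  also have "\<dots> \<le> 2 * z / real n"
  proof (cases "n = 0")
    case False
    then have "real n * 1 \<le> real n * ln 4" using one_le_ln_4 by (intro mult_left_mono) auto
    then show ?thesis using z False one_le_ln_4 by (intro divide_left_mono) (auto intro!: mult_pos_pos)
  qed simp
  finally show ?thesis by (simp add: z_def y_def)
qed

text \<open>The gradient of the gap is of order gap^(1/2); divided by the shifted gap y it is of
  order y^(-1/2). The constant 3 comes from 8 gap \<le> 9 y, and ln 4 \<ge> 1 lets the logarithm in
  the normalisation be dropped.\<close>

lemma log_potential_deriv_le:
  "\<bar>partial_deriv l (log_potential i j k n) x\<bar> \<le> 3 * sqrt (1 / (gap i j k x + (1/4) ^ n)) / real n"
proof -
  define y where "y = gap i j k x + (1/4) ^ n"
  have y: "y > 0" unfolding y_def by (intro add_nonneg_pos gap_nonneg) auto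
  define \<alpha> where "\<alpha> = x $ i - x $ j"
  define \<beta> where "\<beta> = x $ j - x $ k"
  define R where "R h = 2 * \<alpha> * (h $ i - h $ j) + 2 * \<beta> * (h $ j - h $ k)" for h :: "real^'a"
  have nth: "((\<lambda>x. x $ i) has_derivative (\<lambda>h. h $ i)) (at x)" for i
    by (rule bounded_linear_imp_has_derivative) (rule bounded_linear_vec_nth)
  have gap: "(gap i j k has_derivative R) (at x)"
    unfolding gap_def[abs_def] R_def \<alpha>_def \<beta>_def
    by (rule derivative_eq_intros nth refl)+ (simp add: algebra_simps)
  have dln: "((\<lambda>x. ln (gap i j k x + t)) has_derivative (\<lambda>h. 1 / (gap i j k x + t) * R h)) (at x)" if "t > 0" for t
    by (rule has_derivative_compose[of "\<lambda>x. gap i j k x + t" R x UNIV ln "(*) (1 / (gap i j k x + t))"])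
       (use gap_nonneg[of i j k x] that gap DERIV_ln_divide[of "gap i j k x + t"] in
         \<open>auto simp: has_field_derivative_def intro!: derivative_eq_intros\<close>)
  have "(log_potential i j k n has_derivative
      (\<lambda>h. 1 / (real n * ln 4) * (1 / (gap i j k x + ((1/4) ^ n + 1)) * R h - 1 / (gap i j k x + (1/4) ^ n) * R h))) (at x)"
    unfolding log_potential_def[abs_def]
    by (intro has_derivative_mult_right has_derivative_diff dln) (auto intro: add_pos_pos)
  then have "partial_deriv l (log_potential i j k n) x =
      1 / (real n * ln 4) * (1 / (y + 1) * R (axis l 1) - 1 / y * R (axis l 1))"
    by (subst partial_deriv_eq) (auto simp: y_def add.assoc)
  also have "\<dots> = - (R (axis l 1) * (1 / y - 1 / (y + 1)) / (real n * ln 4))"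
    by (simp add: algebra_simps diff_divide_distrib)
  finally have "\<bar>partial_deriv l (log_potential i j k n) x\<bar> = \<bar>R (axis l 1)\<bar> * (1 / y - 1 / (y + 1)) / (real n * ln 4)"
    using y by (simp add: abs_mult divide_left_mono)
  also have "\<dots> \<le> (3 * sqrt y) * (1 / y) / real n"
  proof -
    have le1: "\<bar>axis l (1::real) $ p - axis l 1 $ q\<bar> \<le> 1" for p q
      by (auto simp: axis_def)
    have "\<bar>R (axis l 1)\<bar> \<le> \<bar>2 * \<alpha> * (axis l 1 $ i - axis l 1 $ j)\<bar> + \<bar>2 * \<beta> * (axis l 1 $ j - axis l 1 $ k)\<bar>"
      unfolding R_def by (rule abs_triangle_ineq)
    also have "\<dots> \<le> 2 * \<bar>\<alpha>\<bar> * 1 + 2 * \<bar>\<beta>\<bar> * 1"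
      unfolding abs_mult abs_numeral by (intro add_mono mult_left_mono le1) auto
    finally have "\<bar>R (axis l 1)\<bar>\<^sup>2 \<le> (2 * \<bar>\<alpha>\<bar> + 2 * \<bar>\<beta>\<bar>)\<^sup>2" by (intro power_mono) auto
    also have "\<dots> \<le> 8 * (\<alpha>\<^sup>2 + \<beta>\<^sup>2)"
      using zero_le_power2[of "\<bar>\<alpha>\<bar> - \<bar>\<beta>\<bar>"] by (simp add: power2_sum power2_diff power_mult_distrib)
    also have "\<alpha>\<^sup>2 + \<beta>\<^sup>2 = gap i j k x" by (simp add: gap_def \<alpha>_def \<beta>_def)
    also have "8 * gap i j k x \<le> 9 * y"
      using gap_nonneg[of i j k x] by (simp add: y_def add_increasing2)
    also have "\<dots> = (3 * sqrt y)\<^sup>2" using y by (simp add: power_mult_distrib)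
    finally have R: "\<bar>R (axis l 1)\<bar> \<le> 3 * sqrt y" by (rule power2_le_imp_le) (use y in simp)
    have "1 / y - 1 / (y + 1) \<le> 1 / y" "0 \<le> 1 / y - 1 / (y + 1)" using y by (auto simp: divide_left_mono)
    with R have A: "\<bar>R (axis l 1)\<bar> * (1 / y - 1 / (y + 1)) \<le> (3 * sqrt y) * (1 / y)"
      using y by (intro mult_mono) auto
    show ?thesis
    proof (cases "n = 0")
      case False
      then have "real n * 1 \<le> real n * ln 4" using one_le_ln_4 by (intro mult_left_mono) auto
      then have "\<bar>R (axis l 1)\<bar> * (1 / y - 1 / (y + 1)) / (real n * ln 4) \<le> (3 * sqrt y) * (1 / y) / (real n * 1)"
        using A False y by (intro frac_le) auto
      then show ?thesis by simp
    qed simp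
  qed
  also have "(3 * sqrt y) * (1 / y) / real n = 3 * sqrt (1 / y) / real n"
  proof -
    have "sqrt y * (1 / y) = sqrt (1 / y)" using y by (simp add: real_sqrt_divide field_simps)
    then show ?thesis by (simp only: mult.assoc)
  qed
  finally show ?thesis by (simp add: y_def)
qed

context dirichlet_data
begin

text \<open>Both \<open>u n\<close> and its gradient are of order y^(-1/2)/n, with y the shifted
  gap, so the energy is at most a constant times n^(-2) times an integral of order n. The factor
  \<open>bump\<close> forces the support into the box, which is why \<open>bump\<close> rather than
  1 bounds \<open>u n\<close> from below on the zero set.\<close>

lemma capacity_zero:
  assumes ijk: "i \<noteq> j" "j \<noteq> k" "i \<noteq> k" and ab: "cbox a b \<subseteq> E"
  obtains u where "\<And>n. u n \<in> test_fun E" "\<And>n x. gap i j k x = 0 \<Longrightarrow> u n x \<ge> bump a b x"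
    "(\<lambda>n. nsq \<mu> (u n) + form (u n) (u n)) \<longlonglongrightarrow> 0"
proof -
  define Q where "Q = cbox a b"
  have Q: "compact Q" "Q \<subseteq> E" using ab by (auto simp: Q_def)
  \<comment> \<open>\<open>Suc n\<close> avoids the index 0, where the normalisation divides by
    zero.\<close>
  define u where "u n x = log_potential i j k (Suc n) x * bump a b x" for n x
  define s where "s n x = sqrt (1 / (gap i j k x + (1/4) ^ n))" for n x
  have s2: "(s n x)\<^sup>2 = 1 / (gap i j k x + (1/4) ^ n)" for n x
    using gap_nonneg[of i j k x] unfolding s_def by (intro real_sqrt_pow2) auto
  have s0: "s n x \<ge> 0" for n x unfolding s_def using gap_nonneg[of i j k x] by simp
  have bt: "bump a b \<in> test_fun E" using ab by (rule bump_test_fun)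
  have ut: "u n \<in> test_fun E" for n
    unfolding u_def[abs_def] by (intro test_fun_mult smooth_log_potential bt)
  have u1: "u n x \<ge> bump a b x" if "gap i j k x = 0" for n x
    using mult_right_mono[OF log_potential_ge_1[OF _ that, of "Suc n"] bump_nonneg[of a b x]] by (simp add: u_def)
  obtain B where B: "\<And>x. \<bar>bump a b x\<bar> \<le> B" using test_fun_bounded[OF bt] by blast
  have "\<exists>B. \<forall>x. \<bar>partial_deriv l (bump a b) x\<bar> \<le> B" for l
    using test_fun_bounded[OF test_fun_partial_deriv[OF bt, of l]] by metis
  then obtain B' where B': "\<And>l x. \<bar>partial_deriv l (bump a b) x\<bar> \<le> B' l" by metis
  have Bp: "B \<ge> 0" "B' l \<ge> 0" for l using B[of 0] B'[of l 0] by linarith+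
  define D where "D = 3 * B + (\<Sum>l\<in>UNIV. 2 * B' l) + 2 * B"
  have D: "3 * B + 2 * B' l \<le> D" "2 * B \<le> D" "D \<ge> 0" for l
    using Bp member_le_sum[of l UNIV "\<lambda>l. 2 * B' l"] sum_nonneg[of UNIV "\<lambda>l. 2 * B' l"] unfolding D_def by auto
  have lp: "\<bar>log_potential i j k (Suc n) x\<bar> \<le> 2 * s (Suc n) x / real (Suc n)" for n x
    using log_potential_le[of i j k "Suc n" x] log_potential_nonneg[of i j k "Suc n" x] unfolding s_def by simp
  have ldp: "\<bar>partial_deriv l (log_potential i j k (Suc n)) x\<bar> \<le> 3 * s (Suc n) x / real (Suc n)" for n x l
    using log_potential_deriv_le[of l i j k "Suc n" x] unfolding s_def by simp
  have du: "\<bar>partial_deriv l (u n) x\<bar> \<le> D * s (Suc n) x / real (Suc n)" for l n x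
  proof -
    have "\<bar>partial_deriv l (u n) x\<bar> = \<bar>log_potential i j k (Suc n) x * partial_deriv l (bump a b) x +
        partial_deriv l (log_potential i j k (Suc n)) x * bump a b x\<bar>"
      unfolding u_def[abs_def] by (subst smooth_partial_deriv_mult) (auto intro: smooth_log_potential)
    also have "\<dots> \<le> \<bar>log_potential i j k (Suc n) x\<bar> * \<bar>partial_deriv l (bump a b) x\<bar> +
        \<bar>partial_deriv l (log_potential i j k (Suc n)) x\<bar> * \<bar>bump a b x\<bar>"
      unfolding abs_mult[symmetric] by (rule abs_triangle_ineq)
    also have "\<dots> \<le> (2 * s (Suc n) x / real (Suc n)) * B' l + (3 * s (Suc n) x / real (Suc n)) * B"
      using B B' s0 lp ldp by (intro add_mono mult_mono) auto
    also have "\<dots> = (3 * B + 2 * B' l) * (s (Suc n) x / real (Suc n))" by (simp add: algebra_simps add_divide_distrib)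
    also have "\<dots> \<le> D * (s (Suc n) x / real (Suc n))"
      using D s0 by (intro mult_right_mono) auto
    finally show ?thesis by simp
  qed
  have uu: "\<bar>u n x\<bar> \<le> D * s (Suc n) x / real (Suc n)" for n x
  proof -
    have "\<bar>u n x\<bar> \<le> (2 * s (Suc n) x / real (Suc n)) * B"
      unfolding u_def abs_mult using B s0 lp by (intro mult_mono) auto
    also have "\<dots> = 2 * B * (s (Suc n) x / real (Suc n))" by simp
    also have "\<dots> \<le> D * (s (Suc n) x / real (Suc n))" using D s0 by (intro mult_right_mono) auto
    finally show ?thesis by simp
  qed
  have "\<exists>A\<ge>0. \<forall>x\<in>Q. \<bar>p x * c x $ i $ j\<bar> \<le> A" for i j
    using compact_bound[OF Q continuous_on_mult[OF p_cont c_entry_cont[of i j]]] by metis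
  then obtain A where A: "\<And>i j. A i j \<ge> 0" "\<And>i j x. x \<in> Q \<Longrightarrow> \<bar>p x * c x $ i $ j\<bar> \<le> A i j" by metis
  obtain P where P: "P \<ge> 0" "\<And>x. x \<in> Q \<Longrightarrow> \<bar>p x\<bar> \<le> P" using compact_bound[OF Q p_cont] by blast
  define C where "C = P * D\<^sup>2 + (\<Sum>i\<in>UNIV. \<Sum>j\<in>UNIV. A i j * D\<^sup>2)"
  have Cp: "C \<ge> 0" unfolding C_def using A P by (intro add_nonneg_nonneg sum_nonneg mult_nonneg_nonneg) auto
  obtain V where V: "V \<ge> 0" "\<And>n. (LINT x:Q|lborel. 1 / (gap i j k x + (1/4) ^ n)) \<le> V * real (n + 1)"
    "\<And>n. set_integrable lborel Q (\<lambda>x. 1 / (gap i j k x + (1/4) ^ n))"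
    unfolding Q_def using gap_integral_bound[OF ijk, of a b] by blast
  have zero: "u n x = 0" "partial_deriv l (u n) x = 0" if "x \<notin> Q" for n x l
  proof -
    have 0: "u n x = 0" if "x \<notin> Q" for x using that by (simp add: u_def bump_eq_0_cbox Q_def)
    then show "u n x = 0" using that by blast
    show "partial_deriv l (u n) x = 0"
      by (rule partial_deriv_outside[of Q]) (use 0 Q that compact_imp_closed in auto)
  qed
  have bound: "nsq \<mu> (u n) + form (u n) (u n) \<le> C * V * (real n + 2) / (real (Suc n))\<^sup>2" for n
  proof -
    define q where "q x = C * (1 / (gap i j k x + (1/4) ^ Suc n)) / (real (Suc n))\<^sup>2" for x
    have un [measurable]: "u n \<in> borel_measurable \<mu>" using test_fun_L2(1)[OF ut] by (rule L2_measurable)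
    have nq: "nsq \<mu> (u n) = (LINT x|lborel. indicator E x *\<^sub>R (p x * (u n x * u n x)))"
      unfolding ip_def by (subst integral_\<mu>) (auto simp: set_lebesgue_integral_def)
    have fq: "form (u n) (u n) = 1/2 * (LINT x|lborel. (\<Sum>j\<in>UNIV. flux (u n) j x * partial_deriv j (u n) x))"
      unfolding form_eq[OF ut ut]
      by (subst Bochner_Integration.integral_sum) (auto intro!: flux_integrable test_fun_partial_deriv ut)
    have i1: "integrable lborel (\<lambda>x. indicator E x *\<^sub>R (p x * (u n x * u n x)))"
    proof -
      have "continuous_on E (\<lambda>x. p x * (u n x * u n x))"
        by (intro continuous_intros p_cont smooth_continuous test_fun_smooth[OF ut])
      then have "continuous_on Q (\<lambda>x. p x * (u n x * u n x))" using Q(2) continuous_on_subset by blast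
      then have "integrable lborel (\<lambda>x. indicator Q x *\<^sub>R (p x * (u n x * u n x)))"
        by (rule borel_integrable_compact[OF Q(1)])
      moreover have "indicator Q x *\<^sub>R (p x * (u n x * u n x)) = indicator E x *\<^sub>R (p x * (u n x * u n x))" for x
        using Q(2) zero(1)[of x n] by (auto simp: indicator_def)
      ultimately show ?thesis by (simp only:)
    qed
    have i2: "integrable lborel (\<lambda>x. \<Sum>j\<in>UNIV. flux (u n) j x * partial_deriv j (u n) x)"
      by (intro Bochner_Integration.integrable_sum flux_integrable test_fun_partial_deriv ut)
    have q_eq: "indicator Q x *\<^sub>R q x =
        C / (real (Suc n))\<^sup>2 * (indicator Q x *\<^sub>R (1 / (gap i j k x + (1/4) ^ Suc n)))" for x
      by (simp only: q_def real_scaleR_def times_divide_eq_left mult.left_commute mult.assoc)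
    have i3: "integrable lborel (\<lambda>x. indicator Q x *\<^sub>R q x)"
      unfolding q_eq using V(3)[of "Suc n"] unfolding set_integrable_def by (rule integrable_mult_right)
    have pw: "indicator E x *\<^sub>R (p x * (u n x * u n x)) + 1/2 * (\<Sum>j\<in>UNIV. flux (u n) j x * partial_deriv j (u n) x)
        \<le> indicator Q x *\<^sub>R q x" for x
    proof (cases "x \<in> Q")
      case False
      then show ?thesis by (simp add: zero)
    next
      case True
      define t where "t = D * s (Suc n) x / real (Suc n)"
      have t0: "t \<ge> 0" using D s0 by (simp add: t_def)
      have t2: "t * t = D\<^sup>2 * (1 / (gap i j k x + (1/4) ^ Suc n)) / (real (Suc n))\<^sup>2"
        unfolding s2[symmetric] t_def by (simp add: power2_eq_square)
      have "p x * (u n x * u n x) \<le> P * (t * t)"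
      proof -
        have "\<bar>p x * (u n x * u n x)\<bar> \<le> P * (t * t)"
          unfolding abs_mult using P(2)[OF True] P(1) uu[of n x] t0 unfolding t_def[symmetric]
          by (intro mult_mono) auto
        then show ?thesis by linarith
      qed
      moreover have "(\<Sum>j\<in>UNIV. flux (u n) j x * partial_deriv j (u n) x) \<le> (\<Sum>j\<in>UNIV. \<Sum>i\<in>UNIV. A i j * (t * t))"
      proof (rule sum_mono)
        fix l
        have "flux (u n) l x * partial_deriv l (u n) x = (\<Sum>i\<in>UNIV. p x * c x $ i $ l * (partial_deriv i (u n) x * partial_deriv l (u n) x))"
          by (simp add: flux_def sum_distrib_right mult.assoc)
        also have "\<dots> \<le> (\<Sum>i\<in>UNIV. A i l * (t * t))"
        proof (rule sum_mono)
          fix i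
          have "\<bar>p x * c x $ i $ l * (partial_deriv i (u n) x * partial_deriv l (u n) x)\<bar> \<le> A i l * (t * t)"
            unfolding abs_mult[of "p x * c x $ i $ l"] abs_mult[of "partial_deriv i (u n) x"]
            using A(1) A(2)[OF True] du[of _ n x] t0 unfolding t_def[symmetric]
            by (intro mult_mono) auto
          then show "p x * c x $ i $ l * (partial_deriv i (u n) x * partial_deriv l (u n) x) \<le> A i l * (t * t)"
            by linarith
        qed
        finally show "flux (u n) l x * partial_deriv l (u n) x \<le> (\<Sum>i\<in>UNIV. A i l * (t * t))" .
      qed
      moreover have "0 \<le> (\<Sum>j\<in>UNIV. \<Sum>i\<in>UNIV. A i j * (t * t))"
        using A(1) t0 by (intro sum_nonneg mult_nonneg_nonneg) auto
      moreover have "P * (t * t) + (\<Sum>j\<in>UNIV. \<Sum>i\<in>UNIV. A i j * (t * t)) = q x"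
        unfolding q_def C_def t2 by (subst sum.swap) (simp add: sum_distrib_right algebra_simps add_divide_distrib sum_divide_distrib)
      ultimately show ?thesis using True Q(2) by auto
    qed
    have "nsq \<mu> (u n) + form (u n) (u n) =
       (LINT x|lborel. indicator E x *\<^sub>R (p x * (u n x * u n x)) + 1/2 * (\<Sum>j\<in>UNIV. flux (u n) j x * partial_deriv j (u n) x))"
      unfolding nq fq using i1 i2 by (subst Bochner_Integration.integral_add) auto
    also have "\<dots> \<le> (LINT x|lborel. indicator Q x *\<^sub>R q x)"
      using i1 i2 i3 pw by (intro integral_mono) auto
    also have "\<dots> = C * (LINT x:Q|lborel. 1 / (gap i j k x + (1/4) ^ Suc n)) / (real (Suc n))\<^sup>2"
      unfolding q_eq set_lebesgue_integral_def integral_mult_right_zero by simp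
    also have "\<dots> \<le> C * (V * real (Suc n + 1)) / (real (Suc n))\<^sup>2"
      using V(2)[of "Suc n"] Cp by (intro divide_right_mono mult_left_mono) auto
    finally show ?thesis by (simp add: mult.assoc add.commute)
  qed
  have "(\<lambda>n. C * V * ((real n + 2) / (real (Suc n))\<^sup>2)) \<longlonglongrightarrow> C * V * 0"
  proof (intro tendsto_intros)
    have "(\<lambda>n. 2 / real (Suc n)) \<longlonglongrightarrow> 0" by (rule LIMSEQ_Suc[OF lim_const_over_n])
    moreover have "(real n + 2) / (real (Suc n))\<^sup>2 \<le> 2 / real (Suc n)" for n
    proof -
      have "(real n + 2) / (real (Suc n))\<^sup>2 \<le> (2 * real (Suc n)) / (real (Suc n))\<^sup>2"
        by (intro divide_right_mono) auto
      also have "\<dots> = 2 / real (Suc n)" by (simp add: power2_eq_square del: of_nat_Suc)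
      finally show ?thesis .
    qed
    ultimately show "(\<lambda>n. (real n + 2) / (real (Suc n))\<^sup>2) \<longlonglongrightarrow> 0"
      by (intro Lim_null_comparison[of "\<lambda>n. (real n + 2) / (real (Suc n))\<^sup>2" "\<lambda>n. 2 / real (Suc n)" sequentially] always_eventually allI)
         (simp_all del: of_nat_Suc)
  qed
  then have lim: "(\<lambda>n. C * V * ((real n + 2) / (real (Suc n))\<^sup>2)) \<longlonglongrightarrow> 0" by simp
  have "(\<lambda>n. nsq \<mu> (u n) + form (u n) (u n)) \<longlonglongrightarrow> 0"
  proof (rule Lim_null_comparison[OF always_eventually lim], rule allI)
    show "norm (nsq \<mu> (u n) + form (u n) (u n)) \<le> C * V * ((real n + 2) / (real (Suc n))\<^sup>2)" for n
      using bound[of n] nsq_nonneg[of \<mu> "u n"] form_nonneg[of "u n"] by simp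
  qed
  with ut u1 show thesis by (intro that)
qed

end

subsection \<open>The Markov property at fixed times\<close>

context hunt_process
begin

abbreviation "SC \<equiv> Alexandroff_compactification S"
abbreviation "BC \<equiv> borel_of_top SC"

lemma space_BC [simp]: "space BC = topspace SC"
  unfolding borel_of_top_def using openin_subset by (intro space_measure_of) blast

lemma openin_sets_BC: "openin SC U \<Longrightarrow> U \<in> sets BC"
proof -
  assume U: "openin SC U"
  have "{U. openin SC U} \<subseteq> Pow (topspace SC)" using openin_subset by blast
  with U show ?thesis unfolding borel_of_top_def by (simp only: sets_measure_of) (blast intro: sigma_sets.Basic)
qed

lemma space_P: "x \<in> topspace SC \<Longrightarrow> space (P x) = space M"
  using sets_P by (rule sets_eq_imp_space_eq)

lemma sets_F_le: "sets (F (ennreal t)) \<subseteq> sets M"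
  using subalgebra_F[of t] by (simp add: subalgebra_def)

lemma F_measurable_P:
  assumes "x \<in> topspace SC" "f \<in> measurable (F (ennreal t)) N"
  shows "f \<in> measurable (P x) N"
proof -
  have "f \<in> measurable M N"
    by (rule measurable_from_subalg[OF subalgebra_F assms(2)])
  then show ?thesis using sets_P[OF assms(1)] by (simp cong: measurable_cong_sets)
qed

lemma X_measurable_P: "x \<in> topspace SC \<Longrightarrow> 0 \<le> t \<Longrightarrow> X t \<in> measurable (P x) BC"
  by (rule F_measurable_P[OF _ adapted])

lemma X_topspace: "0 \<le> t \<Longrightarrow> \<omega> \<in> space M \<Longrightarrow> X t \<omega> \<in> topspace SC"
  using measurable_space[OF adapted[of t], of \<omega>] by (simp add: space_F)

lemma X_event: "0 \<le> t \<Longrightarrow> A \<in> sets BC \<Longrightarrow> {\<omega>\<in>space M. X t \<omega> \<in> A} \<in> sets (F (ennreal t))"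
  using measurable_sets[OF adapted[of t], of A] by (simp add: space_F vimage_def Int_def conj_commute)

lemma X_event_M: "0 \<le> t \<Longrightarrow> A \<in> sets BC \<Longrightarrow> {\<omega>\<in>space M. X t \<omega> \<in> A} \<in> sets M"
  using X_event sets_F_le by blast

text \<open>The strong Markov property at the constant time t, integrated over \<open>G\<close>. It
  is phrased with nonnegative integrals so that the passage from sets to functions needs no
  integrability.\<close>

lemma markov_event:
  assumes x: "x \<in> topspace SC" and t: "0 \<le> t" "0 \<le> h" and G: "G \<in> sets (F (ennreal t))" and A: "A \<in> sets BC"
  shows "(\<integral>\<^sup>+\<omega>. indicator G \<omega> * indicator A (X (t + h) \<omega>) \<partial>P x) =
    (\<integral>\<^sup>+\<omega>. indicator G \<omega> * emeasure (P (X t \<omega>)) {\<omega>'\<in>space M. X h \<omega>' \<in> A} \<partial>P x)"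
proof -
  interpret prob_space "P x" using x by (rule prob_space_P)
  define \<sigma> :: "'w \<Rightarrow> ennreal" where "\<sigma> = (\<lambda>_. ennreal t)"
  have \<sigma>: "stopping_time F \<sigma>" unfolding \<sigma>_def by (rule stopping_time_const)
  define k where "k y = measure (P y) {\<omega>'\<in>space M. X h \<omega>' \<in> A}" for y
  define H where "H = {\<omega>\<in>space M. X (t + h) \<omega> \<in> A}"
  have HM: "H \<in> sets (P x)"
    unfolding H_def sets_P[OF x] using X_event_M[of "t + h" A] t A by simp
  have km: "k \<in> borel_measurable BC" unfolding k_def using t A by (intro measurable_P)
  have kX: "(\<lambda>\<omega>. k (X t \<omega>)) \<in> borel_measurable (P x)"
    using measurable_compose[OF X_measurable_P[OF x t(1)] km] .
  have spF: "sets (pre_sigma \<sigma>) \<subseteq> sets M"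
  proof
    fix A assume "A \<in> sets (pre_sigma \<sigma>)"
    then have "{\<omega>\<in>A. \<sigma> \<omega> \<le> ennreal t} \<in> sets (F (ennreal t))" using sets_pre_sigmaD[OF \<sigma>] by blast
    then show "A \<in> sets M" using sets_F_le[of t] by (auto simp: \<sigma>_def)
  qed
  have fms: "finite_measure_subalgebra (P x) (pre_sigma \<sigma>)"
  proof (unfold_locales)
    show "subalgebra (P x) (pre_sigma \<sigma>)"
      using spF by (simp add: subalgebra_def space_pre_sigma space_P[OF x] sets_P[OF x])
  qed
  interpret finite_measure_subalgebra "P x" "pre_sigma \<sigma>" by (rule fms)
  \<comment> \<open>For s < t no outcome satisfies \<open>\<sigma> \<omega> \<le> s\<close>, so
    membership of \<open>G\<close> in F(t) suffices.\<close>
  have Gp: "G \<in> sets (pre_sigma \<sigma>)"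
  proof (rule sets_pre_sigmaI[OF \<sigma>])
    fix s show "{\<omega>\<in>G. \<sigma> \<omega> \<le> s} \<in> sets (F s)"
      using G sets_F_mono[of "ennreal t" s] by (cases "ennreal t \<le> s") (auto simp: \<sigma>_def)
  qed
  have GP: "G \<in> sets (P x)" using Gp spF sets_P[OF x] by auto
  have X\<sigma>: "at_time X \<sigma> \<omega> = X t \<omega>" for \<omega> using t by (simp add: at_time_def \<sigma>_def)
  have X\<sigma>': "at_time X (\<lambda>\<omega>. \<sigma> \<omega> + ennreal h) \<omega> = X (t + h) \<omega>" for \<omega>
    using t by (simp add: at_time_def \<sigma>_def flip: ennreal_plus)
  have ae: "AE \<omega> in P x. real_cond_exp (P x) (pre_sigma \<sigma>) (indicator H) \<omega> = k (X t \<omega>)"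
    using strong_markov[OF x \<sigma> t(2) A] by (simp add: X\<sigma> X\<sigma>' k_def H_def)
  have Hi: "integrable (P x) (indicator H :: 'w \<Rightarrow> real)"
    using HM by (intro integrable_real_indicator) (simp_all add: emeasure_eq_measure)
  have k01: "0 \<le> k (X t \<omega>)" "\<omega> \<in> space M \<Longrightarrow> k (X t \<omega>) \<le> 1" for \<omega>
    using prob_space.prob_le_1[OF prob_space_P[OF X_topspace[OF t(1)]]] by (auto simp: k_def)
  have "(LINT \<omega>:G|P x. indicator H \<omega>) = (LINT \<omega>:G|P x. real_cond_exp (P x) (pre_sigma \<sigma>) (indicator H) \<omega> :: real)"
    by (rule real_cond_exp_intA[OF Hi Gp])
  also have "\<dots> = (LINT \<omega>:G|P x. k (X t \<omega>))"
    unfolding set_lebesgue_integral_def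
    by (intro integral_cong_AE borel_measurable_scaleR borel_measurable_indicator GP kX borel_measurable_cond_exp2)
       (use ae in eventually_elim, simp)
  finally have eq: "(LINT \<omega>|P x. indicator G \<omega> * indicator H \<omega>) = (LINT \<omega>|P x. indicator G \<omega> * k (X t \<omega>))"
    by (simp add: set_lebesgue_integral_def)
  have "(\<integral>\<^sup>+\<omega>. indicator G \<omega> * indicator A (X (t + h) \<omega>) \<partial>P x) =
      (\<integral>\<^sup>+\<omega>. ennreal (indicator G \<omega> * indicator H \<omega>) \<partial>P x)"
    by (intro nn_integral_cong) (auto simp: H_def indicator_def space_P[OF x])
  also have "\<dots> = ennreal (LINT \<omega>|P x. indicator G \<omega> * indicator H \<omega>)"
    using GP HM by (intro nn_integral_eq_integral integrable_const_bound[where B=1]) (auto simp: indicator_def)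
  also have "\<dots> = (\<integral>\<^sup>+\<omega>. ennreal (indicator G \<omega> * k (X t \<omega>)) \<partial>P x)"
    unfolding eq using GP kX k01
    by (intro nn_integral_eq_integral[symmetric] integrable_const_bound[where B=1] AE_I2)
       (auto simp: indicator_def space_P[OF x])
  also have "\<dots> = (\<integral>\<^sup>+\<omega>. indicator G \<omega> * emeasure (P (X t \<omega>)) {\<omega>'\<in>space M. X h \<omega>' \<in> A} \<partial>P x)"
  proof (intro nn_integral_cong)
    fix \<omega> assume "\<omega> \<in> space (P x)"
    then interpret q: prob_space "P (X t \<omega>)" using X_topspace[OF t(1)] by (intro prob_space_P) (simp add: space_P[OF x])
    show "ennreal (indicator G \<omega> * k (X t \<omega>)) = indicator G \<omega> * emeasure (P (X t \<omega>)) {\<omega>'\<in>space M. X h \<omega>' \<in> A}"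
      by (simp add: k_def q.emeasure_eq_measure indicator_def)
  qed
  finally show ?thesis .
qed

text \<open>Makes the inner expectation in \<open>markov_nn_integral\<close> a measurable function
  of the state X(t). For indicators it is the measurability of the laws in the starting
  point.\<close>

lemma kernel_measurable:
  assumes "g \<in> borel_measurable BC" "0 \<le> h"
  shows "(\<lambda>y. \<integral>\<^sup>+\<omega>. g (X h \<omega>) \<partial>P y) \<in> borel_measurable BC"
  using assms(1)
proof (induction g rule: borel_measurable_induct)
  case (cong f g)
  have "(\<integral>\<^sup>+\<omega>. f (X h \<omega>) \<partial>P y) = (\<integral>\<^sup>+\<omega>. g (X h \<omega>) \<partial>P y)" if "y \<in> space BC" for y
    using cong.hyps(3) X_topspace[OF assms(2)] that by (intro nn_integral_cong) (auto simp: space_P)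
  note eq = this
  show ?case by (subst measurable_cong[OF eq]) (use cong.IH in auto)
next
  case (set A)
  have eq: "(\<integral>\<^sup>+\<omega>. indicator A (X h \<omega>) \<partial>P y) = ennreal (measure (P y) {\<omega>'\<in>space M. X h \<omega>' \<in> A})" if "y \<in> space BC" for y
  proof -
    have y: "y \<in> topspace SC" using that by simp
    interpret q: prob_space "P y" using y by (rule prob_space_P)
    have "{\<omega>'\<in>space M. X h \<omega>' \<in> A} \<in> sets (P y)"
      unfolding sets_P[OF y] by (rule X_event_M[OF assms(2) set])
    then have "(\<integral>\<^sup>+\<omega>. indicator {\<omega>'\<in>space M. X h \<omega>' \<in> A} \<omega> \<partial>P y) = ennreal (measure (P y) {\<omega>'\<in>space M. X h \<omega>' \<in> A})"
      by (simp add: q.emeasure_eq_measure)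
    moreover have "(\<integral>\<^sup>+\<omega>. indicator A (X h \<omega>) \<partial>P y) = (\<integral>\<^sup>+\<omega>. indicator {\<omega>'\<in>space M. X h \<omega>' \<in> A} \<omega> \<partial>P y)"
      by (intro nn_integral_cong) (auto simp: space_P[OF y] indicator_def)
    ultimately show ?thesis by simp
  qed
  show ?case using measurable_P[OF assms(2) set] by (subst measurable_cong[OF eq]) auto
next
  case (mult u c)
  have "(\<integral>\<^sup>+\<omega>. c * u (X h \<omega>) \<partial>P y) = c * (\<integral>\<^sup>+\<omega>. u (X h \<omega>) \<partial>P y)" if "y \<in> space BC" for y
    using measurable_compose[OF X_measurable_P[OF _ assms(2)] mult.hyps(2)] that by (intro nn_integral_cmult) auto
  note eq = this
  show ?case by (subst measurable_cong[OF eq]) (use mult.IH in \<open>auto intro: borel_measurable_times_ennreal\<close>)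
next
  case (add u v)
  have "(\<integral>\<^sup>+\<omega>. v (X h \<omega>) + u (X h \<omega>) \<partial>P y) = (\<integral>\<^sup>+\<omega>. v (X h \<omega>) \<partial>P y) + (\<integral>\<^sup>+\<omega>. u (X h \<omega>) \<partial>P y)" if "y \<in> space BC" for y
    using measurable_compose[OF X_measurable_P[OF _ assms(2)] add.hyps(1)]
      measurable_compose[OF X_measurable_P[OF _ assms(2)] add.hyps(3)] that by (intro nn_integral_add) auto
  note eq = this
  show ?case by (subst measurable_cong[OF eq]) (use add.IH in \<open>auto intro: borel_measurable_add\<close>)
next
  case (seq U)
  have eq: "(\<integral>\<^sup>+\<omega>. (SUP i. U i) (X h \<omega>) \<partial>P y) = (SUP i. \<integral>\<^sup>+\<omega>. U i (X h \<omega>) \<partial>P y)" if "y \<in> space BC" for y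
    unfolding SUP_apply
    using measurable_compose[OF X_measurable_P[OF _ assms(2)] seq.hyps(1)] that seq.hyps(3)
    by (intro nn_integral_monotone_convergence_SUP) (auto simp: incseq_def le_fun_def)
  show ?case using seq.IH by (subst measurable_cong[OF eq]) auto
qed

text \<open>Monotone class extension of \<open>markov_event\<close> in the function of the later
  state; the event \<open>G\<close> stays fixed through the induction.\<close>

lemma markov_nn_integral:
  assumes x: "x \<in> topspace SC" and t: "0 \<le> t" "0 \<le> h" and G: "G \<in> sets (F (ennreal t))"
    and g: "g \<in> borel_measurable BC"
  shows "(\<integral>\<^sup>+\<omega>. indicator G \<omega> * g (X (t + h) \<omega>) \<partial>P x) =
    (\<integral>\<^sup>+\<omega>. indicator G \<omega> * (\<integral>\<^sup>+\<omega>'. g (X h \<omega>') \<partial>P (X t \<omega>)) \<partial>P x)"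
  using g
proof (induction g rule: borel_measurable_induct)
  have GP [measurable]: "(indicator G :: 'w \<Rightarrow> ennreal) \<in> borel_measurable (P x)"
    by (rule F_measurable_P[OF x borel_measurable_indicator[OF G]])
  have Xth: "X (t + h) \<in> measurable (P x) BC" using x t by (intro X_measurable_P) auto
  have Xt: "X t \<in> measurable (P x) BC" using x t by (intro X_measurable_P) auto
  have inX: "\<omega> \<in> space (P x) \<Longrightarrow> X t \<omega> \<in> topspace SC" for \<omega>
    using X_topspace[OF t(1)] by (simp add: space_P[OF x])
  {
    case (cong f g)
    have "(\<integral>\<^sup>+\<omega>. indicator G \<omega> * f (X (t + h) \<omega>) \<partial>P x) = (\<integral>\<^sup>+\<omega>. indicator G \<omega> * g (X (t + h) \<omega>) \<partial>P x)"
      using cong.hyps(3) measurable_space[OF Xth] by (intro nn_integral_cong) auto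
    moreover have "(\<integral>\<^sup>+\<omega>'. f (X h \<omega>') \<partial>P (X t \<omega>)) = (\<integral>\<^sup>+\<omega>'. g (X h \<omega>') \<partial>P (X t \<omega>))" if "\<omega> \<in> space (P x)" for \<omega>
      using cong.hyps(3) X_topspace[OF t(2)] inX[OF that] by (intro nn_integral_cong) (auto simp: space_P)
    ultimately show ?case using cong.IH by (simp cong: nn_integral_cong)
  next
    case (set A)
    have "(\<integral>\<^sup>+\<omega>'. indicator A (X h \<omega>') \<partial>P (X t \<omega>)) = emeasure (P (X t \<omega>)) {\<omega>'\<in>space M. X h \<omega>' \<in> A}" if "\<omega> \<in> space (P x)" for \<omega>
    proof -
      note y = inX[OF that]
      have m: "{\<omega>'\<in>space M. X h \<omega>' \<in> A} \<in> sets (P (X t \<omega>))"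
        unfolding sets_P[OF y] by (rule X_event_M[OF t(2) set])
      have "(\<integral>\<^sup>+\<omega>'. indicator A (X h \<omega>') \<partial>P (X t \<omega>)) = (\<integral>\<^sup>+\<omega>'. indicator {\<omega>'\<in>space M. X h \<omega>' \<in> A} \<omega>' \<partial>P (X t \<omega>))"
        by (intro nn_integral_cong) (auto simp: space_P[OF y] indicator_def)
      with m show ?thesis by simp
    qed
    with markov_event[OF x t G set] show ?case by (simp cong: nn_integral_cong)
  next
    case (mult u c)
    note [measurable] = measurable_compose[OF Xth mult.hyps(2)]
    have [measurable]: "(\<lambda>\<omega>. \<integral>\<^sup>+\<omega>'. u (X h \<omega>') \<partial>P (X t \<omega>)) \<in> borel_measurable (P x)"
      using measurable_compose[OF Xt kernel_measurable[OF mult.hyps(2) t(2)]] .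
    have "(\<integral>\<^sup>+\<omega>'. c * u (X h \<omega>') \<partial>P (X t \<omega>)) = c * (\<integral>\<^sup>+\<omega>'. u (X h \<omega>') \<partial>P (X t \<omega>))" if "\<omega> \<in> space (P x)" for \<omega>
      using measurable_compose[OF X_measurable_P[OF inX[OF that] t(2)] mult.hyps(2)] by (rule nn_integral_cmult)
    then have "(\<integral>\<^sup>+\<omega>. indicator G \<omega> * (\<integral>\<^sup>+\<omega>'. c * u (X h \<omega>') \<partial>P (X t \<omega>)) \<partial>P x) =
        (\<integral>\<^sup>+\<omega>. c * (indicator G \<omega> * (\<integral>\<^sup>+\<omega>'. u (X h \<omega>') \<partial>P (X t \<omega>))) \<partial>P x)"
      by (intro nn_integral_cong) (simp add: mult.left_commute)
    also have "\<dots> = c * (\<integral>\<^sup>+\<omega>. indicator G \<omega> * u (X (t + h) \<omega>) \<partial>P x)"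
      unfolding mult.IH by (rule nn_integral_cmult) measurable
    also have "\<dots> = (\<integral>\<^sup>+\<omega>. c * (indicator G \<omega> * u (X (t + h) \<omega>)) \<partial>P x)"
      by (rule nn_integral_cmult[symmetric]) measurable
    finally show ?case by (simp add: mult.left_commute)
  next
    case (add u v)
    note [measurable] = measurable_compose[OF Xth add.hyps(1)] measurable_compose[OF Xth add.hyps(3)]
    have [measurable]: "(\<lambda>\<omega>. \<integral>\<^sup>+\<omega>'. u (X h \<omega>') \<partial>P (X t \<omega>)) \<in> borel_measurable (P x)"
        "(\<lambda>\<omega>. \<integral>\<^sup>+\<omega>'. v (X h \<omega>') \<partial>P (X t \<omega>)) \<in> borel_measurable (P x)"
      using measurable_compose[OF Xt kernel_measurable[OF add.hyps(1) t(2)]]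
        measurable_compose[OF Xt kernel_measurable[OF add.hyps(3) t(2)]] by simp_all
    have "(\<integral>\<^sup>+\<omega>'. v (X h \<omega>') + u (X h \<omega>') \<partial>P (X t \<omega>)) = (\<integral>\<^sup>+\<omega>'. v (X h \<omega>') \<partial>P (X t \<omega>)) + (\<integral>\<^sup>+\<omega>'. u (X h \<omega>') \<partial>P (X t \<omega>))"
      if "\<omega> \<in> space (P x)" for \<omega>
      using measurable_compose[OF X_measurable_P[OF inX[OF that] t(2)] add.hyps(3)]
        measurable_compose[OF X_measurable_P[OF inX[OF that] t(2)] add.hyps(1)] by (rule nn_integral_add)
    then have "(\<integral>\<^sup>+\<omega>. indicator G \<omega> * (\<integral>\<^sup>+\<omega>'. v (X h \<omega>') + u (X h \<omega>') \<partial>P (X t \<omega>)) \<partial>P x) =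
        (\<integral>\<^sup>+\<omega>. indicator G \<omega> * (\<integral>\<^sup>+\<omega>'. v (X h \<omega>') \<partial>P (X t \<omega>)) + indicator G \<omega> * (\<integral>\<^sup>+\<omega>'. u (X h \<omega>') \<partial>P (X t \<omega>)) \<partial>P x)"
      by (intro nn_integral_cong) (simp add: distrib_left)
    also have "\<dots> = (\<integral>\<^sup>+\<omega>. indicator G \<omega> * v (X (t + h) \<omega>) \<partial>P x) + (\<integral>\<^sup>+\<omega>. indicator G \<omega> * u (X (t + h) \<omega>) \<partial>P x)"
      unfolding add.IH by (rule nn_integral_add) measurable
    also have "\<dots> = (\<integral>\<^sup>+\<omega>. indicator G \<omega> * v (X (t + h) \<omega>) + indicator G \<omega> * u (X (t + h) \<omega>) \<partial>P x)"
      by (rule nn_integral_add[symmetric]) measurable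
    finally show ?case by (simp add: distrib_left)
  next
    case (seq U)
    note [measurable] = measurable_compose[OF Xth seq.hyps(1)]
    have [measurable]: "(\<lambda>\<omega>. \<integral>\<^sup>+\<omega>'. U i (X h \<omega>') \<partial>P (X t \<omega>)) \<in> borel_measurable (P x)" for i
      using measurable_compose[OF Xt kernel_measurable[OF seq.hyps(1) t(2)]] .
    have "(\<integral>\<^sup>+\<omega>'. (SUP i. U i) (X h \<omega>') \<partial>P (X t \<omega>)) = (SUP i. \<integral>\<^sup>+\<omega>'. U i (X h \<omega>') \<partial>P (X t \<omega>))" if "\<omega> \<in> space (P x)" for \<omega>
      unfolding SUP_apply
      using measurable_compose[OF X_measurable_P[OF inX[OF that] t(2)] seq.hyps(1)] seq.hyps(3)
      by (intro nn_integral_monotone_convergence_SUP) (auto simp: incseq_def le_fun_def)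
    then have "(\<integral>\<^sup>+\<omega>. indicator G \<omega> * (\<integral>\<^sup>+\<omega>'. (SUP i. U i) (X h \<omega>') \<partial>P (X t \<omega>)) \<partial>P x) =
        (\<integral>\<^sup>+\<omega>. (SUP i. indicator G \<omega> * (\<integral>\<^sup>+\<omega>'. U i (X h \<omega>') \<partial>P (X t \<omega>))) \<partial>P x)"
      by (intro nn_integral_cong) (simp add: SUP_mult_left_ennreal)
    also have "\<dots> = (SUP i. \<integral>\<^sup>+\<omega>. indicator G \<omega> * (\<integral>\<^sup>+\<omega>'. U i (X h \<omega>') \<partial>P (X t \<omega>)) \<partial>P x)"
      using seq.hyps(3) by (intro nn_integral_monotone_convergence_SUP)
        (auto simp: incseq_def le_fun_def intro!: mult_left_mono nn_integral_mono)
    also have "\<dots> = (SUP i. \<integral>\<^sup>+\<omega>. indicator G \<omega> * U i (X (t + h) \<omega>) \<partial>P x)"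
      by (simp only: seq.IH)
    also have "\<dots> = (\<integral>\<^sup>+\<omega>. (SUP i. indicator G \<omega> * U i (X (t + h) \<omega>)) \<partial>P x)"
      using seq.hyps(3) by (intro nn_integral_monotone_convergence_SUP[symmetric])
        (auto simp: incseq_def le_fun_def intro!: mult_left_mono)
    also have "\<dots> = (\<integral>\<^sup>+\<omega>. indicator G \<omega> * (SUP i. U i) (X (t + h) \<omega>) \<partial>P x)"
      by (intro nn_integral_cong) (simp add: SUP_mult_left_ennreal image_comp)
    finally show ?case by simp
  }
qed

end

section \<open>The associated process: its semigroup, measurability and continuity along
  paths\<close>

locale associated_process =
  dirichlet_data E c p + hunt_process "top_of_set E" M F P X
  for E :: "(real^'d::finite) set" and c p and M :: "'w measure" and F P X +
  assumes two_le_dim: "CARD('d) \<ge> 2"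
    and associated: "associated_hunt_process E c p M F P X"
begin

text \<open>\<open>T\<close> matters only up to null sets, while \<open>Pt\<close> is a genuine
  kernel with pointwise values. Energy estimates are made for \<open>T\<close>, pointwise and
  probabilistic ones for \<open>Pt\<close>, and the two are compared almost everywhere.\<close>

definition T :: "real \<Rightarrow> (real^'d \<Rightarrow> real) \<Rightarrow> real^'d \<Rightarrow> real" where
  "T = (SOME T. form_semigroup E c p T \<and>
     (\<forall>t\<ge>0. \<forall>f\<in>Lr_fun 2 \<mu>. AE x in \<mu>. transition P X t f x = T t f x))"

abbreviation Pt :: "real \<Rightarrow> (real^'d \<Rightarrow> real) \<Rightarrow> real^'d \<Rightarrow> real" where
  "Pt \<equiv> transition P X"

lemma T_associated: "form_semigroup E c p T" "t \<ge> 0 \<Longrightarrow> L2 \<mu> f \<Longrightarrow> AE x in \<mu>. Pt t f x = T t f x"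
proof -
  have "\<exists>T. form_semigroup E c p T \<and> (\<forall>t\<ge>0. \<forall>f\<in>Lr_fun 2 \<mu>. AE x in \<mu>. Pt t f x = T t f x)"
    using associated unfolding associated_hunt_process_def by blast
  from someI_ex[OF this] show "form_semigroup E c p T" "t \<ge> 0 \<Longrightarrow> L2 \<mu> f \<Longrightarrow> AE x in \<mu>. Pt t f x = T t f x"
    unfolding T_def by (auto simp: Lr_fun_2_iff)
qed

sublocale sym_semigroup \<mu> T
proof
  show "L2_semigroup \<mu> T" using T_associated(1) by (simp add: form_semigroup_def)
  show "ip \<mu> g v = ip \<mu> h u"
    if "semigroup_generator \<mu> T u g" "semigroup_generator \<mu> T v h" for u g v h
    by (rule form_generator_sym) (use that T_associated(1) in \<open>auto simp only: form_semigroup_def\<close>)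
qed


lemma Some_in_SC: "x \<in> E \<Longrightarrow> Some x \<in> topspace SC" by simp

lemma Some_image_sets:
  assumes "A \<in> sets \<mu>" shows "Some ` A \<in> sets BC"
proof -
  have E: "Some ` E \<in> sets BC" by (rule openin_sets_BC) simp
  have *: "Some ` (A \<inter> E) \<in> sets BC" if "A \<in> sigma_sets UNIV {S. open S}" for A
    using that
  proof induction
    case (Basic U)
    then have "openin SC (Some ` (U \<inter> E))" by (simp add: openin_open_Int inf_commute)
    then show ?case by (rule openin_sets_BC)
  next
    case (Compl A)
    have "Some ` ((UNIV - A) \<inter> E) = Some ` E - Some ` (A \<inter> E)" by auto
    then show ?case using Compl E by auto
  next
    case (Union A)
    have "Some ` (\<Union> (range A) \<inter> E) = (\<Union>i. Some ` (A i \<inter> E))" by auto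
    then show ?case using Union by auto
  qed simp
  obtain B where "B \<in> sets borel" "A = B \<inter> E"
    using assms by (auto simp: sets_\<mu> sets_restrict_space)
  with *[of B] show ?thesis by (simp add: sets_borel)
qed

lemma ext0_measurable:
  assumes "f \<in> borel_measurable \<mu>" shows "ext0 f \<in> borel_measurable BC"
proof (rule measurableI)
  fix A :: "real set" assume A: "A \<in> sets borel"
  have 1: "Some ` {x\<in>E. f x \<in> A} \<in> sets BC"
    using measurable_sets[OF assms A] by (intro Some_image_sets) (simp add: vimage_def Int_def conj_commute)
  have "Some ` E \<in> sets BC" by (rule openin_sets_BC) simp
  then have "space BC - Some ` E \<in> sets BC" by blast
  then have 2: "{None} \<in> sets BC" by (simp add: insert_Diff_if)
  have "ext0 f -` A \<inter> space BC = Some ` {x\<in>E. f x \<in> A} \<union> (if 0 \<in> A then {None} else {})"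
    by (auto simp: ext0_def)
  then show "ext0 f -` A \<inter> space BC \<in> sets BC" by (simp only:) (rule sets.Un[OF 1], use 2 in auto)
qed simp

lemma ext0_X_measurable:
  assumes "f \<in> borel_measurable \<mu>" "0 \<le> t"
  shows "(\<lambda>\<omega>. ext0 f (X t \<omega>)) \<in> borel_measurable (F (ennreal t))"
    and "x \<in> E \<Longrightarrow> (\<lambda>\<omega>. ext0 f (X t \<omega>)) \<in> borel_measurable (P (Some x))"
  using measurable_compose[OF adapted[OF assms(2)] ext0_measurable[OF assms(1)]]
    measurable_compose[OF X_measurable_P[OF Some_in_SC assms(2)] ext0_measurable[OF assms(1)]] by auto

text \<open>Compact support makes the extension by 0 continuous at the cemetery, whose
  neighbourhoods are complements of compact sets; the function can then be composed with the
  path.\<close>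

lemma path_continuous:
  assumes "continuous_on E v" "compact K" "K \<subseteq> E" "\<And>x. x \<in> E \<Longrightarrow> x \<notin> K \<Longrightarrow> v x = 0" "\<omega> \<in> space M"
  shows "continuous_on {0..} (\<lambda>t. ext0 v (X t \<omega>))"
proof -
  have "continuous_map SC euclideanreal (ext0 v)"
    unfolding continuous_map_def
  proof (intro conjI allI impI)
    fix U :: "real set" assume "openin euclideanreal U"
    then have U: "open U" by simp
    show "openin SC {y \<in> topspace SC. ext0 v y \<in> U}"
    proof (cases "0 \<in> U")
      case False
      have "{y \<in> topspace SC. ext0 v y \<in> U} = Some ` (E \<inter> v -` U)"
        using False by (auto simp: ext0_def)
      moreover have "openin (top_of_set E) (E \<inter> v -` U)"
        using continuous_openin_preimage_gen[OF assms(1) U] .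
      ultimately show ?thesis by simp
    next
      case True
      define C where "C = E \<inter> v -` (- U)"
      have eq: "C = K \<inter> v -` (- U)" using assms(3,4) True by (auto simp: C_def) metis
      have Cc: "closedin (top_of_set E) C"
        unfolding C_def using U by (intro continuous_closedin_preimage assms(1)) auto
      have "closedin (top_of_set K) C"
        unfolding eq using U continuous_on_subset[OF assms(1,3)] by (intro continuous_closedin_preimage) auto
      then have "compact C" using assms(2) closedin_compact by blast
      moreover have "C \<subseteq> E" by (auto simp: C_def)
      ultimately have "compactin (top_of_set E) C" by (simp add: compactin_subtopology compactin_euclidean_iff)
      then have "closedin SC (Some ` C)" using Cc by simp
      moreover have "{y \<in> topspace SC. ext0 v y \<in> U} = topspace SC - Some ` C"
        using True by (auto simp: ext0_def C_def)
      ultimately show ?thesis by (metis openin_diff openin_topspace)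
    qed
  qed (auto simp: ext0_def)
  moreover have "continuous_map (top_of_set {0..}) SC (\<lambda>t. X t \<omega>)"
    using associated assms(5) unfolding associated_hunt_process_def by blast
  ultimately have "continuous_map (top_of_set {0..}) euclideanreal (ext0 v \<circ> (\<lambda>t. X t \<omega>))"
    by (rule continuous_map_compose[rotated])
  then show ?thesis by (simp add: o_def)
qed

subsection \<open>The transition operators on bounded square integrable functions\<close>

text \<open>The class on which all descriptions of the transition operators meet: bounded, so that
  the kernel acts pointwise; square integrable, so that \<open>T\<close> acts; and thereby in
  \<open>L\<^sup>r\<close> for some r > d, so that the strong Feller property applies.\<close>

definition good :: "(real^'d \<Rightarrow> real) \<Rightarrow> bool" where
  "good f \<longleftrightarrow> L2 \<mu> f \<and> (\<exists>C. \<forall>x\<in>E. \<bar>f x\<bar> \<le> C)"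

lemma good_L2: "good f \<Longrightarrow> L2 \<mu> f" by (simp add: good_def)

lemma good_meas: "good f \<Longrightarrow> f \<in> borel_measurable \<mu>" by (simp add: good_def L2_def)

lemma good_bound: assumes "good f" obtains C where "C \<ge> 0" "\<And>x. x \<in> E \<Longrightarrow> \<bar>f x\<bar> \<le> C"
proof -
  obtain C where "\<And>x. x \<in> E \<Longrightarrow> \<bar>f x\<bar> \<le> C" using assms by (auto simp: good_def)
  then have "\<And>x. x \<in> E \<Longrightarrow> \<bar>f x\<bar> \<le> \<bar>C\<bar>" by fastforce
  then show thesis using that[of "\<bar>C\<bar>"] by simp
qed

lemma good_dominated:
  assumes "good g" "f \<in> borel_measurable \<mu>" "\<And>x. x \<in> E \<Longrightarrow> \<bar>f x\<bar> \<le> \<bar>g x\<bar>"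
  shows "good f"
proof -
  obtain C where "\<And>x. x \<in> E \<Longrightarrow> \<bar>g x\<bar> \<le> C" by (rule good_bound[OF assms(1)]) (rule that)
  then have "\<And>x. x \<in> E \<Longrightarrow> \<bar>f x\<bar> \<le> C" using assms(3) order_trans by blast
  moreover have "L2 \<mu> f"
    using assms by (intro L2_bound[OF good_L2[OF assms(1)]] AE_I2) auto
  ultimately show ?thesis by (auto simp: good_def)
qed

lemma good_cmult: assumes "good f" shows "good (\<lambda>x. a * f x)"
proof -
  obtain C where C: "\<And>x. x \<in> E \<Longrightarrow> \<bar>f x\<bar> \<le> C" by (rule good_bound[OF assms]) (rule that)
  have "\<bar>a * f x\<bar> \<le> \<bar>a\<bar> * C" if "x \<in> E" for x using C[OF that] by (simp add: abs_mult mult_left_mono)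
  then show ?thesis using L2_cmult[OF good_L2[OF assms]] by (auto simp: good_def)
qed

lemma good_add: assumes "good f" "good g" shows "good (\<lambda>x. f x + g x)"
proof -
  obtain C where C: "\<And>x. x \<in> E \<Longrightarrow> \<bar>f x\<bar> \<le> C" by (rule good_bound[OF assms(1)]) (rule that)
  obtain D where D: "\<And>x. x \<in> E \<Longrightarrow> \<bar>g x\<bar> \<le> D" by (rule good_bound[OF assms(2)]) (rule that)
  have "\<bar>f x + g x\<bar> \<le> C + D" if "x \<in> E" for x using C[OF that] D[OF that] by linarith
  then show ?thesis using L2_add[OF good_L2[OF assms(1)] good_L2[OF assms(2)]] by (auto simp: good_def)
qed


lemma good_test_fun: assumes "u \<in> test_fun E" shows "good u"
proof -
  obtain B where "\<And>x. \<bar>u x\<bar> \<le> B" using test_fun_bounded[OF assms] by blast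
  then show ?thesis using test_fun_L2(1)[OF assms] by (auto simp: good_def)
qed

lemma good_indicator:
  assumes "A \<in> sets \<mu>" "A \<subseteq> K" "compact K" "K \<subseteq> E"
  shows "good (indicator A)"
  unfolding good_def
proof
  show "L2 \<mu> (indicator A)"
    by (rule compact_support_\<mu>(2)[of _ K 1]) (use assms in \<open>auto simp: indicator_def\<close>)
qed (auto intro!: exI[of _ 1] simp: indicator_def)

text \<open>With r = d + 1 \<ge> 2 and C a bound for |f|, |f|^r is at most C^(r-2) f^2.\<close>

lemma good_Lr:
  assumes "good f" shows "f \<in> Lr_fun (real CARD('d) + 1) \<mu>"
proof -
  obtain C where C: "C \<ge> 0" "\<And>x. x \<in> E \<Longrightarrow> \<bar>f x\<bar> \<le> C" by (rule good_bound[OF assms]) (rule that)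
  define r where "r = real CARD('d) + 1"
  have r: "r \<ge> 2" using two_le_dim by (simp add: r_def)
  have fm [measurable]: "f \<in> borel_measurable \<mu>" using assms by (rule good_meas)
  have "integrable \<mu> (\<lambda>x. \<bar>f x\<bar> powr r)"
  proof (rule Bochner_Integration.integrable_bound)
    show "integrable \<mu> (\<lambda>x. C powr (r - 2) * (f x)\<^sup>2)"
      using good_L2[OF assms] by (simp add: L2_def)
    show "AE x in \<mu>. norm (\<bar>f x\<bar> powr r) \<le> norm (C powr (r - 2) * (f x)\<^sup>2)"
    proof (rule AE_I2)
      fix x assume "x \<in> space \<mu>"
      then have x: "\<bar>f x\<bar> \<le> C" using C by simp
      have "\<bar>f x\<bar> powr r = \<bar>f x\<bar> powr (r - 2) * \<bar>f x\<bar> powr 2"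
        using powr_add[of "\<bar>f x\<bar>" "r - 2" 2] by simp
      also have "\<dots> \<le> C powr (r - 2) * \<bar>f x\<bar> powr 2"
        using x r by (intro mult_right_mono powr_mono2) auto
      also have "\<bar>f x\<bar> powr 2 = (f x)\<^sup>2" by (cases "f x = 0") (auto simp: powr_numeral)
      finally show "norm (\<bar>f x\<bar> powr r) \<le> norm (C powr (r - 2) * (f x)\<^sup>2)" by simp
    qed
  qed measurable
  then show ?thesis using fm by (simp add: Lr_fun_def r_def)
qed

lemma Pt_cont:
  assumes "good f" "t > 0" shows "continuous_on E (Pt t f)"
proof -
  have "\<forall>r t f. real CARD('d) < r \<and> 0 < t \<and> f \<in> Lr_fun r \<mu> \<longrightarrow>
      (\<forall>x\<in>E. integrable (P (Some x)) (\<lambda>\<omega>. ext0 f (X t \<omega>))) \<and> continuous_on E (Pt t f)"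
    using associated unfolding associated_hunt_process_def by (elim conjE)
  then show ?thesis using good_Lr[OF assms(1)] assms(2) by (metis less_add_one)
qed

lemma X_cases:
  assumes "x \<in> E" "0 \<le> t" "\<omega> \<in> space (P (Some x))"
  obtains "X t \<omega> = None" | y where "y \<in> E" "X t \<omega> = Some y"
  using X_topspace[OF assms(2), of \<omega>] assms space_P[OF Some_in_SC] by auto

lemma ext0_bound:
  assumes "x \<in> E" "0 \<le> t" "\<omega> \<in> space (P (Some x))" "\<And>y. y \<in> E \<Longrightarrow> \<bar>f y\<bar> \<le> C" "C \<ge> 0"
  shows "\<bar>ext0 f (X t \<omega>)\<bar> \<le> C"
  by (rule X_cases[OF assms(1-3)]) (use assms(4,5) in \<open>auto simp: ext0_def\<close>)

lemma Pt_integrable: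
  assumes "f \<in> borel_measurable \<mu>" "\<And>y. y \<in> E \<Longrightarrow> \<bar>f y\<bar> \<le> C" "C \<ge> 0" "x \<in> E" "0 \<le> t"
  shows "integrable (P (Some x)) (\<lambda>\<omega>. ext0 f (X t \<omega>))"
proof -
  interpret prob_space "P (Some x)" by (rule prob_space_P[OF Some_in_SC[OF assms(4)]])
  show ?thesis
    using ext0_X_measurable(2)[OF assms(1,5,4)] ext0_bound[OF assms(4,5) _ assms(2,3)]
    by (intro integrable_const_bound[where B=C] AE_I2) auto
qed

lemma good_Pt_integrable:
  assumes "good f" "x \<in> E" "0 \<le> t" shows "integrable (P (Some x)) (\<lambda>\<omega>. ext0 f (X t \<omega>))"
  using good_bound[OF assms(1)] Pt_integrable[OF good_meas[OF assms(1)] _ _ assms(2,3)] by metis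

lemma Pt_bound:
  assumes "good f" "\<And>y. y \<in> E \<Longrightarrow> \<bar>f y\<bar> \<le> C" "C \<ge> 0" "x \<in> E" "0 \<le> t"
  shows "\<bar>Pt t f x\<bar> \<le> C"
proof -
  interpret prob_space "P (Some x)" by (rule prob_space_P[OF Some_in_SC[OF assms(4)]])
  have "norm (LINT \<omega>|P (Some x). ext0 f (X t \<omega>)) \<le> (LINT \<omega>|P (Some x). C)"
    using good_Pt_integrable[OF assms(1,4,5)] ext0_bound[OF assms(4,5) _ assms(2,3)]
    by (intro order_trans[OF integral_norm_bound] integral_mono) auto
  then show ?thesis by (simp add: transition_def prob_space)
qed

lemma ext0_lin: "ext0 (\<lambda>x. a * f x + b * g x) y = a * ext0 f y + b * ext0 g y"
  by (cases y) (auto simp: ext0_def)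

lemma Pt_lin:
  assumes "good f" "good g" "x \<in> E" "0 \<le> t"
  shows "Pt t (\<lambda>y. a * f y + b * g y) x = a * Pt t f x + b * Pt t g x"
  using good_Pt_integrable[OF assms(1,3,4)] good_Pt_integrable[OF assms(2,3,4)]
  by (simp add: transition_def ext0_lin)

lemma Pt_mono:
  assumes "good f" "good g" "x \<in> E" "0 \<le> t" "\<And>y. y \<in> E \<Longrightarrow> f y \<le> g y"
  shows "Pt t f x \<le> Pt t g x"
  unfolding transition_def
proof (rule integral_mono[OF good_Pt_integrable[OF assms(1,3,4)] good_Pt_integrable[OF assms(2,3,4)]])
  fix \<omega> assume \<omega>: "\<omega> \<in> space (P (Some x))"
  show "ext0 f (X t \<omega>) \<le> ext0 g (X t \<omega>)"
    by (rule X_cases[OF assms(3,4) \<omega>]) (use assms(5) in \<open>auto simp: ext0_def\<close>)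
qed

lemma Pt_lim:
  assumes "\<And>n. good (f n)" "good g" "good f'" "\<And>n y. y \<in> E \<Longrightarrow> \<bar>f n y\<bar> \<le> \<bar>g y\<bar>"
    "\<And>y. y \<in> E \<Longrightarrow> (\<lambda>n. f n y) \<longlonglongrightarrow> f' y" "x \<in> E" "0 \<le> t"
  shows "(\<lambda>n. Pt t (f n) x) \<longlonglongrightarrow> Pt t f' x"
  unfolding transition_def
proof (rule integral_dominated_convergence)
  show "integrable (P (Some x)) (\<lambda>\<omega>. \<bar>ext0 g (X t \<omega>)\<bar>)"
    using good_Pt_integrable[OF assms(2,6,7)] by simp
  show "AE \<omega> in P (Some x). (\<lambda>n. ext0 (f n) (X t \<omega>)) \<longlonglongrightarrow> ext0 f' (X t \<omega>)"
  proof (rule AE_I2)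
    fix \<omega> assume \<omega>: "\<omega> \<in> space (P (Some x))"
    show "(\<lambda>n. ext0 (f n) (X t \<omega>)) \<longlonglongrightarrow> ext0 f' (X t \<omega>)"
      by (rule X_cases[OF assms(6,7) \<omega>]) (use assms(5) in \<open>auto simp: ext0_def\<close>)
  qed
  show "AE \<omega> in P (Some x). norm (ext0 (f n) (X t \<omega>)) \<le> \<bar>ext0 g (X t \<omega>)\<bar>" for n
  proof (rule AE_I2)
    fix \<omega> assume \<omega>: "\<omega> \<in> space (P (Some x))"
    show "norm (ext0 (f n) (X t \<omega>)) \<le> \<bar>ext0 g (X t \<omega>)\<bar>"
      by (rule X_cases[OF assms(6,7) \<omega>]) (use assms(4) in \<open>auto simp: ext0_def\<close>)
  qed
qed (use assms ext0_X_measurable(2) good_meas in auto)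

text \<open>Measurability of \<open>Pt t f\<close> comes from its continuity, hence t > 0; square
  integrability is inherited from \<open>T t f\<close>.\<close>

lemma good_Pt: assumes "good f" "t > 0" shows "good (Pt t f)"
proof -
  obtain C where C: "C \<ge> 0" "\<And>x. x \<in> E \<Longrightarrow> \<bar>f x\<bar> \<le> C" by (rule good_bound[OF assms(1)]) (rule that)
  have m: "Pt t f \<in> borel_measurable \<mu>" by (rule cont_imp_meas_\<mu>[OF Pt_cont[OF assms]])
  have "AE x in \<mu>. Pt t f x = T t f x" using assms by (intro T_associated(2) good_L2) auto
  then have "AE x in \<mu>. T t f x = Pt t f x" by eventually_elim simp
  then have "L2 \<mu> (Pt t f)"
    using assms by (intro L2_cong_AE[OF L2_T m]) (auto intro: good_L2)
  then show ?thesis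
    using Pt_bound[OF assms(1) C(2,1)] assms(2) by (auto simp: good_def intro!: exI[of _ C])
qed

lemma ip_Pt: assumes "good f" "t > 0" "L2 \<mu> g" shows "ip \<mu> (Pt t f) g = ip \<mu> (T t f) g"
  using assms good_L2[OF assms(1)] good_L2[OF good_Pt[OF assms(1,2)]]
  by (intro ip_cong_AE T_associated(2) L2_measurable L2_T) auto

lemma markov_good:
  assumes "x \<in> E" "0 \<le> s" "0 < h" "G \<in> sets (F (ennreal s))" "good f" "\<And>y. y \<in> E \<Longrightarrow> 0 \<le> f y"
  shows "(LINT \<omega>|P (Some x). indicator G \<omega> * ext0 f (X (s + h) \<omega>)) =
    (LINT \<omega>|P (Some x). indicator G \<omega> * ext0 (Pt h f) (X s \<omega>))"
proof -
  interpret prob_space "P (Some x)" by (rule prob_space_P[OF Some_in_SC[OF assms(1)]])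
  obtain C where C: "C \<ge> 0" "\<And>x. x \<in> E \<Longrightarrow> \<bar>f x\<bar> \<le> C" by (rule good_bound[OF assms(5)]) (rule that)
  have spP: "space (P (Some x)) = space M" by (rule space_P[OF Some_in_SC[OF assms(1)]])
  have e0: "0 \<le> ext0 f y" if "y \<in> topspace SC" for y using that assms(6) by (auto simp: ext0_def)
  have GP: "G \<in> sets (P (Some x))" using assms(4) sets_F_le sets_P[OF Some_in_SC[OF assms(1)]] by auto
  \<comment> \<open>At the cemetery both sides vanish because it is absorbing; at a proper state the
    kernel is \<open>Pt h f\<close> by definition.\<close>
  have ker: "(\<integral>\<^sup>+\<omega>. ennreal (ext0 f (X h \<omega>)) \<partial>P y) = ennreal (ext0 (Pt h f) y)" if y: "y \<in> topspace SC" for y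
  proof (cases y)
    case None
    have "AE \<omega> in P None. X 0 \<omega> = None" using y None start by simp
    then have "AE \<omega> in P None. X h \<omega> = None"
      using AE_space
    proof eventually_elim
      case (elim \<omega>)
      then show ?case using cemetery[of \<omega> 0 h] assms(3) space_P[OF y] None by simp
    qed
    then have "AE \<omega> in P None. ennreal (ext0 f (X h \<omega>)) = 0" by eventually_elim (simp add: ext0_def)
    then have "(\<integral>\<^sup>+\<omega>. ennreal (ext0 f (X h \<omega>)) \<partial>P None) = (\<integral>\<^sup>+\<omega>. 0 \<partial>P None)" by (rule nn_integral_cong_AE)
    then show ?thesis by (simp add: None ext0_def)
  next
    case (Some z)
    then have z: "z \<in> E" using y by auto
    have "(\<integral>\<^sup>+\<omega>. ennreal (ext0 f (X h \<omega>)) \<partial>P (Some z)) = ennreal (LINT \<omega>|P (Some z). ext0 f (X h \<omega>))"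
      using assms(3) e0 X_topspace[of h] space_P[OF Some_in_SC[OF z]]
      by (intro nn_integral_eq_integral good_Pt_integrable[OF assms(5) z] AE_I2) auto
    then show ?thesis by (simp add: Some ext0_def transition_def)
  qed
  have i1: "integrable (P (Some x)) (\<lambda>\<omega>. indicator G \<omega> * ext0 f (X (s + h) \<omega>))"
    using assms GP integrable_mult_indicator[OF GP good_Pt_integrable[OF assms(5,1), of "s + h"]] by simp
  have i2: "integrable (P (Some x)) (\<lambda>\<omega>. indicator G \<omega> * ext0 (Pt h f) (X s \<omega>))"
    using integrable_mult_indicator[OF GP good_Pt_integrable[OF good_Pt[OF assms(5,3)] assms(1,2)]] by simp
  have Pt0: "0 \<le> ext0 (Pt h f) y" if "y \<in> topspace SC" for y
  proof -
    have "0 \<le> Pt h f z" if "z \<in> E" for z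
      unfolding transition_def using e0 X_topspace[of h] assms(3) space_P[OF Some_in_SC[OF that]]
      by (intro Bochner_Integration.integral_nonneg_AE AE_I2) auto
    then show ?thesis using that by (auto simp: ext0_def)
  qed
  have "ennreal (LINT \<omega>|P (Some x). indicator G \<omega> * ext0 f (X (s + h) \<omega>)) =
      (\<integral>\<^sup>+\<omega>. ennreal (indicator G \<omega> * ext0 f (X (s + h) \<omega>)) \<partial>P (Some x))"
    using e0 X_topspace[of "s + h"] assms(2,3)
    by (intro nn_integral_eq_integral[symmetric] i1 AE_I2 mult_nonneg_nonneg) (auto simp: spP)
  also have "\<dots> = (\<integral>\<^sup>+\<omega>. indicator G \<omega> * ennreal (ext0 f (X (s + h) \<omega>)) \<partial>P (Some x))"
    by (intro nn_integral_cong) (simp add: indicator_def)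
  also have "\<dots> = (\<integral>\<^sup>+\<omega>. indicator G \<omega> * (\<integral>\<^sup>+\<omega>'. ennreal (ext0 f (X h \<omega>')) \<partial>P (X s \<omega>)) \<partial>P (Some x))"
    using assms ext0_measurable[OF good_meas[OF assms(5)]]
    by (intro markov_nn_integral[of "Some x" s h G "\<lambda>y. ennreal (ext0 f y)"]) auto
  also have "\<dots> = (\<integral>\<^sup>+\<omega>. ennreal (indicator G \<omega> * ext0 (Pt h f) (X s \<omega>)) \<partial>P (Some x))"
    using X_topspace[OF assms(2)] by (intro nn_integral_cong) (simp add: ker spP indicator_def del: topspace_Alexandroff_compactification)
  also have "\<dots> = ennreal (LINT \<omega>|P (Some x). indicator G \<omega> * ext0 (Pt h f) (X s \<omega>))"
    using Pt0 X_topspace[OF assms(2)]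
    by (intro nn_integral_eq_integral i2 AE_I2 mult_nonneg_nonneg) (auto simp: spP)
  finally show ?thesis
    using e0 Pt0 X_topspace[of "s + h"] X_topspace[of s] assms(2,3)
    by (subst (asm) ennreal_inj) (auto intro!: Bochner_Integration.integral_nonneg_AE AE_I2 mult_nonneg_nonneg simp: spP
      simp del: topspace_Alexandroff_compactification)
qed

lemma test_fun_generator:
  assumes "u \<in> test_fun E"
  obtains g where "semigroup_generator \<mu> T u g" "\<And>v. v \<in> test_fun E \<Longrightarrow> form u v = - ip \<mu> g v"
proof -
  obtain g where g: "has_generator u g" using test_fun_has_generator[OF assms] by blast
  have "semigroup_generator \<mu> T u g"
    using form_generator_test_fun[OF assms g] T_associated(1) by (simp add: form_semigroup_def)
  with g show thesis by (intro that) (auto simp: has_generator_def)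
qed

lemma T_dissipation:
  assumes "u \<in> test_fun E" "h \<ge> 0"
  shows "nsq \<mu> u - ip \<mu> u (T h u) \<le> h * form u u"
proof -
  obtain g where g: "semigroup_generator \<mu> T u g" "\<And>v. v \<in> test_fun E \<Longrightarrow> form u v = - ip \<mu> g v"
    using test_fun_generator[OF assms(1)] by blast
  show ?thesis using dissipation_bound[OF g(1) assms(2)] g(2)[OF assms(1)] by (simp add: ip_commute)
qed

subsection \<open>Symmetry of the transition operators\<close>

text \<open>Symmetry of the operators \<open>T\<close> is only known on the generator domain.
  Putting the kernel on \<open>f\<close> and \<open>T\<close> on a fixed test function gives an
  identity stable under dominated limits in \<open>f\<close>, which can therefore be spread from
  test functions to nonnegative \<open>good\<close> functions.\<close>

definition sym_at :: "real \<Rightarrow> (real^'d \<Rightarrow> real) \<Rightarrow> (real^'d \<Rightarrow> real) \<Rightarrow> bool" where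
  "sym_at h u f \<longleftrightarrow> ip \<mu> (Pt h f) u = ip \<mu> f (T h u)"

lemma sym_at_lin:
  assumes "u \<in> test_fun E" "h > 0" "good f" "good g" "sym_at h u f" "sym_at h u g"
  shows "sym_at h u (\<lambda>x. a * f x + b * g x)"
proof -
  have L: "L2 \<mu> u" "L2 \<mu> f" "L2 \<mu> g" "L2 \<mu> (Pt h f)" "L2 \<mu> (Pt h g)" "L2 \<mu> (T h u)"
    using assms(2) test_fun_L2(1)[OF assms(1)] good_L2[OF assms(3)] good_L2[OF assms(4)]
      good_L2[OF good_Pt[OF assms(3,2)]] good_L2[OF good_Pt[OF assms(4,2)]] L2_T[of h u] by auto
  have "ip \<mu> (Pt h (\<lambda>x. a * f x + b * g x)) u = ip \<mu> (\<lambda>x. a * Pt h f x + b * Pt h g x) u"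
    unfolding ip_def using assms
    by (intro Bochner_Integration.integral_cong) (auto simp: Pt_lin)
  also have "\<dots> = a * ip \<mu> (Pt h f) u + b * ip \<mu> (Pt h g) u"
    using L by (simp add: ip_add_left L2_cmult ip_cmult_left)
  also have "\<dots> = ip \<mu> (\<lambda>x. a * f x + b * g x) (T h u)"
    using L assms(5,6) by (simp add: ip_add_left L2_cmult ip_cmult_left sym_at_def)
  finally show ?thesis by (simp add: sym_at_def)
qed

text \<open>Dominated convergence is used on the left through the kernel and the integrability of
  \<open>u\<close>, on the right through square integrable domination. This stands in for the
  density of test functions in \<open>L\<^sup>2\<close>.\<close>

lemma sym_at_lim:
  assumes u: "u \<in> test_fun E" "h > 0" and f: "\<And>n. good (f n)" "good g" "f' \<in> borel_measurable \<mu>"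
    and le: "\<And>n y. y \<in> E \<Longrightarrow> \<bar>f n y\<bar> \<le> \<bar>g y\<bar>" and lim: "\<And>y. y \<in> E \<Longrightarrow> (\<lambda>n. f n y) \<longlonglongrightarrow> f' y"
    and sym: "\<And>n. sym_at h u (f n)"
  shows "good f'" "sym_at h u f'"
proof -
  have le': "\<bar>f' y\<bar> \<le> \<bar>g y\<bar>" if "y \<in> E" for y
    using tendsto_rabs[OF lim[OF that]] by (rule LIMSEQ_le_const2) (use le[OF that] in auto)
  then show f'g: "good f'" by (intro good_dominated[OF f(2,3)])
  obtain C where C: "C \<ge> 0" "\<And>x. x \<in> E \<Longrightarrow> \<bar>g x\<bar> \<le> C" by (rule good_bound[OF f(2)]) (rule that)
  have um [measurable]: "u \<in> borel_measurable \<mu>" and Tm [measurable]: "T h u \<in> borel_measurable \<mu>"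
    and fm [measurable]: "\<And>n. f n \<in> borel_measurable \<mu>" "f' \<in> borel_measurable \<mu>" "g \<in> borel_measurable \<mu>"
    and Pm [measurable]: "\<And>n. Pt h (f n) \<in> borel_measurable \<mu>" "Pt h f' \<in> borel_measurable \<mu>"
    using u f(3) good_meas[OF good_test_fun[OF u(1)]] L2_measurable[OF L2_T[OF _ test_fun_L2(1)[OF u(1)]], of h]
      good_meas[OF f(1)] good_meas[OF f(2)] good_meas[OF good_Pt[OF f(1) u(2)]] good_meas[OF good_Pt[OF f'g u(2)]] by auto
  have 1: "(\<lambda>n. ip \<mu> (Pt h (f n)) u) \<longlonglongrightarrow> ip \<mu> (Pt h f') u"
    unfolding ip_def
  proof (rule integral_dominated_convergence[where w="\<lambda>x. C * \<bar>u x\<bar>"])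
    show "AE x in \<mu>. (\<lambda>n. Pt h (f n) x * u x) \<longlonglongrightarrow> Pt h f' x * u x"
      using u by (intro AE_I2 tendsto_intros Pt_lim[OF f(1,2) f'g le lim]) auto
    show "AE x in \<mu>. norm (Pt h (f n) x * u x) \<le> C * \<bar>u x\<bar>" for n
    proof (rule AE_I2)
      fix x assume "x \<in> space \<mu>"
      then have "\<bar>Pt h (f n) x\<bar> \<le> C"
        using u C le by (intro Pt_bound f) (auto intro: order_trans)
      then show "norm (Pt h (f n) x * u x) \<le> C * \<bar>u x\<bar>" by (simp add: abs_mult mult_right_mono)
    qed
    show "integrable \<mu> (\<lambda>x. C * \<bar>u x\<bar>)" using test_fun_L2(2)[OF u(1)] by simp
  qed measurable
  have 2: "(\<lambda>n. ip \<mu> (f n) (T h u)) \<longlonglongrightarrow> ip \<mu> f' (T h u)"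
    unfolding ip_def
  proof (rule integral_dominated_convergence[where w="\<lambda>x. \<bar>g x * T h u x\<bar>"])
    show "AE x in \<mu>. (\<lambda>n. f n x * T h u x) \<longlonglongrightarrow> f' x * T h u x"
      using lim by (intro AE_I2 tendsto_intros) auto
    show "AE x in \<mu>. norm (f n x * T h u x) \<le> \<bar>g x * T h u x\<bar>" for n
      using le by (intro AE_I2) (auto simp: abs_mult intro!: mult_right_mono)
    show "integrable \<mu> (\<lambda>x. \<bar>g x * T h u x\<bar>)"
      using u(2) by (intro integrable_abs L2_integrable_mult good_L2[OF f(2)] L2_T test_fun_L2(1)[OF u(1)]) auto
  qed measurable
  have "ip \<mu> (Pt h (f n)) u = ip \<mu> (f n) (T h u)" for n using sym by (simp add: sym_at_def)
  with 1 2 show "sym_at h u f'" unfolding sym_at_def using LIMSEQ_unique by auto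
qed

lemma sym_at_test_fun:
  assumes "u \<in> test_fun E" "h > 0" "f \<in> test_fun E"
  shows "sym_at h u f"
proof -
  obtain g where g: "semigroup_generator \<mu> T u g" using test_fun_generator[OF assms(1)] by blast
  obtain k where k: "semigroup_generator \<mu> T f k" using test_fun_generator[OF assms(3)] by blast
  have "ip \<mu> (Pt h f) u = ip \<mu> (T h f) u"
    using assms by (intro ip_Pt good_test_fun test_fun_L2)
  with symmetric_on_domain[OF k g, of h] assms(2) show ?thesis by (simp add: sym_at_def)
qed

lemma sym_at_zero: "sym_at h u (\<lambda>_. 0)"
proof -
  have "ext0 (\<lambda>_. 0) y = 0" for y :: "(real^'d) option" by (cases y) (simp_all add: ext0_def)
  then show ?thesis by (simp add: sym_at_def ip_def transition_def)
qed

lemma sym_at_box: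
  assumes u: "u \<in> test_fun E" "h > 0" and ab: "cbox a b \<subseteq> E"
  shows "sym_at h u (indicator (box a b))"
proof (rule sym_at_lim(2)[OF u, of "\<lambda>n x. 1 - exp (- real n * bump a b x)" "indicator (cbox a b)"])
  have t: "(\<lambda>x. 1 - exp (- real n * bump a b x)) \<in> test_fun E" for n
    by (rule one_minus_exp_bump_test_fun[OF ab])
  show "good (\<lambda>x. 1 - exp (- real n * bump a b x))" "sym_at h u (\<lambda>x. 1 - exp (- real n * bump a b x))" for n
    using t u by (auto intro: good_test_fun sym_at_test_fun)
  show "good (indicator (cbox a b))"
    by (rule good_indicator[of _ "cbox a b"]) (use ab emeasure_\<mu>_compact(2)[of "cbox a b"] in auto)
  show "indicator (box a b) \<in> borel_measurable \<mu>"
    by (intro borel_imp_meas_\<mu> borel_measurable_indicator) simp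
  show "\<bar>1 - exp (- real n * bump a b y)\<bar> \<le> \<bar>indicator (cbox a b) y\<bar>" for n y
    using bump_nonneg[of a b y] by (cases "y \<in> cbox a b") (auto simp: bump_eq_0_cbox)
  show "(\<lambda>n. 1 - exp (- real n * bump a b y)) \<longlonglongrightarrow> indicator (box a b) y" for y
    by (rule box_indicator_limit)
qed

text \<open>Open boxes generate the Borel sets and are stable under intersection. Cutting everything
  to one fixed box inside \<open>E\<close> keeps all measures finite, so that complements and
  countable disjoint unions stay in the class.\<close>

lemma sym_at_indicator:
  assumes u: "u \<in> test_fun E" "h > 0" and ab: "cbox a b \<subseteq> E" and A: "A \<in> sets borel"
  shows "sym_at h u (indicator (A \<inter> box a b))" "good (indicator (A \<inter> box a b))"
proof -
  have good: "good (indicator (A \<inter> box a b))" if "A \<in> sets borel" for A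
    by (rule good_indicator[of _ "cbox a b"])
       (use that ab box_subset_cbox[of a b] in \<open>auto simp: sets_\<mu> sets_restrict_space_iff\<close>)
  then show "good (indicator (A \<inter> box a b))" using A .
  have "Int_stable (range (\<lambda>(a::real^'d, b). box a b))"
    by (auto simp: Int_stable_def box_Int_box)
  moreover have "range (\<lambda>(a::real^'d, b). box a b) \<subseteq> Pow UNIV" by simp
  moreover have "A \<in> sigma_sets UNIV (range (\<lambda>(a, b). box a b))"
    using A unfolding borel_eq_box by simp
  ultimately show "sym_at h u (indicator (A \<inter> box a b))"
  proof (induction rule: sigma_sets_induct_disjoint)
    case (basic A)
    then obtain a' b' where A: "A = box a' b'" by auto
    obtain a'' b'' where eq: "box a' b' \<inter> box a b = box a'' b''" by (rule that[OF box_Int_box])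
    show ?case
    \<comment> \<open>The empty case is split off because an empty open box may have a nonempty
      closed box; for a nonempty one the closed box is the closure and so remains inside
      \<open>E\<close>.\<close>
    proof (cases "box a'' b'' = {}")
      case True
      then show ?thesis
        using sym_at_zero
        by (simp add: A eq)
    next
      case False
      then have "cbox a'' b'' = closure (box a'' b'')" by simp
      also have "\<dots> \<subseteq> closure (box a b)" unfolding eq[symmetric] by (intro closure_mono) auto
      also have "\<dots> \<subseteq> cbox a b" by (intro closure_minimal box_subset_cbox closed_cbox)
      finally show ?thesis unfolding A eq using ab by (intro sym_at_box u) auto
    qed
  next
    case empty
    then show ?case
      using sym_at_zero
      by simp
  next
    case (compl A)
    have As: "A \<in> sets borel" using compl unfolding borel_eq_box by simp
    have "sym_at h u (\<lambda>x. 1 * indicator (UNIV \<inter> box a b) x + (-1) * indicator (A \<inter> box a b) x)"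
      using compl As good[of UNIV] good[OF As] sym_at_box[OF u ab] by (intro sym_at_lin u) auto
    moreover have "(\<lambda>x. 1 * indicator (UNIV \<inter> box a b) x + (-1) * indicator (A \<inter> box a b) x) = (indicator ((UNIV - A) \<inter> box a b) :: _ \<Rightarrow> real)"
      by (auto simp: indicator_def fun_eq_iff)
    ultimately show ?case by simp
  next
    case (union A)
    have As: "A i \<in> sets borel" for i using union unfolding borel_eq_box by auto
    define f where "f n x = (\<Sum>i<n. indicator (A i \<inter> box a b) x :: real)" for n x
    have fi: "f n = indicator ((\<Union>i<n. A i) \<inter> box a b)" for n
    proof (rule ext)
      fix x
      have "(\<Sum>i<n. indicator (A i) x :: real) = indicator (\<Union>i<n. A i) x"
        using union(1) by (intro indicator_UN_disjoint[symmetric]) (auto simp: disjoint_family_on_def)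
      then show "f n x = indicator ((\<Union>i<n. A i) \<inter> box a b) x"
        by (simp add: f_def indicator_inter_arith flip: sum_distrib_right)
    qed
    have "sym_at h u (f n) \<and> good (f n)" for n
    proof (induction n)
      case 0
      then show ?case
        using sym_at_zero
          good_cmult[OF good_test_fun[OF u(1)], of 0]
        by (simp add: f_def)
    next
      case (Suc n)
      have "sym_at h u (\<lambda>x. 1 * f n x + 1 * indicator (A n \<inter> box a b) x)"
        by (rule sym_at_lin[OF u]) (use Suc good[OF As] union(3) in auto)
      moreover have "good (\<lambda>x. f n x + indicator (A n \<inter> box a b) x)"
        by (rule good_add) (use Suc good[OF As] in auto)
      moreover have "f (Suc n) = (\<lambda>x. f n x + indicator (A n \<inter> box a b) x)"
        by (simp add: f_def[abs_def])
      ultimately show ?case by simp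
    qed
    note sg = this
    show ?case
    proof (rule sym_at_lim(2)[OF u, of f "indicator (UNIV \<inter> box a b)"])
      show "good (f n)" "sym_at h u (f n)" for n using sg by auto
      show "(\<lambda>n. f n y) \<longlonglongrightarrow> indicator (\<Union> (range A) \<inter> box a b) y" for y
        unfolding fi indicator_inter_arith by (intro tendsto_mult LIMSEQ_indicator_UN tendsto_const)
      show "\<bar>f n y\<bar> \<le> \<bar>indicator (UNIV \<inter> box a b) y\<bar>" for n y
        unfolding fi by (auto simp: indicator_def)
      show "indicator (\<Union> (range A) \<inter> box a b) \<in> borel_measurable \<mu>"
        using As by (intro borel_imp_meas_\<mu> borel_measurable_indicator) auto
    qed (use good[of UNIV] in auto)
  qed
qed

lemma good_mult_indicator:
  assumes "good f" "A \<in> sets borel" shows "good (\<lambda>x. f x * indicator A x)"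
proof (rule good_dominated[OF assms(1)])
  show "(\<lambda>x. f x * indicator A x) \<in> borel_measurable \<mu>"
    using assms by (intro borel_measurable_times good_meas borel_imp_meas_\<mu> borel_measurable_indicator)
qed (auto simp: indicator_def)

lemma sym_at_nonneg:
  assumes u: "u \<in> test_fun E" "h > 0" and ab: "cbox a b \<subseteq> E"
    and f: "f \<in> borel_measurable \<mu>" "\<And>x. 0 \<le> f x" "\<And>x. x \<in> E \<Longrightarrow> f x \<le> C"
  shows "sym_at h u (\<lambda>x. f x * indicator (box a b) x)"
proof -
  have good_box: "good (indicator (box a b))"
    using sym_at_indicator(2)[OF u ab, of UNIV] by simp
  have good: "good (\<lambda>x. g x * indicator (box a b) x)" if "g \<in> borel_measurable \<mu>" "\<And>x. 0 \<le> g x" "\<And>x. x \<in> E \<Longrightarrow> g x \<le> C" for g C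
  proof (rule good_dominated[OF good_cmult[OF good_box, of C]])
    show "(\<lambda>x. g x * indicator (box a b) x) \<in> borel_measurable \<mu>"
      using that good_meas[OF good_box] by (intro borel_measurable_times)
    show "\<bar>g x * indicator (box a b) x\<bar> \<le> \<bar>C * indicator (box a b) x\<bar>" if "x \<in> E" for x
      using \<open>\<And>x. 0 \<le> g x\<close>[of x] \<open>\<And>x. x \<in> E \<Longrightarrow> g x \<le> C\<close>[OF that] by (auto simp: indicator_def)
  qed
  \<comment> \<open>Boundedness is put into the induction formula, because the pieces that arise in
    the induction need bounds of their own.\<close>
  have "(\<exists>C. \<forall>x\<in>E. f x \<le> C) \<longrightarrow> sym_at h u (\<lambda>x. f x * indicator (box a b) x)"
    using f(1,2)
  proof (induction f rule: borel_measurable_induct_real)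
    case (set A)
    then obtain B where B: "B \<in> sets borel" "A = B \<inter> E" by (auto simp: sets_\<mu> sets_restrict_space)
    have "box a b \<subseteq> E" using ab box_subset_cbox by blast
    then have "(\<lambda>x. indicator A x * indicator (box a b) x :: real) = indicator (B \<inter> box a b)"
      unfolding B(2) by (auto simp: indicator_def fun_eq_iff)
    then show ?case using sym_at_indicator(1)[OF u ab B(1)] by simp
  next
    case (mult f c)
    show ?case
    proof (cases "c = 0")
      case True
      then show ?thesis
        using sym_at_zero
        by simp
    next
      case False
      show ?thesis
      proof (intro impI)
        assume "\<exists>C. \<forall>x\<in>E. c * f x \<le> C"
        then obtain C where "\<And>x. x \<in> E \<Longrightarrow> c * f x \<le> C" by blast
        then have C: "\<And>x. x \<in> E \<Longrightarrow> f x \<le> C / c" using False mult.hyps(1) by (simp add: field_simps less_le)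
        then have "sym_at h u (\<lambda>x. f x * indicator (box a b) x)" using mult.IH by blast
        from sym_at_lin[OF u good[OF mult.hyps(2,3) C] good[OF mult.hyps(2,3) C] this this, of c 0]
        show "sym_at h u (\<lambda>x. c * f x * indicator (box a b) x)" by (simp add: mult.assoc)
      qed
    qed
  next
    case (add v f)
    show ?case
    proof (intro impI)
      assume "\<exists>C. \<forall>x\<in>E. f x + v x \<le> C"
      then obtain C where "\<And>x. x \<in> E \<Longrightarrow> f x + v x \<le> C" by blast
      then have C: "\<And>x. x \<in> E \<Longrightarrow> f x \<le> C" "\<And>x. x \<in> E \<Longrightarrow> v x \<le> C"
        using add.hyps by (smt (verit))+
      then have s: "sym_at h u (\<lambda>x. f x * indicator (box a b) x)" "sym_at h u (\<lambda>x. v x * indicator (box a b) x)"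
        using add.IH by blast+
      have g: "good (\<lambda>x. f x * indicator (box a b) x)" "good (\<lambda>x. v x * indicator (box a b) x)"
        using add.hyps C by (auto intro!: good)
      from sym_at_lin[OF u g s, of 1 1]
      show "sym_at h u (\<lambda>x. (f x + v x) * indicator (box a b) x)" by (simp add: distrib_right)
    qed
  next
    case (seq U)
    show ?case
    proof (intro impI)
      assume "\<exists>C. \<forall>x\<in>E. f x \<le> C"
      then obtain C where C: "\<And>x. x \<in> E \<Longrightarrow> f x \<le> C" by blast
      have Uf: "U i x \<le> f x" if "x \<in> E" for i x
        using seq.hyps that by (intro incseq_le[of "\<lambda>i. U i x"]) (auto simp: incseq_def le_fun_def)
      then have UC: "U i x \<le> C" if "x \<in> E" for i x using C that order_trans by blast
      then have s: "sym_at h u (\<lambda>x. U i x * indicator (box a b) x)" for i using seq.IH by blast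
      show "sym_at h u (\<lambda>x. f x * indicator (box a b) x)"
      proof (rule sym_at_lim(2)[OF u, of "\<lambda>i x. U i x * indicator (box a b) x" "\<lambda>x. f x * indicator (box a b) x"])
        show "good (\<lambda>x. U i x * indicator (box a b) x)" for i
          using seq.hyps UC by (intro good) auto
        show "good (\<lambda>x. f x * indicator (box a b) x)" using f(1,2) C by (intro good) 
        then show "(\<lambda>x. f x * indicator (box a b) x) \<in> borel_measurable \<mu>" by (rule good_meas)
        show "\<bar>U i x * indicator (box a b) x\<bar> \<le> \<bar>f x * indicator (box a b) x\<bar>" if "x \<in> E" for i x
          using Uf[OF that, of i] seq.hyps(2)[of i x] f(2)[of x] by (auto simp: indicator_def)
        show "(\<lambda>i. U i x * indicator (box a b) x) \<longlonglongrightarrow> f x * indicator (box a b) x" if "x \<in> E" for x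
          using seq.hyps that by (intro tendsto_intros) auto
      qed (use s in auto)
    qed
  qed
  with f(3) show ?thesis by blast
qed

lemma countable_boxes:
  obtains a b :: "nat \<Rightarrow> real^'d" where "\<And>m. cbox (a m) (b m) \<subseteq> E" "E = (\<Union>m. box (a m) (b m))"
proof -
  define \<F> where "\<F> = {box a b |a b. cbox a b \<subseteq> E}"
  obtain \<F>' where F': "\<F>' \<subseteq> \<F>" "countable \<F>'" "\<Union>\<F>' = \<Union>\<F>"
    by (rule Lindelof[of \<F>]) (auto simp: \<F>_def)
  have "cbox (1::real^'d) 0 = {}"
  proof -
    have False if "x \<in> cbox (1::real^'d) 0" for x
    proof -
      have "1 \<le> x $ i \<and> x $ i \<le> 0" for i using that by (simp add: mem_box_cart)
      then show False by (meson not_one_le_zero order_trans)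
    qed
    then show ?thesis by blast
  qed
  then have "box (1::real^'d) 0 = {}" "cbox (1::real^'d) 0 \<subseteq> E" using box_subset_cbox by blast+
  \<comment> \<open>The empty box keeps the family nonempty, so that it is the range of a sequence
    even when \<open>E\<close> is empty.\<close>
  then have "{} \<in> \<F>" unfolding \<F>_def by blast
  have "E \<subseteq> \<Union>\<F>"
  proof
    fix x assume "x \<in> E"
    then obtain a b where "x \<in> box a b" "cbox a b \<subseteq> E"
      by (rule open_contains_cbox[OF open_E]) (rule that)
    then show "x \<in> \<Union>\<F>" by (auto simp: \<F>_def)
  qed
  moreover have "\<Union>\<F> \<subseteq> E" using box_subset_cbox by (fastforce simp: \<F>_def)
  ultimately have UE: "E = \<Union>(insert {} \<F>')" using F' by auto
  define B where "B = from_nat_into (insert {} \<F>')"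
  have B: "insert {} \<F>' = range B"
    unfolding B_def by (rule range_from_nat_into[symmetric]) (use F' in auto)
  have "\<exists>a b. B m = box a b \<and> cbox a b \<subseteq> E" for m
  proof -
    have "B m \<in> insert {} \<F>'" unfolding B by (rule rangeI)
    then have "B m \<in> \<F>" using F'(1) \<open>{} \<in> \<F>\<close> by auto
    then show ?thesis by (auto simp: \<F>_def)
  qed
  then obtain a b where "\<And>m. B m = box (a m) (b m)" "\<And>m. cbox (a m) (b m) \<subseteq> E" by metis
  with UE B show thesis by (intro that[of a b]) auto
qed

text \<open>\<open>E\<close> is exhausted by finite unions of boxes. Each new box is used only
  outside the earlier ones, and this cut is absorbed into the factor \<open>f\<close>, for which
  \<open>sym_at_nonneg\<close> asks no regularity.\<close>

lemma Pt_symmetric: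
  assumes u: "u \<in> test_fun E" "h > 0" and f: "good f" "\<And>x. 0 \<le> f x"
  shows "ip \<mu> (Pt h f) u = ip \<mu> f (T h u)"
proof -
  obtain a b :: "nat \<Rightarrow> real^'d" where ab: "\<And>m. cbox (a m) (b m) \<subseteq> E" "E = (\<Union>m. box (a m) (b m))"
    using countable_boxes by blast
  obtain C where C: "C \<ge> 0" "\<And>x. x \<in> E \<Longrightarrow> \<bar>f x\<bar> \<le> C" by (rule good_bound[OF f(1)]) (rule that)
  define U where "U n = (\<Union>m<n. box (a m) (b m))" for n
  have Ub: "U n \<in> sets borel" for n unfolding U_def by auto
  have "sym_at h u (\<lambda>x. f x * indicator (U n) x)" for n
  proof (induction n)
    case 0
    then show ?case
      using sym_at_zero
      by (simp add: U_def)
  next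
    case (Suc n)
    have g: "good (\<lambda>x. f x * indicator (- U n) x)" using f Ub by (intro good_mult_indicator) auto
    have s: "sym_at h u (\<lambda>x. (f x * indicator (- U n) x) * indicator (box (a n) (b n)) x)"
      using f(2) C by (intro sym_at_nonneg[OF u ab(1) good_meas[OF g], of C])
        (auto simp: indicator_def intro: order_trans[OF abs_ge_self])
    have "sym_at h u (\<lambda>x. 1 * (f x * indicator (U n) x) + 1 * ((f x * indicator (- U n) x) * indicator (box (a n) (b n)) x))"
      using Suc s f Ub by (intro sym_at_lin[OF u] good_mult_indicator) auto
    moreover have "1 * (f x * indicator (U n) x) + 1 * ((f x * indicator (- U n) x) * indicator (box (a n) (b n)) x) = f x * indicator (U (Suc n)) x" for x
      by (auto simp: U_def lessThan_Suc indicator_def)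
    ultimately show ?case by simp
  qed
  note sym = this
  have "sym_at h u f"
  proof (rule sym_at_lim(2)[OF u, of "\<lambda>n x. f x * indicator (U n) x" f])
    show "(\<lambda>n. f x * indicator (U n) x) \<longlonglongrightarrow> f x" if "x \<in> E" for x
    proof -
      have "(\<lambda>n. f x * indicator (U n) x) \<longlonglongrightarrow> f x * indicator (\<Union>m. box (a m) (b m)) x"
        unfolding U_def by (intro tendsto_mult tendsto_const LIMSEQ_indicator_UN)
      then show ?thesis using that ab(2) by simp
    qed
    show "good (\<lambda>x. f x * indicator (U n) x)" for n by (rule good_mult_indicator[OF f(1) Ub])
    show "\<bar>f x * indicator (U n) x\<bar> \<le> \<bar>f x\<bar>" for n x by (simp add: indicator_def)
  qed (use f sym good_meas in auto)
  then show ?thesis by (simp add: sym_at_def)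
qed

subsection \<open>Hitting probabilities along a time grid\<close>

text \<open>With \<open>\<tau>\<close> the first \<open>k\<close> such that \<open>X (k h)\<close> lies in \<open>A\<close>, \<open>grid_hit \<alpha> h A N x\<close> is the expectation
  of \<open>\<alpha>\<^sup>\<tau>\<close> on \<open>\<tau> \<le> N\<close>.\<close>

primrec grid_hit :: "real \<Rightarrow> real \<Rightarrow> (real^'d) set \<Rightarrow> nat \<Rightarrow> real^'d \<Rightarrow> real" where
  "grid_hit \<alpha> h A 0 = indicator A"
| "grid_hit \<alpha> h A (Suc N) = (\<lambda>x. indicator A x + \<alpha> * (Pt h (grid_hit \<alpha> h A N) x * indicator (E - A) x))"

lemma good_grid_hit:
  assumes "good (indicator A)" "A \<in> sets borel" "h > 0"
  shows "good (grid_hit \<alpha> h A N)"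
proof (induction N)
  case (Suc N)
  then show ?case
    unfolding grid_hit.simps using assms
    by (intro good_add good_cmult good_mult_indicator good_Pt) auto
qed (use assms in simp)

lemma Pt_nonneg:
  assumes "good f" "x \<in> E" "0 \<le> t" "\<And>y. y \<in> E \<Longrightarrow> 0 \<le> f y" shows "0 \<le> Pt t f x"
  using Pt_mono[OF good_cmult[OF assms(1), of 0] assms(1-3)] assms(4)
    Pt_lin[OF assms(1,1,2,3), of 0 0] by simp

lemma grid_hit_bounds:
  assumes "good (indicator A)" "A \<in> sets borel" "h > 0" "0 \<le> \<alpha>" "\<alpha> \<le> 1"
  shows "0 \<le> grid_hit \<alpha> h A N x" "x \<in> E \<Longrightarrow> grid_hit \<alpha> h A N x \<le> 1"
proof -
  have "(\<forall>x. 0 \<le> grid_hit \<alpha> h A N x) \<and> (\<forall>x\<in>E. grid_hit \<alpha> h A N x \<le> 1)"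
  proof (induction N)
    case (Suc N)
    have g: "good (grid_hit \<alpha> h A N)" using assms by (intro good_grid_hit)
    have 0: "0 \<le> Pt h (grid_hit \<alpha> h A N) x" if "x \<in> E" for x
      using Suc assms that by (intro Pt_nonneg[OF g]) auto
    have "\<bar>Pt h (grid_hit \<alpha> h A N) x\<bar> \<le> 1" if "x \<in> E" for x
      using Suc assms that by (intro Pt_bound[OF g]) auto
    then have 1: "\<alpha> * Pt h (grid_hit \<alpha> h A N) x \<le> 1" if "x \<in> E" for x
      using assms 0[OF that] that by (intro mult_le_one) (auto simp: abs_le_iff)
    show ?case using 0 1 assms by (auto simp: indicator_def)
  qed (auto simp: indicator_def)
  then show "0 \<le> grid_hit \<alpha> h A N x" "x \<in> E \<Longrightarrow> grid_hit \<alpha> h A N x \<le> 1" by auto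
qed

text \<open>The increment is the expectation of \<open>\<alpha>\<^sup>\<tau>\<close> on the event
  that \<open>A\<close> is first met at step N + 1, hence at most \<alpha>^(N+1). Off
  \<open>A\<close> it is \<alpha> times the transition operator applied to the previous increment,
  which gives the induction.\<close>

lemma grid_hit_increment:
  assumes "good (indicator A)" "A \<in> sets borel" "h > 0" "0 \<le> \<alpha>" "\<alpha> \<le> 1" "x \<in> E"
  shows "0 \<le> grid_hit \<alpha> h A (Suc N) x - grid_hit \<alpha> h A N x"
    and "grid_hit \<alpha> h A (Suc N) x - grid_hit \<alpha> h A N x \<le> \<alpha> ^ Suc N"
proof -
  note g = good_grid_hit[OF assms(1-3)]
  note b = grid_hit_bounds[OF assms(1-5)]
  have "0 \<le> grid_hit \<alpha> h A (Suc N) x - grid_hit \<alpha> h A N x \<and>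
      grid_hit \<alpha> h A (Suc N) x - grid_hit \<alpha> h A N x \<le> \<alpha> ^ Suc N"
    using assms(6)
  proof (induction N arbitrary: x)
    case 0
    have "0 \<le> Pt h (grid_hit \<alpha> h A 0) x" using b 0 assms(3) by (intro Pt_nonneg[OF g]) auto
    moreover have "\<bar>Pt h (grid_hit \<alpha> h A 0) x\<bar> \<le> 1" using b 0 assms(3) by (intro Pt_bound[OF g]) auto
    then have "\<alpha> * Pt h (grid_hit \<alpha> h A 0) x \<le> \<alpha> * 1" using assms(4) by (intro mult_left_mono) auto
    ultimately show ?case using assms(4) by (auto simp: indicator_def)
  next
    case (Suc N)
    define d where "d y = 1 * grid_hit \<alpha> h A (Suc N) y + (-1) * grid_hit \<alpha> h A N y" for y
    have gd: "good d" unfolding d_def[abs_def] using g by (intro good_add good_cmult)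
    have "0 \<le> d y \<and> d y \<le> \<alpha> ^ Suc N" if "y \<in> E" for y using Suc.IH[OF that] unfolding d_def by simp
    then have "0 \<le> Pt h d x" "\<bar>Pt h d x\<bar> \<le> \<alpha> ^ Suc N"
      using assms Suc.prems by (auto intro!: Pt_nonneg[OF gd] Pt_bound[OF gd])
    moreover have "Pt h d x = 1 * Pt h (grid_hit \<alpha> h A (Suc N)) x + (-1) * Pt h (grid_hit \<alpha> h A N) x"
      unfolding d_def[abs_def] using assms Suc.prems by (intro Pt_lin g) auto
    moreover have "grid_hit \<alpha> h A (Suc (Suc N)) x - grid_hit \<alpha> h A (Suc N) x =
        \<alpha> * ((1 * Pt h (grid_hit \<alpha> h A (Suc N)) x + (-1) * Pt h (grid_hit \<alpha> h A N) x) * indicator (E - A) x)"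
      by (simp only: grid_hit.simps) (simp add: algebra_simps)
    ultimately have eq: "grid_hit \<alpha> h A (Suc (Suc N)) x - grid_hit \<alpha> h A (Suc N) x = \<alpha> * (Pt h d x * indicator (E - A) x)"
      and d: "0 \<le> Pt h d x" "Pt h d x \<le> \<alpha> ^ Suc N" by auto
    have "Pt h d x * indicator (E - A) x \<le> \<alpha> ^ Suc N" "0 \<le> Pt h d x * indicator (E - A) x"
      using d assms(4) by (auto simp: indicator_def)
    then show ?case unfolding eq using assms(4) by (auto intro!: mult_left_mono)
  qed
  then show "0 \<le> grid_hit \<alpha> h A (Suc N) x - grid_hit \<alpha> h A N x"
    "grid_hit \<alpha> h A (Suc N) x - grid_hit \<alpha> h A N x \<le> \<alpha> ^ Suc N" by auto
qed

lemma level_set: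
  assumes "u \<in> test_fun E"
  shows "good (indicator {x. u x > 1})" "open {x. u x > 1}" "{x. u x > 1} \<subseteq> E" "{x. u x > 1} \<in> sets borel"
proof -
  from assms obtain K where K: "smooth u" "compact K" "K \<subseteq> E" "\<And>x. x \<notin> K \<Longrightarrow> u x = 0"
    using test_funE by blast
  show o: "open {x. u x > 1}"
    using smooth_continuous[OF K(1), of UNIV] by (intro open_Collect_less continuous_on_const)
  then show b: "{x. u x > 1} \<in> sets borel" by simp
  have AK: "{x. u x > 1} \<subseteq> K"
  proof
    fix x assume "x \<in> {x. u x > 1}"
    then show "x \<in> K" using K(4)[of x] by (cases "x \<in> K") auto
  qed
  then show AE: "{x. u x > 1} \<subseteq> E" using K(3) by blast
  have "{x. u x > 1} \<in> sets \<mu>" using b AE by (auto simp: sets_\<mu> sets_restrict_space_iff)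
  then show "good (indicator {x. u x > 1})" by (rule good_indicator[OF _ AK K(2,3)])
qed

text \<open>Off \<open>A\<close>, \<open>\<phi> - \<alpha> P\<^sub>h \<phi>\<close> vanishes up to a geometrically small error for \<open>\<phi> = grid_hit \<alpha> h A N\<close>, so
  \<open>\<phi>\<close> nearly minimises the form \<open>\<langle>f, f - \<alpha> P\<^sub>h f\<rangle>\<close> among the \<open>f\<close> that are at least \<open>1\<close> on \<open>A\<close>.\<close>

lemma grid_hit_energy:
  assumes u: "u \<in> test_fun E" and h: "h > 0"
  shows "nsq \<mu> (grid_hit (exp (- h)) h {x. u x > 1} N0) \<le> nsq \<mu> u + form u u"
proof -
  define A where "A = {x. u x > 1}"
  define \<alpha> where "\<alpha> = exp (- h)"
  have \<alpha>: "0 < \<alpha>" "\<alpha> < 1" using h by (auto simp: \<alpha>_def)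
  then have \<alpha>': "0 \<le> \<alpha>" "\<alpha> \<le> 1" by auto
  note A = level_set[OF u, folded A_def]
  define \<phi> where "\<phi> N = grid_hit \<alpha> h A N" for N
  have g: "good (\<phi> N)" for N unfolding \<phi>_def using A h by (intro good_grid_hit) 
  have b: "0 \<le> \<phi> N x" "x \<in> E \<Longrightarrow> \<phi> N x \<le> 1" for N x
    unfolding \<phi>_def using grid_hit_bounds[OF A(1,4) h \<alpha>'] by auto
  have inc: "0 \<le> \<phi> (Suc N) x - \<phi> N x" "\<phi> (Suc N) x - \<phi> N x \<le> \<alpha> ^ Suc N" if "x \<in> E" for N x
    unfolding \<phi>_def using grid_hit_increment[OF A(1,4) h \<alpha>' that] by auto
  define C where "C = (LINT x|\<mu>. \<bar>u x\<bar>)"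
  define q where "q f = nsq \<mu> f - \<alpha> * ip \<mu> f (T h f)" for f
  have Lu: "L2 \<mu> u" "integrable \<mu> u" using test_fun_L2[OF u] by auto
  have L: "L2 \<mu> (\<phi> N)" for N using g by (rule good_L2)
  have LT: "L2 \<mu> (T h u)" "L2 \<mu> (T h (\<phi> N))" "L2 \<mu> (Pt h (\<phi> N))" for N
    using h Lu L good_L2[OF good_Pt[OF g h]] by (auto intro: L2_T)
  \<comment> \<open>Let B be the bilinear form of q. Then q(\<phi>) - B(u, \<phi>) is at most C
    \<alpha>^(N+1), and 0 \<le> q(\<phi> - u) = q(\<phi>) - 2 B(u, \<phi>) + q(u); eliminating B(u,
    \<phi>) gives the claim.\<close>
  have main: "q (\<phi> N) \<le> q u + 2 * C * \<alpha> ^ Suc N" for N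
  proof -
    define d where "d x = \<phi> N x - \<alpha> * Pt h (\<phi> N) x" for x
    have Ld: "L2 \<mu> d" unfolding d_def[abs_def] using L LT by (intro L2_diff L2_cmult)
    \<comment> \<open>On \<open>A\<close>, \<phi> = 1 < u and d \<ge> 0, so the difference is at
      most 0. Off \<open>A\<close>, d is minus an increment of the hitting function and hence
      geometrically small.\<close>
    have pw: "\<phi> N x * d x - u x * d x \<le> \<bar>u x\<bar> * \<alpha> ^ Suc N" if x: "x \<in> E" for x
    proof (cases "x \<in> A")
      case True
      have "\<phi> N x = 1"
        unfolding \<phi>_def using True by (cases N) (auto simp: indicator_def)
      moreover have "\<bar>Pt h (\<phi> N) x\<bar> \<le> 1" using b x h by (intro Pt_bound[OF g]) auto
      then have "\<alpha> * Pt h (\<phi> N) x \<le> 1"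
        using \<alpha>' Pt_nonneg[OF g x _ b(1)] h by (intro mult_le_one) (auto simp: abs_le_iff)
      moreover have "u x > 1" using True by (simp add: A_def)
      ultimately have "(1 - u x) * (1 - \<alpha> * Pt h (\<phi> N) x) \<le> 0" "\<phi> N x = 1"
        by (auto intro!: mult_nonpos_nonneg)
      moreover have "0 \<le> \<bar>u x\<bar> * \<alpha> ^ Suc N" using \<alpha>' by simp
      ultimately show ?thesis unfolding d_def by (simp add: algebra_simps)
    next
      case False
      then have eq: "d x = - (\<phi> (Suc N) x - \<phi> N x)"
        unfolding d_def \<phi>_def using x by simp
      have "\<phi> N x * d x \<le> 0" using b inc[OF x] unfolding eq by (intro mult_nonneg_nonpos) auto
      moreover have "\<bar>u x * d x\<bar> \<le> \<bar>u x\<bar> * \<alpha> ^ Suc N"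
        unfolding abs_mult eq using inc[OF x] by (intro mult_left_mono) auto
      ultimately show ?thesis by linarith
    qed
    have "ip \<mu> (\<phi> N) d - ip \<mu> u d \<le> C * \<alpha> ^ Suc N"
    proof -
      have "ip \<mu> (\<phi> N) d - ip \<mu> u d = (LINT x|\<mu>. \<phi> N x * d x - u x * d x)"
        using L2_integrable_mult[OF L Ld] L2_integrable_mult[OF Lu(1) Ld] by (simp add: ip_def)
      also have "\<dots> \<le> (LINT x|\<mu>. \<bar>u x\<bar> * \<alpha> ^ Suc N)"
        using pw L2_integrable_mult[OF L Ld] L2_integrable_mult[OF Lu(1) Ld] Lu(2) by (intro integral_mono) auto
      finally show ?thesis by (simp add: C_def)
    qed
    moreover have "ip \<mu> (\<phi> N) d = q (\<phi> N)"
    proof -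
      have "ip \<mu> (\<phi> N) d = nsq \<mu> (\<phi> N) - \<alpha> * ip \<mu> (\<phi> N) (Pt h (\<phi> N))"
        unfolding d_def[abs_def] using L LT by (simp add: ip_diff_right L2_cmult ip_cmult_right)
      also have "ip \<mu> (\<phi> N) (Pt h (\<phi> N)) = ip \<mu> (\<phi> N) (T h (\<phi> N))"
        using ip_Pt[OF g h L, of N N] by (simp add: ip_commute)
      finally show ?thesis by (simp add: q_def)
    qed
    moreover have ud: "ip \<mu> u d = ip \<mu> u (\<phi> N) - \<alpha> * ip \<mu> (\<phi> N) (T h u)"
    proof -
      have "ip \<mu> u d = ip \<mu> u (\<phi> N) - \<alpha> * ip \<mu> u (Pt h (\<phi> N))"
        unfolding d_def[abs_def] using L LT Lu by (simp add: ip_diff_right L2_cmult ip_cmult_right)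
      also have "ip \<mu> u (Pt h (\<phi> N)) = ip \<mu> (\<phi> N) (T h u)"
        using Pt_symmetric[OF u h g b(1), of N] by (simp add: ip_commute)
      finally show ?thesis .
    qed
    moreover have "0 \<le> q (\<phi> N) - 2 * ip \<mu> u d + q u"
    proof -
      define w where "w x = \<phi> N x - u x" for x
      have Lw: "L2 \<mu> w" unfolding w_def[abs_def] using L Lu by (intro L2_diff)
      have "AE x in \<mu>. T h w x = T h (\<phi> N) x - T h u x"
        unfolding w_def[abs_def] using h L Lu by (intro T_diff) auto
      then have "ip \<mu> w (T h w) = ip \<mu> w (\<lambda>x. T h (\<phi> N) x - T h u x)"
        using h Lw LT L Lu by (intro ip_cong_AE L2_measurable L2_T L2_diff) auto
      also have "\<dots> = ip \<mu> (\<phi> N) (T h (\<phi> N)) - ip \<mu> (\<phi> N) (T h u) - ip \<mu> u (T h (\<phi> N)) + ip \<mu> u (T h u)"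
        unfolding w_def[abs_def] using L Lu LT by (simp add: ip_diff_left ip_diff_right L2_diff)
      also have "ip \<mu> u (T h (\<phi> N)) = ip \<mu> (\<phi> N) (T h u)"
        using ip_Pt[OF g h Lu(1), of N] Pt_symmetric[OF u h g b(1), of N] by (simp add: ip_commute)
      finally have 1: "ip \<mu> w (T h w) = ip \<mu> (\<phi> N) (T h (\<phi> N)) - 2 * ip \<mu> (\<phi> N) (T h u) + ip \<mu> u (T h u)" by simp
      have 2: "nsq \<mu> w = nsq \<mu> (\<phi> N) - 2 * ip \<mu> u (\<phi> N) + nsq \<mu> u"
        unfolding w_def[abs_def] using L Lu by (simp add: ip_diff_left ip_diff_right L2_diff ip_commute[of \<mu> "\<phi> N" u])
      have "\<alpha> * ip \<mu> w (T h w) \<le> \<alpha> * nsq \<mu> w" using T_ip_le[OF _ Lw, of h] h \<alpha>' by (intro mult_left_mono) auto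
      also have "\<dots> \<le> 1 * nsq \<mu> w" using \<alpha>' by (intro mult_right_mono nsq_nonneg) auto
      finally have "0 \<le> nsq \<mu> w - \<alpha> * ip \<mu> w (T h w)" by simp
      then show ?thesis unfolding 1 2 ud q_def by (simp add: algebra_simps)
    qed
    ultimately show ?thesis by linarith
  qed
  \<comment> \<open>Here \<alpha> h \<le> 1 - \<alpha> because e^h \<ge> 1 + h. The same factor 1 -
    \<alpha> stands in the lower bound for q(\<phi>), so it cancels and the final estimate does not
    depend on h.\<close>
  have qu: "q u \<le> (1 - \<alpha>) * (nsq \<mu> u + form u u)"
  proof -
    have "\<alpha> * (nsq \<mu> u - ip \<mu> u (T h u)) \<le> \<alpha> * (h * form u u)"
      using T_dissipation[OF u, of h] h \<alpha>' by (intro mult_left_mono) auto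
    also have "\<dots> \<le> (1 - \<alpha>) * form u u"
    proof -
      have "1 + h \<le> exp h" by (rule exp_ge_add_one_self)
      then have "\<alpha> * (1 + h) \<le> \<alpha> * exp h" using \<alpha>' by (intro mult_left_mono)
      also have "\<alpha> * exp h = 1" by (simp add: \<alpha>_def flip: exp_add)
      finally have "\<alpha> * h \<le> 1 - \<alpha>" by (simp add: algebra_simps)
      then have "\<alpha> * h * form u u \<le> (1 - \<alpha>) * form u u" by (intro mult_right_mono form_nonneg)
      then show ?thesis by (simp add: mult.assoc)
    qed
    finally show ?thesis by (simp add: q_def algebra_simps)
  qed
  \<comment> \<open>\<phi> increases in N, so the norm at N0 may be estimated at N0 + n; letting n
    tend to infinity removes the geometric error.\<close>
  have bound: "(1 - \<alpha>) * nsq \<mu> (\<phi> N0) \<le> q u + 2 * C * \<alpha> ^ Suc (N0 + n)" for n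
  proof -
    have "\<phi> N0 x \<le> \<phi> (N0 + n) x" if "x \<in> E" for x
      using inc(1)[OF that] by (induction n) (auto intro: order_trans)
    then have "nsq \<mu> (\<phi> N0) \<le> nsq \<mu> (\<phi> (N0 + n))"
      unfolding ip_def using b(1) L2_integrable_mult[OF L L] by (intro integral_mono) (auto intro!: mult_mono)
    then have "(1 - \<alpha>) * nsq \<mu> (\<phi> N0) \<le> (1 - \<alpha>) * nsq \<mu> (\<phi> (N0 + n))" using \<alpha> by (intro mult_left_mono) auto
    also have "\<dots> \<le> q (\<phi> (N0 + n))"
    proof -
      have "\<alpha> * ip \<mu> (\<phi> (N0 + n)) (T h (\<phi> (N0 + n))) \<le> \<alpha> * nsq \<mu> (\<phi> (N0 + n))"
        using T_ip_le[OF _ L, of h] h \<alpha>' by (intro mult_left_mono) auto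
      then show ?thesis by (simp add: q_def algebra_simps)
    qed
    also have "\<dots> \<le> q u + 2 * C * \<alpha> ^ Suc (N0 + n)" by (rule main)
    finally show ?thesis .
  qed
  have "(\<lambda>n. q u + 2 * C * \<alpha> ^ Suc (N0 + n)) \<longlonglongrightarrow> q u + 2 * C * 0"
  proof (intro tendsto_intros)
    have "(\<lambda>n. \<alpha> ^ n) \<longlonglongrightarrow> 0" using \<alpha> by (intro LIMSEQ_realpow_zero) auto
    from LIMSEQ_ignore_initial_segment[OF this, of "Suc N0"]
    show "(\<lambda>n. \<alpha> ^ Suc (N0 + n)) \<longlonglongrightarrow> 0" by (simp add: add.commute)
  qed
  then have "(1 - \<alpha>) * nsq \<mu> (\<phi> N0) \<le> q u + 2 * C * 0"
    using bound by (intro LIMSEQ_le_const) auto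
  then have "(1 - \<alpha>) * nsq \<mu> (\<phi> N0) \<le> (1 - \<alpha>) * (nsq \<mu> u + form u u)" using qu by simp
  then show ?thesis using \<alpha> by (simp add: \<phi>_def A_def \<alpha>_def)
qed

text \<open>On \<tau> \<le> N the discount \<open>\<alpha>\<^sup>\<tau>\<close> is at least
  \<alpha>^N.\<close>

lemma grid_hit_discount:
  assumes "good (indicator A)" "A \<in> sets borel" "h > 0" "0 \<le> \<alpha>" "\<alpha> \<le> 1" "x \<in> E"
  shows "\<alpha> ^ N * grid_hit 1 h A N x \<le> grid_hit \<alpha> h A N x"
  using assms(6)
proof (induction N arbitrary: x)
  case (Suc N)
  have g: "good (grid_hit 1 h A N)" "good (grid_hit \<alpha> h A N)" using assms by (auto intro: good_grid_hit)
  have "Pt h (\<lambda>y. \<alpha> ^ N * grid_hit 1 h A N y + 0 * grid_hit 1 h A N y) x \<le> Pt h (grid_hit \<alpha> h A N) x"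
    using assms Suc by (intro Pt_mono good_add good_cmult g) auto
  then have le: "\<alpha> ^ N * Pt h (grid_hit 1 h A N) x \<le> Pt h (grid_hit \<alpha> h A N) x"
    using Pt_lin[OF g(1) g(1) Suc.prems, of h "\<alpha> ^ N" 0] assms(3) by simp
  have "\<alpha> ^ Suc N \<le> 1" using assms by (intro power_le_one)
  moreover have "\<alpha> * (\<alpha> ^ N * Pt h (grid_hit 1 h A N) x) \<le> \<alpha> * Pt h (grid_hit \<alpha> h A N) x"
    using le assms by (intro mult_left_mono)
  ultimately show ?case by (auto simp: indicator_def mult.assoc)
qed simp

text \<open>2^m steps of length 2^(-m) cover a unit of time, over which the discount is at least
  e^(-1). Undoing it costs a factor e, squared in the norm.\<close>

lemma grid_hit_unit_time_energy:
  assumes u: "u \<in> test_fun E"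
  shows "nsq \<mu> (grid_hit 1 ((1/2) ^ m) {x. u x > 1} (2 ^ m)) \<le> (exp 1)\<^sup>2 * (nsq \<mu> u + form u u)"
proof -
  define A where "A = {x. u x > 1}"
  note A = level_set[OF u, folded A_def]
  define h :: real where "h = (1/2) ^ m"
  have h: "h > 0" "real (2 ^ m) * h = 1" by (auto simp: h_def power_divide)
  define \<psi> where "\<psi> = grid_hit 1 h A (2 ^ m)"
  define \<phi> where "\<phi> = grid_hit (exp (- h)) h A (2 ^ m)"
  have g: "good \<psi>" "good \<phi>" unfolding \<psi>_def \<phi>_def using A h by (auto intro: good_grid_hit)
  have "exp (- h) ^ (2 ^ m) = exp (- 1)"
    using h(2) by (simp flip: exp_of_nat_mult)
  then have "exp (- 1) * \<psi> x \<le> \<phi> x" if "x \<in> E" for x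
    using grid_hit_discount[OF A(1,4) h(1) _ _ that, of "exp (- h)" "2 ^ m"] h(1) unfolding \<psi>_def \<phi>_def by simp
  then have "exp 1 * (exp (- 1) * \<psi> x) \<le> exp 1 * \<phi> x" if "x \<in> E" for x
    using that by (intro mult_left_mono) auto
  then have le: "\<psi> x \<le> exp 1 * \<phi> x" if "x \<in> E" for x
    using that by (simp flip: mult.assoc exp_add)
  have "0 \<le> \<psi> x" for x unfolding \<psi>_def using grid_hit_bounds(1)[OF A(1,4) h(1)] by simp
  then have "nsq \<mu> \<psi> \<le> nsq \<mu> (\<lambda>x. exp 1 * \<phi> x)"
    unfolding ip_def using le L2_integrable_mult[OF good_L2 good_L2] g good_cmult[OF g(2), of "exp 1"]
    by (intro integral_mono) (auto intro!: mult_mono order_trans[OF _ le])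
  also have "\<dots> = (exp 1)\<^sup>2 * nsq \<mu> \<phi>"
    by (simp add: ip_cmult_left ip_cmult_right power2_eq_square)
  also have "\<dots> \<le> (exp 1)\<^sup>2 * (nsq \<mu> u + form u u)"
    unfolding \<phi>_def A_def using grid_hit_energy[OF u h(1)] by (intro mult_left_mono) auto
  finally show ?thesis by (simp add: \<psi>_def A_def h_def)
qed

end

section \<open>From hitting along the grid to hitting in continuous time\<close>

lemma ex_le_Suc_iff: "(\<exists>k\<le>Suc N. Q k) \<longleftrightarrow> Q 0 \<or> (\<exists>k\<le>N. Q (Suc k))"
  by (metis Suc_le_mono le0 not0_implies_Suc)

lemma emeasure_lborel_open_pos:
  fixes V :: "'a::euclidean_space set"
  assumes "open V" "x \<in> V" shows "emeasure lborel V > 0"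
proof -
  obtain a b where ab: "box a b \<subseteq> V" "\<forall>i\<in>Basis. a \<bullet> i < b \<bullet> i"
    using open_contains_box[OF assms] by metis
  have "0 < ennreal (\<Prod>i\<in>Basis. (b - a) \<bullet> i)"
    using ab(2) by (simp add: inner_diff_left prod_pos)
  also have "\<dots> = emeasure lborel (box a b)"
    using ab(2) by (intro emeasure_lborel_box[symmetric]) (auto intro: less_imp_le)
  also have "\<dots> \<le> emeasure lborel V" using ab(1) assms(1) by (intro emeasure_mono) auto
  finally show ?thesis .
qed

context associated_process
begin

text \<open>Either the set is occupied at time s (\<open>G1\<close>), or the search restarts at s +
  h on the remaining event \<open>G2\<close>, which is why s and \<open>G\<close> vary in the
  induction. The Markov property turns the restarted search into one application of
  \<open>Pt h\<close>.\<close>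

lemma grid_hit_prob:
  assumes u: "u \<in> test_fun E" and h: "h > 0" and x: "x \<in> E"
    and "0 \<le> s" "G \<in> sets (F (ennreal s))"
  shows "(LINT \<omega>|P (Some x). indicator (G \<inter> {\<omega>\<in>space M. \<exists>k\<le>N. X (s + real k * h) \<omega> \<in> Some ` {x. u x > 1}}) \<omega>) =
    (LINT \<omega>|P (Some x). indicator G \<omega> * ext0 (grid_hit 1 h {x. u x > 1} N) (X s \<omega>))"
  using assms(4,5)
proof (induction N arbitrary: s G)
  define A where "A = {x. u x > 1}"
  note A = level_set[OF u, folded A_def]
  define H where "H s N = {\<omega>\<in>space M. \<exists>k\<le>N. X (s + real k * h) \<omega> \<in> Some ` A}" for s N
  have x': "Some x \<in> topspace SC" using x by simp
  have spP: "space (P (Some x)) = space M" by (rule space_P[OF x'])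
  have sP: "sets (P (Some x)) = sets M" by (rule sets_P[OF x'])
  interpret prob_space "P (Some x)" by (rule prob_space_P[OF x'])
  have A\<mu>: "A \<in> sets \<mu>" using A by (auto simp: sets_\<mu> sets_restrict_space_iff)
  then have ABC: "Some ` A \<in> sets BC" by (rule Some_image_sets)
  have ev: "{\<omega>\<in>space M. X s \<omega> \<in> Some ` A} \<in> sets (F (ennreal s))" if "0 \<le> s" for s
    by (rule X_event[OF that ABC])
  have HM: "H s N \<in> sets M" if "0 \<le> s" for s N
  proof -
    have "H s N = (\<Union>k\<le>N. {\<omega>\<in>space M. X (s + real k * h) \<omega> \<in> Some ` A})" by (auto simp: H_def)
    also have "\<dots> \<in> sets M" using that h ABC by (intro sets.finite_UN X_event_M) auto
    finally show ?thesis .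
  qed
  have FM: "G \<in> sets M" if "G \<in> sets (F (ennreal s))" for G s using that sets_F_le by blast
  have ii: "integrable (P (Some x)) (\<lambda>\<omega>. indicator B \<omega> :: real)" if "B \<in> sets M" for B
    using that by (intro integrable_real_indicator) (simp_all add: sP emeasure_eq_measure)
  {
    case 0
    show ?case
    proof (rule Bochner_Integration.integral_cong[OF refl])
      fix \<omega> assume \<omega>: "\<omega> \<in> space (P (Some x))"
      show "indicator (G \<inter> {\<omega>\<in>space M. \<exists>k\<le>0. X (s + real k * h) \<omega> \<in> Some ` {x. u x > 1}}) \<omega> =
          indicator G \<omega> * ext0 (grid_hit 1 h {x. u x > 1} 0) (X s \<omega>)"
        using \<omega> by (cases "X s \<omega>") (auto simp: spP indicator_def ext0_def)
    qed
  next
    case (Suc N)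
    have g: "good (grid_hit 1 h A N)" using A h by (intro good_grid_hit)
    define G1 where "G1 = G \<inter> {\<omega>\<in>space M. X s \<omega> \<in> Some ` A}"
    define G2 where "G2 = G - {\<omega>\<in>space M. X s \<omega> \<in> Some ` A}"
    have G1: "G1 \<in> sets (F (ennreal s))" and G2: "G2 \<in> sets (F (ennreal s))"
      unfolding G1_def G2_def using Suc.prems ev by auto
    have "ennreal s \<le> ennreal (s + h)" using h by (intro ennreal_leI) simp
    then have G2': "G2 \<in> sets (F (ennreal (s + h)))" using G2 sets_F_mono by blast
    have i1: "integrable (P (Some x)) (\<lambda>\<omega>. indicator G1 \<omega> :: real)" by (rule ii[OF FM[OF G1]])
    have i2: "integrable (P (Some x)) (\<lambda>\<omega>. indicator (G2 \<inter> H (s + h) N) \<omega> :: real)"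
      using Suc.prems h by (intro ii sets.Int FM[OF G2] HM) auto
    have i3: "integrable (P (Some x)) (\<lambda>\<omega>. indicator G2 \<omega> * ext0 (Pt h (grid_hit 1 h A N)) (X s \<omega>))"
    proof -
      have "G2 \<in> sets (P (Some x))" unfolding sP by (rule FM[OF G2])
      from integrable_mult_indicator[OF this good_Pt_integrable[OF good_Pt[OF g h] x Suc.prems(1)]]
      show ?thesis by simp
    qed
    have "indicator (G \<inter> H s (Suc N)) \<omega> = (indicator G1 \<omega> + indicator (G2 \<inter> H (s + h) N) \<omega> :: real)" if "\<omega> \<in> space M" for \<omega>
    proof -
      have "(\<exists>k\<le>Suc N. X (s + real k * h) \<omega> \<in> Some ` A) \<longleftrightarrow>
          X s \<omega> \<in> Some ` A \<or> (\<exists>k\<le>N. X (s + h + real k * h) \<omega> \<in> Some ` A)"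
      proof -
        have "s + real (Suc k) * h = s + h + real k * h" for k by (simp add: algebra_simps)
        then show ?thesis
          using ex_le_Suc_iff[of N "\<lambda>k. X (s + real k * h) \<omega> \<in> Some ` A"]
          by (simp add: add.assoc)
      qed
      then show ?thesis using that by (auto simp: H_def G1_def G2_def indicator_def)
    qed
    then have "(LINT \<omega>|P (Some x). indicator (G \<inter> H s (Suc N)) \<omega>) =
        (LINT \<omega>|P (Some x). indicator G1 \<omega> + indicator (G2 \<inter> H (s + h) N) \<omega> :: real)"
      by (intro Bochner_Integration.integral_cong) (auto simp: spP)
    also have "\<dots> = (LINT \<omega>|P (Some x). indicator G1 \<omega>) + (LINT \<omega>|P (Some x). indicator (G2 \<inter> H (s + h) N) \<omega>)"
      by (rule Bochner_Integration.integral_add[OF i1 i2])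
    also have "(LINT \<omega>|P (Some x). indicator (G2 \<inter> H (s + h) N) \<omega>) =
        (LINT \<omega>|P (Some x). indicator G2 \<omega> * ext0 (grid_hit 1 h A N) (X (s + h) \<omega>))"
      unfolding H_def A_def using Suc.prems h G2' by (intro Suc.IH) auto
    also have "\<dots> = (LINT \<omega>|P (Some x). indicator G2 \<omega> * ext0 (Pt h (grid_hit 1 h A N)) (X s \<omega>))"
      using grid_hit_bounds(1)[OF A(1,4) h, of 1] by (intro markov_good[OF x Suc.prems(1) h G2 g]) auto
    also have "(LINT \<omega>|P (Some x). indicator G1 \<omega>) + \<dots> =
        (LINT \<omega>|P (Some x). indicator G1 \<omega> + indicator G2 \<omega> * ext0 (Pt h (grid_hit 1 h A N)) (X s \<omega>))"
      by (rule Bochner_Integration.integral_add[OF i1 i3, symmetric])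
    also have "\<dots> = (LINT \<omega>|P (Some x). indicator G \<omega> * ext0 (grid_hit 1 h A (Suc N)) (X s \<omega>))"
    proof (rule Bochner_Integration.integral_cong[OF refl])
      fix \<omega> assume \<omega>: "\<omega> \<in> space (P (Some x))"
      show "indicator G1 \<omega> + indicator G2 \<omega> * ext0 (Pt h (grid_hit 1 h A N)) (X s \<omega>) =
          indicator G \<omega> * ext0 (grid_hit 1 h A (Suc N)) (X s \<omega>)"
        by (rule X_cases[OF x Suc.prems(1) \<omega>]) (use \<omega> in \<open>auto simp: spP G1_def G2_def indicator_def ext0_def\<close>)
    qed
    finally show ?case unfolding H_def A_def .
  }
qed

text \<open>\<open>H s\<close> is the event of a visit to the level set at some time s + k 2^(-m)
  \<le> s + 1. The dyadic grids are nested, so its probability is a limit of grid probabilities; and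
  as the level set is open, a continuous path that visits it is caught by a fine enough
  grid.\<close>

lemma unit_time_hit:
  assumes u: "u \<in> test_fun E"
  obtains \<Psi> H where "good \<Psi>" "\<And>x. x \<in> E \<Longrightarrow> 0 \<le> \<Psi> x \<and> \<Psi> x \<le> 1"
    "nsq \<mu> \<Psi> \<le> (exp 1)\<^sup>2 * (nsq \<mu> u + form u u)"
    "\<And>s. 0 \<le> s \<Longrightarrow> H s \<in> sets M"
    "\<And>s. 0 \<le> s \<Longrightarrow> {\<omega>\<in>space M. \<exists>t. s \<le> t \<and> t < s + 1 \<and> ext0 u (X t \<omega>) > 1} \<subseteq> H s"
    "\<And>s x. 0 \<le> s \<Longrightarrow> x \<in> E \<Longrightarrow> measure (P (Some x)) (H s) = (LINT \<omega>|P (Some x). ext0 \<Psi> (X s \<omega>))"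
proof -
  define A where "A = {x. u x > 1}"
  note A = level_set[OF u, folded A_def]
  define h :: "nat \<Rightarrow> real" where "h m = (1/2) ^ m" for m
  have h: "h m > 0" "real (2 ^ m) * h m = 1" "h m = 2 * h (Suc m)" for m by (auto simp: h_def power_divide)
  define D where "D s m = {\<omega>\<in>space M. \<exists>k\<le>2 ^ m. X (s + real k * h m) \<omega> \<in> Some ` A}" for s m
  define H where "H s = (\<Union>m. D s m)" for s
  define \<psi> where "\<psi> m = grid_hit 1 (h m) A (2 ^ m)" for m
  define \<Psi> where "\<Psi> x = measure (P (Some x)) (H 0)" for x
  have A\<mu>: "A \<in> sets \<mu>" using A by (auto simp: sets_\<mu> sets_restrict_space_iff)
  then have ABC: "Some ` A \<in> sets BC" by (rule Some_image_sets)
  have DM: "D s m \<in> sets M" if "0 \<le> s" for s m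
  proof -
    have "D s m = (\<Union>k\<le>2 ^ m. {\<omega>\<in>space M. X (s + real k * h m) \<omega> \<in> Some ` A})" unfolding D_def by blast
    also have "\<dots> \<in> sets M" using that h(1)[of m] ABC by (intro sets.finite_UN X_event_M) auto
    finally show ?thesis .
  qed
  have HM: "H s \<in> sets M" if "0 \<le> s" for s unfolding H_def using DM[OF that] by auto
  have inc: "incseq (D s)" for s
  proof (rule incseq_SucI, rule subsetI)
    fix m \<omega> assume "\<omega> \<in> D s m"
    then obtain k where k: "\<omega> \<in> space M" "k \<le> 2 ^ m" "X (s + real k * h m) \<omega> \<in> Some ` A" by (auto simp: D_def)
    have "real k * h m = real (2 * k) * h (Suc m)" using h(3)[of m] by simp
    with k(3) have "X (s + real (2 * k) * h (Suc m)) \<omega> \<in> Some ` A" by (simp only:)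
    moreover have "2 * k \<le> 2 ^ Suc m" using k(2) by simp
    ultimately show "\<omega> \<in> D s (Suc m)" using k(1) unfolding D_def by blast
  qed
  have g: "good (\<psi> m)" for m unfolding \<psi>_def by (rule good_grid_hit[OF A(1,4) h(1)])
  have b: "0 \<le> \<psi> m x" "x \<in> E \<Longrightarrow> \<psi> m x \<le> 1" for m x
    unfolding \<psi>_def using grid_hit_bounds[OF A(1,4) h(1), of 1] by auto
  have Dprob: "measure (P (Some x)) (D s m) = (LINT \<omega>|P (Some x). ext0 (\<psi> m) (X s \<omega>))"
    if "0 \<le> s" "x \<in> E" for s m x
  proof -
    have x': "Some x \<in> topspace SC" using that by simp
    have "space M \<in> sets (F (ennreal s))" using sets.top[of "F (ennreal s)"] by (simp add: space_F)
    from grid_hit_prob[OF u h(1) that(2,1) this, of "2 ^ m" m]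
    have "(LINT \<omega>|P (Some x). indicator (space M \<inter> D s m) \<omega>) = (LINT \<omega>|P (Some x). indicator (space M) \<omega> * ext0 (\<psi> m) (X s \<omega>))"
      unfolding D_def \<psi>_def A_def .
    also have "\<dots> = (LINT \<omega>|P (Some x). ext0 (\<psi> m) (X s \<omega>))"
      by (intro Bochner_Integration.integral_cong) (auto simp: space_P[OF x'])
    also have "space M \<inter> D s m = D s m" unfolding D_def by blast
    finally show ?thesis
      by (simp add: Int_absorb2 space_P[OF x'] sets.sets_into_space[OF DM[OF that(1)]])
  qed
  have lim: "(\<lambda>m. measure (P (Some x)) (D s m)) \<longlonglongrightarrow> measure (P (Some x)) (H s)" if "0 \<le> s" "x \<in> E" for s x
  proof -
    have x': "Some x \<in> topspace SC" using that by simp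
    interpret prob_space "P (Some x)" by (rule prob_space_P[OF x'])
    show ?thesis unfolding H_def using inc DM[OF that(1)] sets_P[OF x']
      by (intro finite_Lim_measure_incseq) auto
  qed
  have start0: "measure (P (Some x)) (D 0 m) = \<psi> m x" if x: "x \<in> E" for m x
  proof -
    have x': "Some x \<in> topspace SC" using x by simp
    interpret prob_space "P (Some x)" by (rule prob_space_P[OF x'])
    have "(LINT \<omega>|P (Some x). ext0 (\<psi> m) (X 0 \<omega>)) = (LINT \<omega>|P (Some x). \<psi> m x)"
    proof (rule integral_cong_AE)
      show "AE \<omega> in P (Some x). ext0 (\<psi> m) (X 0 \<omega>) = \<psi> m x"
        using start[OF x'] by eventually_elim (simp add: ext0_def)
    qed (use ext0_X_measurable(2)[OF good_meas[OF g] _ x] in auto)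
    then show ?thesis using Dprob[OF _ x, of 0 m] by (simp add: prob_space)
  qed
  have \<Psi>lim: "(\<lambda>m. \<psi> m x) \<longlonglongrightarrow> \<Psi> x" if "x \<in> E" for x
    using lim[OF _ that, of 0] start0[OF that] by (simp add: \<Psi>_def)
  have \<Psi>01: "0 \<le> \<Psi> x \<and> \<Psi> x \<le> 1" if "x \<in> E" for x
    using prob_space.prob_le_1[OF prob_space_P[OF Some_in_SC[OF that]]] by (simp add: \<Psi>_def)
  have \<psi>m [measurable]: "\<psi> m \<in> borel_measurable \<mu>" for m using g by (rule good_meas)
  have \<Psi>m [measurable]: "\<Psi> \<in> borel_measurable \<mu>"
    by (rule borel_measurable_LIMSEQ_real[OF _ \<psi>m]) (use \<Psi>lim in simp)
  define B where "B = (exp 1)\<^sup>2 * (nsq \<mu> u + form u u)"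
  have B0: "B \<ge> 0" unfolding B_def by (intro mult_nonneg_nonneg add_nonneg_nonneg nsq_nonneg form_nonneg) auto
  \<comment> \<open>Fatou's lemma carries the energy bound, uniform in m, over to the limit.\<close>
  have nB: "(\<integral>\<^sup>+x. ennreal (\<Psi> x * \<Psi> x) \<partial>\<mu>) \<le> ennreal B"
  proof -
    have "(\<integral>\<^sup>+x. ennreal (\<Psi> x * \<Psi> x) \<partial>\<mu>) = (\<integral>\<^sup>+x. liminf (\<lambda>m. ennreal (\<psi> m x * \<psi> m x)) \<partial>\<mu>)"
    proof (rule nn_integral_cong)
      fix x assume "x \<in> space \<mu>"
      then have "(\<lambda>m. ennreal (\<psi> m x * \<psi> m x)) \<longlonglongrightarrow> ennreal (\<Psi> x * \<Psi> x)"
        by (intro tendsto_ennrealI tendsto_mult \<Psi>lim) auto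
      then show "ennreal (\<Psi> x * \<Psi> x) = liminf (\<lambda>m. ennreal (\<psi> m x * \<psi> m x))"
        by (rule lim_imp_Liminf[OF trivial_limit_sequentially, symmetric])
    qed
    also have "\<dots> \<le> liminf (\<lambda>m. \<integral>\<^sup>+x. ennreal (\<psi> m x * \<psi> m x) \<partial>\<mu>)"
      by (rule nn_integral_liminf) measurable
    also have "\<dots> \<le> liminf (\<lambda>m::nat. ennreal B)"
    proof (intro Liminf_mono always_eventually allI)
      fix m
      have "(\<integral>\<^sup>+x. ennreal (\<psi> m x * \<psi> m x) \<partial>\<mu>) = ennreal (nsq \<mu> (\<psi> m))"
        unfolding ip_def by (rule nn_integral_eq_integral[OF L2_integrable_mult[OF good_L2[OF g] good_L2[OF g]]]) simp
      also have "\<dots> \<le> ennreal B"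
        unfolding B_def \<psi>_def h_def A_def by (intro ennreal_leI grid_hit_unit_time_energy u)
      finally show "(\<integral>\<^sup>+x. ennreal (\<psi> m x * \<psi> m x) \<partial>\<mu>) \<le> ennreal B" .
    qed
    finally show ?thesis by (simp add: Liminf_const)
  qed
  have int\<Psi>: "integrable \<mu> (\<lambda>x. \<Psi> x * \<Psi> x)"
    using nB by (intro integrableI_bounded) (auto intro: le_less_trans)
  have good\<Psi>: "good \<Psi>"
    unfolding good_def L2_def using \<Psi>m int\<Psi> \<Psi>01 by (auto simp: power2_eq_square intro!: exI[of _ 1])
  have "ennreal (nsq \<mu> \<Psi>) \<le> ennreal B"
    unfolding ip_def using nB by (subst nn_integral_eq_integral[OF int\<Psi>, symmetric]) auto
  then have nsq: "nsq \<mu> \<Psi> \<le> B" using B0 by (simp add: ennreal_le_iff)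
  have prob: "measure (P (Some x)) (H s) = (LINT \<omega>|P (Some x). ext0 \<Psi> (X s \<omega>))" if "0 \<le> s" "x \<in> E" for s x
  proof -
    have x': "Some x \<in> topspace SC" using that by simp
    interpret prob_space "P (Some x)" by (rule prob_space_P[OF x'])
    have "(\<lambda>m. LINT \<omega>|P (Some x). ext0 (\<psi> m) (X s \<omega>)) \<longlonglongrightarrow> (LINT \<omega>|P (Some x). ext0 \<Psi> (X s \<omega>))"
    proof (rule integral_dominated_convergence[where w="\<lambda>_. 1"])
      show "AE \<omega> in P (Some x). (\<lambda>m. ext0 (\<psi> m) (X s \<omega>)) \<longlonglongrightarrow> ext0 \<Psi> (X s \<omega>)"
      proof (rule AE_I2)
        fix \<omega> assume \<omega>: "\<omega> \<in> space (P (Some x))"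
        show "(\<lambda>m. ext0 (\<psi> m) (X s \<omega>)) \<longlonglongrightarrow> ext0 \<Psi> (X s \<omega>)"
          by (rule X_cases[OF that(2,1) \<omega>]) (use \<Psi>lim in \<open>auto simp: ext0_def\<close>)
      qed
      show "AE \<omega> in P (Some x). norm (ext0 (\<psi> m) (X s \<omega>)) \<le> 1" for m
        unfolding real_norm_def using b by (intro AE_I2 ext0_bound[OF that(2,1)]) auto
    qed (use ext0_X_measurable(2)[OF \<psi>m that] ext0_X_measurable(2)[OF \<Psi>m that] in auto)
    with lim[OF that] show ?thesis unfolding Dprob[OF that] by (rule LIMSEQ_unique)
  qed
  have sub: "{\<omega>\<in>space M. \<exists>t. s \<le> t \<and> t < s + 1 \<and> ext0 u (X t \<omega>) > 1} \<subseteq> H s" if s: "0 \<le> s" for s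
  proof (rule subsetI)
    fix \<omega> assume "\<omega> \<in> {\<omega>\<in>space M. \<exists>t. s \<le> t \<and> t < s + 1 \<and> ext0 u (X t \<omega>) > 1}"
    then obtain t where \<omega>: "\<omega> \<in> space M" and t: "s \<le> t" "t < s + 1" "ext0 u (X t \<omega>) > 1" by auto
    from u obtain K where K: "smooth u" "compact K" "K \<subseteq> E" "\<And>x. x \<notin> K \<Longrightarrow> u x = 0"
      using test_funE by blast
    have cont: "continuous_on {0..} (\<lambda>t. ext0 u (X t \<omega>))"
      by (rule path_continuous[OF smooth_continuous[OF K(1)] K(2,3) K(4) \<omega>])
    \<comment> \<open>The last point of grid m not after t. It tends to t, so by continuity
      \<open>u\<close> along the path exceeds 1 at \<open>r m\<close> for large m.\<close>
    define r where "r m = s + real (nat \<lfloor>(t - s) * 2 ^ m\<rfloor>) * h m" for m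
    have rb: "t - h m \<le> r m" "r m \<le> t" "r m \<ge> 0" for m
    proof -
      define y where "y = (t - s) * 2 ^ m"
      have y: "0 \<le> y" "y * h m = t - s" using t by (auto simp: y_def h_def power_divide)
      have fl: "real (nat \<lfloor>y\<rfloor>) \<le> y" "y - 1 \<le> real (nat \<lfloor>y\<rfloor>)" using y(1) by linarith+
      have "real (nat \<lfloor>y\<rfloor>) * h m \<le> y * h m" "(y - 1) * h m \<le> real (nat \<lfloor>y\<rfloor>) * h m"
        using fl h(1)[of m] by (auto intro!: mult_right_mono)
      then show "t - h m \<le> r m" "r m \<le> t" unfolding r_def y_def[symmetric] using y(2) by (auto simp: algebra_simps)
      show "r m \<ge> 0" unfolding r_def using s h(1)[of m] by simp
    qed
    have "(\<lambda>m. t - h m) \<longlonglongrightarrow> t - 0" unfolding h_def by (intro tendsto_intros LIMSEQ_realpow_zero) auto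
    then have "r \<longlonglongrightarrow> t" using rb by (intro real_tendsto_sandwich[of "\<lambda>m. t - h m" r sequentially "\<lambda>_. t"]) auto
    moreover have "continuous (at t within {0..}) (\<lambda>t. ext0 u (X t \<omega>))"
      using cont s t by (simp add: continuous_on_eq_continuous_within)
    ultimately have "(\<lambda>m. ext0 u (X (r m) \<omega>)) \<longlonglongrightarrow> ext0 u (X t \<omega>)"
      using continuous_within_tendsto_compose'[of t "{0..}" "\<lambda>t. ext0 u (X t \<omega>)" r sequentially] rb by auto
    then have "\<forall>\<^sub>F m in sequentially. ext0 u (X (r m) \<omega>) > 1" using t(3) by (rule order_tendstoD)
    then obtain m where m: "ext0 u (X (r m) \<omega>) > 1" by (auto simp: eventually_sequentially)
    then have "X (r m) \<omega> \<in> Some ` A" by (cases "X (r m) \<omega>") (auto simp: ext0_def A_def)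
    moreover have "nat \<lfloor>(t - s) * 2 ^ m\<rfloor> \<le> 2 ^ m"
    proof -
      have "(t - s) * 2 ^ m \<le> 1 * 2 ^ m" using t by (intro mult_right_mono) auto
      then have "\<lfloor>(t - s) * 2 ^ m\<rfloor> \<le> \<lfloor>2 ^ m :: real\<rfloor>" by (intro floor_mono) simp
      then show ?thesis by (simp add: nat_le_iff)
    qed
    ultimately have "\<omega> \<in> D s m" using \<omega> unfolding D_def r_def by blast
    then show "\<omega> \<in> H s" by (auto simp: H_def)
  qed
  show thesis
    by (rule that[OF good\<Psi> \<Psi>01 nsq[unfolded B_def] HM sub prob])
qed

text \<open>By contraction \<open>T t\<close> maps the indicator to 0 almost everywhere. Strong
  Feller continuity upgrades this to every starting point, since a nonempty open set has positive
  Lebesgue measure.\<close>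

lemma null_set_not_charged:
  assumes "N \<in> null_sets \<mu>" "x \<in> E" "t > 0"
  shows "AE \<omega> in P (Some x). X t \<omega> \<notin> Some ` N"
proof -
  interpret prob_space "P (Some x)" by (rule prob_space_P[OF Some_in_SC[OF assms(2)]])
  have N: "N \<in> sets \<mu>" "emeasure \<mu> N = 0" using assms(1) by auto
  have NE: "N \<subseteq> E" using sets.sets_into_space[OF N(1)] by simp
  have ae0: "AE y in \<mu>. y \<notin> N" by (rule AE_not_in[OF assms(1)])
  have "integrable \<mu> (\<lambda>x. indicator N x :: real)" using N by (intro integrable_real_indicator) auto
  then have "L2 \<mu> (indicator N)"
  proof -
    have "(\<lambda>x. (indicator N x :: real)\<^sup>2) = indicator N" by (auto simp: indicator_def fun_eq_iff)
    moreover assume "integrable \<mu> (\<lambda>x. indicator N x :: real)"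
    ultimately show ?thesis unfolding L2_def using N(1) by simp
  qed
  then have g: "good (indicator N)" unfolding good_def by (auto intro!: exI[of _ 1] simp: indicator_def)
  have "nsq \<mu> (indicator N) = ip \<mu> (\<lambda>_. 0) (\<lambda>_. 0)"
    using ae0 N(1) by (intro ip_cong_AE) auto
  then have n0: "nsq \<mu> (indicator N) = 0" by (simp add: ip_def)
  have "nsq \<mu> (T t (indicator N)) \<le> nsq \<mu> (indicator N)" using assms(3) g by (intro contraction good_L2) auto
  then have "nsq \<mu> (T t (indicator N)) = 0" using n0 nsq_nonneg[of \<mu> "T t (indicator N)"] by simp
  then have "AE y in \<mu>. T t (indicator N) y = 0" using assms(3) g by (intro nsq_zero_AE L2_T good_L2) auto
  moreover have "AE y in \<mu>. Pt t (indicator N) y = T t (indicator N) y" using assms(3) g by (intro T_associated(2) good_L2) auto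
  ultimately have "AE y in \<mu>. Pt t (indicator N) y = 0" by eventually_elim simp
  then have aeL: "AE y in lborel. y \<in> E \<longrightarrow> Pt t (indicator N) y = 0" by (simp add: AE_\<mu>_iff)
  have cont: "continuous_on E (Pt t (indicator N))" by (rule Pt_cont[OF g assms(3)])
  have Pt0: "Pt t (indicator N) x = 0"
  proof (rule ccontr)
    assume nz: "Pt t (indicator N) x \<noteq> 0"
    define V where "V = E \<inter> Pt t (indicator N) -` (- {0})"
    have V: "open V" unfolding V_def by (intro continuous_open_preimage cont open_E) auto
    have "x \<in> V" using nz assms(2) by (simp add: V_def)
    have "AE y in lborel. y \<notin> V" using aeL by eventually_elim (auto simp: V_def)
    then have "V \<in> null_sets lborel" using V by (subst (asm) AE_iff_null_sets[symmetric]) auto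
    then have "emeasure lborel V = 0" by auto
    then show False using V \<open>x \<in> V\<close> using emeasure_lborel_open_pos[OF V] by force
  qed
  have int: "integrable (P (Some x)) (\<lambda>\<omega>. ext0 (indicator N) (X t \<omega>))"
    using assms by (intro good_Pt_integrable g) auto
  have "AE \<omega> in P (Some x). ext0 (indicator N) (X t \<omega>) = (0::real)"
    using Pt0 integral_nonneg_eq_0_iff_AE[OF int]
    by (auto simp: transition_def ext0_def split: option.splits)
  then show ?thesis by eventually_elim (auto simp: ext0_def)
qed

end

subsection \<open>Triple collisions\<close>

text \<open>A nonnegative continuous function on a compact interval has a zero iff its values at
  rational times come below every 1/(l+1). Rationality of the left endpoint covers a zero at that
  endpoint, also when the interval is a single point.\<close>

lemma zero_time_measurable:
  fixes w :: "'w \<Rightarrow> real \<Rightarrow> real"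
  assumes cont: "\<And>\<omega>. \<omega> \<in> space M \<Longrightarrow> continuous_on {\<alpha>..\<beta>} (w \<omega>)"
    and meas: "\<And>t. t \<in> {\<alpha>..\<beta>} \<Longrightarrow> (\<lambda>\<omega>. w \<omega> t) \<in> borel_measurable M"
    and nonneg: "\<And>\<omega> t. 0 \<le> w \<omega> t" and "\<alpha> \<in> \<rat>" "\<alpha> \<le> \<beta>"
  shows "{\<omega>\<in>space M. \<exists>t\<in>{\<alpha>..\<beta>}. w \<omega> t = 0} \<in> sets M"
proof -
  have "{\<omega>\<in>space M. \<exists>t\<in>{\<alpha>..\<beta>}. w \<omega> t = 0} =
      (\<Inter>l::nat. \<Union>q\<in>\<rat> \<inter> {\<alpha>..\<beta>}. {\<omega>\<in>space M. w \<omega> q < 1 / real (Suc l)})" (is "?L = ?R")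
  proof (intro equalityI subsetI)
    fix \<omega> assume "\<omega> \<in> ?L"
    then obtain t where \<omega>: "\<omega> \<in> space M" and t: "t \<in> {\<alpha>..\<beta>}" "w \<omega> t = 0" by auto
    have "\<exists>q\<in>\<rat> \<inter> {\<alpha>..\<beta>}. w \<omega> q < 1 / real (Suc l)" for l
    proof -
      have "0 < 1 / real (Suc l)" by simp
      from cont[OF \<omega>, unfolded continuous_on_iff, rule_format, OF t(1) this]
      obtain d where d: "d > 0" "\<And>s. s \<in> {\<alpha>..\<beta>} \<Longrightarrow> dist s t < d \<Longrightarrow> dist (w \<omega> s) (w \<omega> t) < 1 / real (Suc l)"
        by blast
      obtain q where q: "q \<in> \<rat>" "q \<in> {\<alpha>..\<beta>}" "dist q t < d"
      proof (cases "t = \<alpha>")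
        case True
        then show thesis using that[of \<alpha>] assms(4) t(1) d(1) by auto
      next
        case False
        then have "max \<alpha> (t - d) < t" using t(1) d(1) by auto
        then obtain q where "q \<in> \<rat>" "max \<alpha> (t - d) < q" "q < t" using Rats_dense_in_real by blast
        then show thesis using that[of q] t(1) by (auto simp: dist_real_def)
      qed
      then show ?thesis using d(2)[OF q(2,3)] t(2) by (intro bexI[of _ q]) (auto simp: dist_real_def)
    qed
    with \<omega> show "\<omega> \<in> ?R" by blast
  next
    fix \<omega> assume R: "\<omega> \<in> ?R"
    then have \<omega>: "\<omega> \<in> space M" by blast
    obtain t where t: "t \<in> {\<alpha>..\<beta>}" "\<And>s. s \<in> {\<alpha>..\<beta>} \<Longrightarrow> w \<omega> t \<le> w \<omega> s"
      using continuous_attains_inf[OF compact_Icc _ cont[OF \<omega>]] assms(5) by (metis atLeastatMost_empty_iff)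
    have "w \<omega> t \<le> 1 / real (Suc l)" for l
    proof -
      obtain q where "q \<in> {\<alpha>..\<beta>}" "w \<omega> q < 1 / real (Suc l)" using R by blast
      then show ?thesis using t(2)[of q] by simp
    qed
    then have "w \<omega> t \<le> 0" by (intro LIMSEQ_le_const[OF LIMSEQ_Suc[OF lim_const_over_n[of 1]]]) auto
    then have "w \<omega> t = 0" using nonneg[of \<omega> t] by simp
    with \<omega> t(1) show "\<omega> \<in> ?L" by blast
  qed
  also have "\<dots> \<in> sets M"
  proof -
    have "{\<omega>\<in>space M. w \<omega> q < 1 / real (Suc l)} \<in> sets M" if "q \<in> \<rat> \<inter> {\<alpha>..\<beta>}" for l q
      using meas[of q] that by (intro borel_measurable_less) auto
    then have "(\<Union>q\<in>\<rat> \<inter> {\<alpha>..\<beta>}. {\<omega>\<in>space M. w \<omega> q < 1 / real (Suc l)}) \<in> sets M" for l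
      by (intro sets.countable_UN' countable_Int1[OF countable_rat]) auto
    then show ?thesis by (intro sets.countable_INT) auto
  qed
  finally show ?thesis .
qed

context associated_process
begin

text \<open>The hitting functions tend to 0 in \<open>L\<^sup>2\<close>, hence along a subsequence
  almost everywhere. The law of X(\<delta>) does not charge the exceptional set, so the
  probabilities of a hit after time \<delta> > 0 tend to 0 from every starting point.
  \<open>N\<close> is the intersection of the corresponding events.\<close>

lemma small_capacity_not_hit:
  assumes v: "\<And>n. v n \<in> test_fun E" "(\<lambda>n. nsq \<mu> (v n) + form (v n) (v n)) \<longlonglongrightarrow> 0"
    and x: "x \<in> E" and \<delta>: "\<delta> > 0"
  obtains N where "N \<in> null_sets (P (Some x))"
    "{\<omega>\<in>space M. \<exists>t. \<delta> \<le> t \<and> t < \<delta> + 1 \<and> (\<forall>n. ext0 (v n) (X t \<omega>) > 1)} \<subseteq> N"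
proof -
  have x': "Some x \<in> topspace SC" using x by simp
  interpret prob_space "P (Some x)" by (rule prob_space_P[OF x'])
  define Q where "Q n \<Psi> H \<longleftrightarrow> good \<Psi> \<and> (\<forall>x\<in>E. 0 \<le> \<Psi> x \<and> \<Psi> x \<le> 1) \<and>
    nsq \<mu> \<Psi> \<le> (exp 1)\<^sup>2 * (nsq \<mu> (v n) + form (v n) (v n)) \<and> H \<in> sets M \<and>
    {\<omega>\<in>space M. \<exists>t. \<delta> \<le> t \<and> t < \<delta> + 1 \<and> ext0 (v n) (X t \<omega>) > 1} \<subseteq> H \<and>
    measure (P (Some x)) H = (LINT \<omega>|P (Some x). ext0 \<Psi> (X \<delta> \<omega>))" for n \<Psi> H
  have "\<exists>\<Psi> H. Q n \<Psi> H" for n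
  proof -
    obtain \<Psi> H where *: "good \<Psi>" "\<And>x. x \<in> E \<Longrightarrow> 0 \<le> \<Psi> x \<and> \<Psi> x \<le> 1"
      "nsq \<mu> \<Psi> \<le> (exp 1)\<^sup>2 * (nsq \<mu> (v n) + form (v n) (v n))"
      "\<And>s. 0 \<le> s \<Longrightarrow> H s \<in> sets M"
      "\<And>s. 0 \<le> s \<Longrightarrow> {\<omega>\<in>space M. \<exists>t. s \<le> t \<and> t < s + 1 \<and> ext0 (v n) (X t \<omega>) > 1} \<subseteq> H s"
      "\<And>s x. 0 \<le> s \<Longrightarrow> x \<in> E \<Longrightarrow> measure (P (Some x)) (H s) = (LINT \<omega>|P (Some x). ext0 \<Psi> (X s \<omega>))"
      by (rule unit_time_hit[OF v(1)[of n]]) (rule that)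
    have "Q n \<Psi> (H \<delta>)"
      unfolding Q_def
      by (intro conjI ballI *(1,3) *(4-6)[OF less_imp_le[OF \<delta>]] *(6)[OF _ x]) (use *(2) x in auto)
    then show ?thesis by blast
  qed
  then obtain \<Psi> H where Q: "\<And>n. Q n (\<Psi> n) (H n)" by metis
  have g: "good (\<Psi> n)" and b: "\<And>x. x \<in> E \<Longrightarrow> 0 \<le> \<Psi> n x \<and> \<Psi> n x \<le> 1"
    and nb: "nsq \<mu> (\<Psi> n) \<le> (exp 1)\<^sup>2 * (nsq \<mu> (v n) + form (v n) (v n))" and HM: "H n \<in> sets M"
    and sub: "{\<omega>\<in>space M. \<exists>t. \<delta> \<le> t \<and> t < \<delta> + 1 \<and> ext0 (v n) (X t \<omega>) > 1} \<subseteq> H n"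
    and pr: "measure (P (Some x)) (H n) = (LINT \<omega>|P (Some x). ext0 (\<Psi> n) (X \<delta> \<omega>))" for n
    using Q[of n] unfolding Q_def by auto
  have int: "integrable \<mu> (\<lambda>y. \<Psi> n y * \<Psi> n y)" for n
    by (intro L2_integrable_mult good_L2 g)
  have lim0: "(\<lambda>n. (exp 1)\<^sup>2 * (nsq \<mu> (v n) + form (v n) (v n))) \<longlonglongrightarrow> 0"
    using tendsto_mult_right_zero[OF v(2), of "(exp 1)\<^sup>2"] .
  have "(\<lambda>n. LINT y|\<mu>. norm (\<Psi> n y * \<Psi> n y)) \<longlonglongrightarrow> 0"
  proof (rule Lim_null_comparison[OF always_eventually lim0], rule allI)
    fix n
    have "(LINT y|\<mu>. norm (\<Psi> n y * \<Psi> n y)) = nsq \<mu> (\<Psi> n)" by (simp add: ip_def)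
    then show "norm (LINT y|\<mu>. norm (\<Psi> n y * \<Psi> n y)) \<le> (exp 1)\<^sup>2 * (nsq \<mu> (v n) + form (v n) (v n))"
      using nb[of n] nsq_nonneg[of \<mu> "\<Psi> n"] by simp
  qed
  from tendsto_L1_AE_subseq[OF int this]
  obtain r where r: "strict_mono r" "AE y in \<mu>. (\<lambda>n. \<Psi> (r n) y * \<Psi> (r n) y) \<longlonglongrightarrow> 0" by blast
  then obtain Z where Z: "Z \<in> null_sets \<mu>" "{y\<in>space \<mu>. \<not> (\<lambda>n. \<Psi> (r n) y * \<Psi> (r n) y) \<longlonglongrightarrow> 0} \<subseteq> Z"
    by (auto simp: eventually_ae_filter)
  have \<Psi>0: "(\<lambda>n. \<Psi> (r n) y) \<longlonglongrightarrow> 0" if "y \<in> E" "y \<notin> Z" for y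
  proof -
    have "(\<lambda>n. \<Psi> (r n) y * \<Psi> (r n) y) \<longlonglongrightarrow> 0" using Z(2) that by auto
    then have "(\<lambda>n. sqrt (\<Psi> (r n) y * \<Psi> (r n) y)) \<longlonglongrightarrow> sqrt 0" by (intro tendsto_intros)
    then show ?thesis using b[OF that(1)] by simp
  qed
  have "(\<lambda>n. LINT \<omega>|P (Some x). ext0 (\<Psi> (r n)) (X \<delta> \<omega>)) \<longlonglongrightarrow> (LINT \<omega>|P (Some x). 0)"
  proof (rule integral_dominated_convergence[where w="\<lambda>_. 1"])
    show "AE \<omega> in P (Some x). (\<lambda>n. ext0 (\<Psi> (r n)) (X \<delta> \<omega>)) \<longlonglongrightarrow> 0"
      using null_set_not_charged[OF Z(1) x \<delta>] AE_space
    proof eventually_elim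
      case (elim \<omega>)
      show ?case
        by (rule X_cases[OF x less_imp_le[OF \<delta>] elim(2)]) (use elim(1) \<Psi>0 in \<open>auto simp: ext0_def\<close>)
    qed
    show "AE \<omega> in P (Some x). norm (ext0 (\<Psi> (r n)) (X \<delta> \<omega>)) \<le> 1" for n
      unfolding real_norm_def using b by (intro AE_I2 ext0_bound[OF x less_imp_le[OF \<delta>]]) auto
  qed (use ext0_X_measurable(2)[OF good_meas[OF g] less_imp_le[OF \<delta>] x] in auto)
  then have lim: "(\<lambda>n. measure (P (Some x)) (H (r n))) \<longlonglongrightarrow> 0" unfolding pr by simp
  define N where "N = (\<Inter>n. H (r n))"
  have NM: "N \<in> sets M" unfolding N_def using HM by auto
  have "measure (P (Some x)) N \<le> measure (P (Some x)) (H (r n))" for n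
    using NM HM sets_P[OF x'] by (intro finite_measure_mono) (auto simp: N_def)
  then have "measure (P (Some x)) N \<le> 0" using lim by (intro LIMSEQ_le_const) auto
  then have "measure (P (Some x)) N = 0" using measure_nonneg[of "P (Some x)" N] by simp
  then have "N \<in> null_sets (P (Some x))"
    using NM sets_P[OF x'] by (auto simp: null_sets_def emeasure_eq_measure)
  moreover have "{\<omega>\<in>space M. \<exists>t. \<delta> \<le> t \<and> t < \<delta> + 1 \<and> (\<forall>n. ext0 (v n) (X t \<omega>) > 1)} \<subseteq> N"
    unfolding N_def using sub by blast
  ultimately show thesis by (rule that)
qed

text \<open>Two countable decompositions reduce the claim to \<open>small_capacity_not_hit\<close>:
  by the size of \<open>bump\<close> at the hit, and by unit time windows [q, q + 1) with rational q
  > 0.\<close>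

lemma gap_zero_box_not_hit:
  assumes ijk: "i \<noteq> j" "j \<noteq> k" "i \<noteq> k" and ab: "cbox a b \<subseteq> E" and x: "x \<in> E"
  shows "{\<omega>\<in>space M. \<exists>t>0. X t \<omega> \<in> Some ` {y\<in>box a b. gap i j k y = 0}} \<in> null_sets (P (Some x))"
proof -
  have x': "Some x \<in> topspace SC" using x by simp
  define f where "f = bump a b"
  \<comment> \<open>The gap itself lacks compact support. Multiplied by \<open>bump\<close> it has
    the same zeros in the open box and is continuous along paths up to and beyond the
    lifetime.\<close>
  define g where "g y = gap i j k y * bump a b y" for y
  have ft: "f \<in> test_fun E" and gt: "g \<in> test_fun E"
    unfolding f_def g_def[abs_def] using bump_test_fun[OF ab] by (auto intro: test_fun_mult)
  have path: "continuous_on {0..} (\<lambda>t. ext0 u (X t \<omega>))" if u: "u \<in> test_fun E" and \<omega>: "\<omega> \<in> space M" for u \<omega>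
  proof -
    from u obtain K where K: "smooth u" "compact K" "K \<subseteq> E" "\<And>x. x \<notin> K \<Longrightarrow> u x = 0"
      using test_funE by blast
    show ?thesis by (rule path_continuous[OF smooth_continuous[OF K(1)] K(2,3) K(4) \<omega>])
  qed
  have XM: "(\<lambda>\<omega>. ext0 u (X t \<omega>)) \<in> borel_measurable M" if "u \<in> test_fun E" "0 \<le> t" for u t
    by (rule measurable_from_subalg[OF subalgebra_F ext0_X_measurable(1)[OF good_meas[OF good_test_fun[OF that(1)]] that(2)]])
  have inZ: "X t \<omega> \<in> Some ` {y\<in>box a b. gap i j k y = 0} \<longleftrightarrow> ext0 f (X t \<omega>) > 0 \<and> ext0 g (X t \<omega>) = 0" for t \<omega>
  proof (cases "X t \<omega>")
    case (Some y)
    then show ?thesis using bump_pos_iff[of a b y] by (auto simp: ext0_def f_def g_def)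
  qed (simp add: ext0_def)
  define Ev where "Ev = {\<omega>\<in>space M. \<exists>t>0. X t \<omega> \<in> Some ` {y\<in>box a b. gap i j k y = 0}}"
  \<comment> \<open>A nonnegative process, continuous in time, that vanishes exactly when f \<ge>
    1/(n+1) and g = 0. The threshold turns the open condition f > 0 into closed ones, to which
    \<open>zero_time_measurable\<close> applies.\<close>
  define w where "w n \<omega> t = max 0 (1 / real (Suc n) - ext0 f (X t \<omega>)) + \<bar>ext0 g (X t \<omega>)\<bar>" for n \<omega> t
  have w0: "w n \<omega> t = 0 \<longleftrightarrow> 1 / real (Suc n) \<le> ext0 f (X t \<omega>) \<and> ext0 g (X t \<omega>) = 0" for n \<omega> t
    unfolding w_def by (auto simp: max_def add_nonneg_eq_0_iff)
  have arch: "\<exists>n. 1 / real (Suc n) \<le> s" if "s > 0" for s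
    using reals_Archimedean[OF that] by (auto simp: inverse_eq_divide intro: less_imp_le)
  have "Ev = (\<Union>n. \<Union>m. {\<omega>\<in>space M. \<exists>t\<in>{1 / real (Suc m)..1 / real (Suc m) + real m}. w n \<omega> t = 0})" (is "_ = ?U")
  proof (intro equalityI subsetI)
    fix \<omega> assume "\<omega> \<in> Ev"
    then obtain t where t: "\<omega> \<in> space M" "t > 0" "ext0 f (X t \<omega>) > 0" "ext0 g (X t \<omega>) = 0"
      unfolding Ev_def inZ by auto
    obtain n where n: "1 / real (Suc n) \<le> ext0 f (X t \<omega>)" using arch[OF t(3)] by blast
    obtain m1 where m1: "1 / real (Suc m1) \<le> t" using arch[OF t(2)] by blast
    obtain m2 :: nat where m2: "t \<le> real m2" using real_arch_simple by blast
    define m where "m = max m1 m2"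
    have "1 / real (Suc m) \<le> 1 / real (Suc m1)" by (intro divide_left_mono) (auto simp: m_def)
    moreover have "t \<le> 1 / real (Suc m) + real m"
    proof -
      have "real m2 \<le> real m" "0 \<le> 1 / real (Suc m)" by (auto simp: m_def)
      with m2 show ?thesis by linarith
    qed
    ultimately have "t \<in> {1 / real (Suc m)..1 / real (Suc m) + real m}" using m1 by simp
    moreover have "w n \<omega> t = 0" using n t(4) by (simp add: w0)
    ultimately show "\<omega> \<in> ?U" using t(1) by blast
  next
    fix \<omega> assume "\<omega> \<in> ?U"
    then obtain n m t where t: "\<omega> \<in> space M" "1 / real (Suc m) \<le> t" "w n \<omega> t = 0" by auto
    have "0 < 1 / real (Suc m)" "0 < 1 / real (Suc n)" by simp_all
    then have "0 < t" "0 < ext0 f (X t \<omega>)" "ext0 g (X t \<omega>) = 0" using t unfolding w0 by linarith+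
    then show "\<omega> \<in> Ev" unfolding Ev_def inZ using t(1) by blast
  qed
  also have "\<dots> \<in> sets M"
  proof -
    have "{\<omega>\<in>space M. \<exists>t\<in>{1 / real (Suc m)..1 / real (Suc m) + real m}. w n \<omega> t = 0} \<in> sets M" for n m
    proof (rule zero_time_measurable)
    have pos: "0 \<le> t" if "t \<in> {1 / real (Suc m)..1 / real (Suc m) + real m}" for t
      using that by (auto intro: order_trans[of _ "1 / real (Suc m)"] simp del: of_nat_Suc)
    show "continuous_on {1 / real (Suc m)..1 / real (Suc m) + real m} (w n \<omega>)" if "\<omega> \<in> space M" for \<omega>
      unfolding w_def using pos
      by (intro continuous_intros continuous_on_subset[OF path[OF ft that]] continuous_on_subset[OF path[OF gt that]]) auto
    show "(\<lambda>\<omega>. w n \<omega> t) \<in> borel_measurable M" if "t \<in> {1 / real (Suc m)..1 / real (Suc m) + real m}" for t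
      unfolding w_def using XM[OF ft pos[OF that]] XM[OF gt pos[OF that]] by measurable
    show "0 \<le> w n \<omega> t" for \<omega> t unfolding w_def by simp
    show "1 / real (Suc m) \<in> \<rat>" by simp
    qed simp
    then show ?thesis by (intro sets.countable_nat_UN) auto
  qed
  finally have EvM: "Ev \<in> sets M" .
  have "\<exists>N\<in>null_sets (P (Some x)). {\<omega>\<in>space M. \<exists>t. q \<le> t \<and> t < q + 1 \<and> 1 / real (Suc n) < ext0 f (X t \<omega>) \<and> ext0 g (X t \<omega>) = 0} \<subseteq> N"
    if q: "q > 0" for n q
  proof -
    obtain u where u: "\<And>n. u n \<in> test_fun E" "\<And>n y. gap i j k y = 0 \<Longrightarrow> u n y \<ge> bump a b y"
      "(\<lambda>n. nsq \<mu> (u n) + form (u n) (u n)) \<longlonglongrightarrow> 0"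
      by (rule capacity_zero[OF ijk ab]) (rule that)
    \<comment> \<open>On the zero set u \<ge> \<open>bump\<close>, so where \<open>bump\<close> >
      1/(n+1) the factor n + 1 lifts \<open>u\<close> above the level 1. With n fixed the energies
      still tend to 0.\<close>
    define v where "v m y = real (Suc n) * u m y" for m y
    have vt: "v m \<in> test_fun E" for m unfolding v_def[abs_def] by (rule test_fun_cmult[OF u(1)])
    have "nsq \<mu> (v m) + form (v m) (v m) = (real (Suc n))\<^sup>2 * (nsq \<mu> (u m) + form (u m) (u m))" for m
      unfolding v_def[abs_def] using u(1)[of m]
      by (simp only: ip_cmult_left ip_cmult_right form_cmult_left form_cmult_right test_fun_cmult)
         (simp add: power2_eq_square algebra_simps)
    then have vl: "(\<lambda>m. nsq \<mu> (v m) + form (v m) (v m)) \<longlonglongrightarrow> 0"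
      using tendsto_mult_right_zero[OF u(3), of "(real (Suc n))\<^sup>2"] by simp
    obtain N where N: "N \<in> null_sets (P (Some x))"
      "{\<omega>\<in>space M. \<exists>t. q \<le> t \<and> t < q + 1 \<and> (\<forall>n. ext0 (v n) (X t \<omega>) > 1)} \<subseteq> N"
      by (rule small_capacity_not_hit[OF vt vl x q]) (rule that)
    have "1 < ext0 (v m) (X t \<omega>)" if "1 / real (Suc n) < ext0 f (X t \<omega>)" "ext0 g (X t \<omega>) = 0" for m t \<omega>
    proof (cases "X t \<omega>")
      case None
      then show ?thesis using that(1) by (simp add: ext0_def)
    next
      case (Some y)
      have bp: "1 / real (Suc n) < bump a b y" using that(1) Some by (simp add: ext0_def f_def)
      have "0 < 1 / real (Suc n)" by simp
      then have "bump a b y \<noteq> 0" using bp by linarith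
      then have "gap i j k y = 0" using that(2) Some by (simp add: ext0_def g_def)
      then have "bump a b y \<le> u m y" by (rule u(2))
      then have "1 / real (Suc n) < u m y" using bp by simp
      then show ?thesis using Some by (simp add: ext0_def v_def field_simps)
    qed
    then have "{\<omega>\<in>space M. \<exists>t. q \<le> t \<and> t < q + 1 \<and> 1 / real (Suc n) < ext0 f (X t \<omega>) \<and> ext0 g (X t \<omega>) = 0} \<subseteq> N"
      using N(2) by blast
    with N(1) show ?thesis by blast
  qed
  then have "\<exists>N. \<forall>n q. q > 0 \<longrightarrow> N n q \<in> null_sets (P (Some x)) \<and>
      {\<omega>\<in>space M. \<exists>t. q \<le> t \<and> t < q + 1 \<and> 1 / real (Suc n) < ext0 f (X t \<omega>) \<and> ext0 g (X t \<omega>) = 0} \<subseteq> N n q"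
    by (intro choice allI) blast
  then obtain N where N: "\<And>n q. q > 0 \<Longrightarrow> N n q \<in> null_sets (P (Some x))"
    "\<And>n q. q > 0 \<Longrightarrow> {\<omega>\<in>space M. \<exists>t. q \<le> t \<and> t < q + 1 \<and> 1 / real (Suc n) < ext0 f (X t \<omega>) \<and> ext0 g (X t \<omega>) = 0} \<subseteq> N n q"
    by blast
  have "(\<Union>n. \<Union>q\<in>\<rat> \<inter> {0<..}. N n q) \<in> null_sets (P (Some x))"
    using countable_rat by (intro null_sets_UN' null_sets_UN N(1)) (auto intro: countable_Int1)
  moreover have "Ev \<subseteq> (\<Union>n. \<Union>q\<in>\<rat> \<inter> {0<..}. N n q)"
  proof
    fix \<omega> assume "\<omega> \<in> Ev"
    then obtain t where t: "\<omega> \<in> space M" "t > 0" "ext0 f (X t \<omega>) > 0" "ext0 g (X t \<omega>) = 0"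
      unfolding Ev_def inZ by auto
    obtain n where n: "1 / real (Suc n) < ext0 f (X t \<omega>)"
      using reals_Archimedean[OF t(3)] by (auto simp: inverse_eq_divide)
    have "max 0 (t - 1) < t" using t(2) by simp
    then obtain q where q: "q \<in> \<rat>" "max 0 (t - 1) < q" "q < t" using Rats_dense_in_real by blast
    then have "q > 0" "q \<le> t \<and> t < q + 1" by auto
    then have "\<omega> \<in> N n q" using N(2)[of q n] t n by blast
    then show "\<omega> \<in> (\<Union>n. \<Union>q\<in>\<rat> \<inter> {0<..}. N n q)" using q by auto
  qed
  moreover have "Ev \<in> sets (P (Some x))" unfolding sets_P[OF x'] by (rule EvM)
  ultimately have "Ev \<in> null_sets (P (Some x))" by (metis null_sets_subset)
  then show ?thesis by (simp add: Ev_def)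
qed

text \<open>A countable union over index triples and boxes. In dimension two there are no three
  distinct indices and the union is empty.\<close>

lemma triple_points_not_hit:
  assumes x: "x \<in> E"
  shows "{\<omega>\<in>space (P (Some x)). \<exists>t>0. X t \<omega> \<in> Some ` triple_points E} \<in> null_sets (P (Some x))"
proof -
  obtain a b :: "nat \<Rightarrow> real^'d" where ab: "\<And>m. cbox (a m) (b m) \<subseteq> E" "E = (\<Union>m. box (a m) (b m))"
    by (rule countable_boxes) (rule that)
  define I where "I = {(i, j, k). i \<noteq> j \<and> j \<noteq> k \<and> i \<noteq> (k::'d)}"
  define Z where "Z z m = {y\<in>box (a m) (b m). gap (fst z) (fst (snd z)) (snd (snd z)) y = 0}" for z m
  have "triple_points E = (\<Union>z\<in>I. \<Union>m. Z z m)"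
  proof (intro equalityI subsetI)
    fix y assume "y \<in> triple_points E"
    then obtain i j k where y: "y \<in> E" "i \<noteq> j" "j \<noteq> k" "i \<noteq> k" "y $ i = y $ j" "y $ j = y $ k"
      by (auto simp: triple_points_def)
    then obtain m where "y \<in> box (a m) (b m)" using ab(2) by blast
    with y have "(i, j, k) \<in> I" "y \<in> Z (i, j, k) m" by (auto simp: I_def Z_def gap_def)
    then show "y \<in> (\<Union>z\<in>I. \<Union>m. Z z m)" by blast
  next
    fix y assume "y \<in> (\<Union>z\<in>I. \<Union>m. Z z m)"
    then obtain i j k m where y: "(i, j, k) \<in> I" "y \<in> Z (i, j, k) m" by auto
    then have "y \<in> E" using ab(2) by (auto simp: Z_def)
    moreover have "y $ i = y $ j \<and> y $ j = y $ k"
      using y(2) by (auto simp: Z_def gap_def add_nonneg_eq_0_iff)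
    ultimately show "y \<in> triple_points E" using y(1) by (auto simp: triple_points_def I_def)
  qed
  then have "{\<omega>\<in>space (P (Some x)). \<exists>t>0. X t \<omega> \<in> Some ` triple_points E} =
      (\<Union>z\<in>I. \<Union>m. {\<omega>\<in>space M. \<exists>t>0. X t \<omega> \<in> Some ` Z z m})"
    unfolding space_P[OF Some_in_SC[OF x]] by (auto simp only:)
  also have "\<dots> \<in> null_sets (P (Some x))"
  proof (intro null_sets_UN' null_sets_UN)
    show "countable I" by (rule countable_finite) simp
    fix z m assume "z \<in> I"
    then show "{\<omega>\<in>space M. \<exists>t>0. X t \<omega> \<in> Some ` Z z m} \<in> null_sets (P (Some x))"
      unfolding Z_def using ab(1)[of m] x by (intro gap_zero_box_not_hit) (auto simp: I_def)
  qed simp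
  finally show ?thesis .
qed

end

theorem theorem4p3:
  fixes E :: "(real^'d::finite) set"
    and c :: "real^'d \<Rightarrow> real^'d^'d" and p :: "real^'d \<Rightarrow> real"
    and M :: "'w measure" and F :: "ennreal \<Rightarrow> 'w measure"
    and P :: "(real^'d) option \<Rightarrow> 'w measure" and X :: "real \<Rightarrow> 'w \<Rightarrow> (real^'d) option"
  assumes "CARD('d) \<ge> 2"
    and "open E" and "connected E" and "E \<noteq> {}"
    and "admissible E c p"
    and "associated_hunt_process E c p M F P X"
    and "x \<in> E"
  shows "{\<omega> \<in> space (P (Some x)). \<exists>t>0. X t \<omega> \<in> Some ` triple_points E} \<in> sets (P (Some x)) \<and>
         measure (P (Some x)) {\<omega> \<in> space (P (Some x)). \<exists>t>0. X t \<omega> \<in> Some ` triple_points E} = 0"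
proof -
  interpret hunt_process "top_of_set E" M F P X
    using assms(6) by (simp add: associated_hunt_process_def)
  interpret associated_process E c p M F P X
    by unfold_locales (use assms in auto)
  show ?thesis
    using triple_points_not_hit[OF \<open>x \<in> E\<close>] by (auto simp: null_sets_def measure_def)
qed

end
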